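(* Let $A$ be a nonunital $C^*$-algebra that admits an admissible quasitracial projection scale. Then $A$ has no dense maximal ideal (that is, no maximal ideal of $A$ is norm dense in $A$). In particular, if moreover $A$ is simple (no nonzero proper closed ideals), then $A$ has no maximal ideals.
   Context: Ideals are complex-linear two-sided ideals, not assumed norm closed. A proper ideal $J$ of $A$ satisfies $0\subsetneq J\subsetneq A$; a maximal ideal is one that is maximal among the proper ideals. $\operatorname{Ped}(A)$ is the Pedersen ideal, the smallest norm-dense ideal of $A$. For positive $a,b$ in a $C^*$-algebra, $a\precsim b$ (Cuntz subequivalence) means there are elements $r_n$ of the algebra with $r_n^*br_n\to a$ in norm. $(x-t)_+$ denotes functional calculus with $s\mapsto\max\{s-t,0\}$. A lower semicontinuous $2$-quasitrace on $A$ is a norm-lower semicontinuous map $\tau:A_+\to[0,\infty]$ with $\tau(0)=0$, $\tau(\lambda a)=\lambda\tau(a)$ for $\lambda>0$, $\tau(a+b)=\tau(a)+\tau(b)$ whenever $ab=ba$, $\tau(x^*x)=\tau(xx^* )$ for $x\in A$, and which extends to a map with the same properties on $M_2(A)_+$; it extends canonically to $(A\otimes\mathcal K)_+$. Put $d_\tau(a)=\lim_n\tau(a^{1/n})\in[0,\infty]$. $\tau$ is faithful if $\tau(a)=0$ implies $a=0$ for $a\in A_+$, and densely finite if $d_\tau(a)<\infty$ for every $a\in\operatorname{Ped}(A)_+$. Admissible quasitracial projection scale. Let $(p_n)_{n\ge1}$ be an increasing approximate unit of $A$ consisting of projections, $p_0=0$, $q_n=p_n-p_{n-1}$, with $q_n\neq0$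 for all $n\ge1$. Let $\mathcal T$ be a nonempty family of faithful, densely finite, lower semicontinuous $2$-quasitraces on $A$, each normalized by $d_\tau(p_1)=1$. Put $\mathcal T_{\mathrm{fin}}=\{\tau\in\mathcal T:\sup_n\tau(p_n)<\infty\}$ and $\mathcal T_{\mathrm{inf}}=\{\tau\in\mathcal T:\sup_n\tau(p_n)=\infty\}$. Let $\rho\ge0$, $\varepsilon_0>0$, $e\in\operatorname{Ped}(A)_+$. The tuple $(\mathcal T,\{p_n\},\rho,\mathcal T_{\mathrm{inf}},(\mathcal T_{\mathrm{fin}},e,\varepsilon_0))$ is an admissible quasitracial projection scale if: (1) for every $n\ge1$ and $c\in A_+$: if $d_\tau(q_n)+\rho<d_\tau(c)$ for all $\tau\in\mathcal T$, then $q_n\precsim c$; (2) if $\mathcal T_{\mathrm{inf}}\ne\varnothing$, then $\sup_{\tau\in\mathcal T_{\mathrm{inf}}}\tau(p_n)<\infty$ for every $n$ and $\lim_n\inf_{\tau\in\mathcal T_{\mathrm{inf}}}\tau(p_n)=\infty$; (3) if $\mathcal T_{\mathrm{fin}}\ne\varnothing$, then $\inf_{\tau\in\mathcal T_{\mathrm{fin}}}d_\tau((e-\varepsilon_0)_+)>\rho$ and $\sup_{\tau\in\mathcal T_{\mathrm{fin}}}\bigl(\sup_{j\ge1}\tau(p_j)-\tau(p_n)\bigr)\to0$ as $n\to\infty$. If $\mathcal T_{\mathrm{inf}}$ (resp. $\mathcal T_{\mathrm{fin}}$) is empty, condition (2) (resp. (3)) is regarded as satisfied. "$A$ admits an admissible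 quasitracial projection scale" means that such data exist. *)

theory Defs
  imports "HOL-Analysis.Analysis" "HOL-Computational_Algebra.Polynomial"
begin

section \<open>C*-algebras, not assumed unital\<close>

class cstar_algebra = real_normed_algebra + banach +
  fixes scaleC :: "complex \<Rightarrow> 'a \<Rightarrow> 'a" (infixr \<open>*\<^sub>C\<close> 75)
    and star :: "'a \<Rightarrow> 'a" (\<open>(_\<^sup>\<star>)\<close> [1000] 999)
  assumes scaleC_of_real: "of_real r *\<^sub>C x = r *\<^sub>R x"
    and scaleC_add_left: "(c + d) *\<^sub>C x = c *\<^sub>C x + d *\<^sub>C x"
    and scaleC_add_right: "c *\<^sub>C (x + y) = c *\<^sub>C x + c *\<^sub>C y"
    and scaleC_scaleC: "c *\<^sub>C (d *\<^sub>C x) = (c * d) *\<^sub>C x"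
    and mult_scaleC_left: "(c *\<^sub>C x) * y = c *\<^sub>C (x * y)"
    and mult_scaleC_right: "x * (c *\<^sub>C y) = c *\<^sub>C (x * y)"
    and norm_scaleC: "norm (c *\<^sub>C x) = cmod c * norm x"
    and star_star: "(x\<^sup>\<star>)\<^sup>\<star> = x"
    and star_add: "(x + y)\<^sup>\<star> = x\<^sup>\<star> + y\<^sup>\<star>"
    and star_scaleC: "(c *\<^sub>C x)\<^sup>\<star> = cnj c *\<^sub>C x\<^sup>\<star>"
    and star_mult: "(x * y)\<^sup>\<star> = y\<^sup>\<star> * x\<^sup>\<star>"
    and cstar_identity: "norm (x\<^sup>\<star> * x) = (norm x)\<^sup>2"

text \<open>Multiplication and involution are parameters, so that the same definition serves for
  \<open>A\<close> and for \<open>M\<^sub>2(A)\<close>.\<close>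

definition pos_cone :: "('b \<Rightarrow> 'b \<Rightarrow> 'b) \<Rightarrow> ('b \<Rightarrow> 'b) \<Rightarrow> 'b set" where
  "pos_cone mul st = range (\<lambda>x. mul (st x) x)"

definition positives :: "'a::cstar_algebra set" where
  "positives = pos_cone (*) star"

definition projection :: "'a::cstar_algebra \<Rightarrow> bool" where
  "projection p \<longleftrightarrow> p\<^sup>\<star> = p \<and> p * p = p"


section \<open>Ideals\<close>

definition is_ideal :: "'a::cstar_algebra set \<Rightarrow> bool" where
  "is_ideal J \<longleftrightarrow> 0 \<in> J \<and> (\<forall>x\<in>J. \<forall>y\<in>J. x + y \<in> J) \<and> (\<forall>c. \<forall>x\<in>J. c *\<^sub>C x \<in> J) \<and>
     (\<forall>x\<in>J. \<forall>a. a * x \<in> J \<and> x * a \<in> J)"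

definition proper_ideal :: "'a::cstar_algebra set \<Rightarrow> bool" where
  "proper_ideal J \<longleftrightarrow> is_ideal J \<and> {0} \<subset> J \<and> J \<subset> UNIV"

definition maximal_ideal :: "'a::cstar_algebra set \<Rightarrow> bool" where
  "maximal_ideal J \<longleftrightarrow> proper_ideal J \<and> (\<forall>I. proper_ideal I \<and> J \<subseteq> I \<longrightarrow> I = J)"

definition norm_dense :: "'a::cstar_algebra set \<Rightarrow> bool" where
  "norm_dense S \<longleftrightarrow> closure S = UNIV"

definition Ped :: "'a::cstar_algebra set" where
  "Ped = (LEAST J. is_ideal J \<and> norm_dense J)"


section \<open>Functional calculus and Cuntz subequivalence\<close>

text \<open>Evaluation at \<open>a\<close> of the polynomial \<open>s \<cdot> Q(s)\<close>, which has no constant term and so makes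
  sense without a unit; \<open>((*) a ^^ i) a\<close> is \<open>a\<close> to the power \<open>i + 1\<close>.\<close>

definition poly_eval0 :: "real poly \<Rightarrow> 'a::cstar_algebra \<Rightarrow> 'a" where
  "poly_eval0 Q a = (\<Sum>i\<le>degree Q. coeff Q i *\<^sub>R ((*) a ^^ i) a)"

text \<open>Continuous functional calculus of a positive element \<open>a\<close>, for a continuous \<open>f\<close> on
  \<open>[0,\<infinity>)\<close> with \<open>f 0 = 0\<close>: the norm limit of \<open>P\<^sub>k(a)\<close> for any polynomials \<open>P\<^sub>k\<close> without constant
  term converging to \<open>f\<close> uniformly on \<open>[0, \<parallel>a\<parallel>]\<close>, an interval that contains the spectrum of \<open>a\<close>.\<close>

definition fcalc :: "(real \<Rightarrow> real) \<Rightarrow> 'a::cstar_algebra \<Rightarrow> 'a" where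
  "fcalc f a = (THE b. \<forall>Q :: nat \<Rightarrow> real poly.
     uniform_limit {0..norm a} (\<lambda>k s. s * poly (Q k) s) f sequentially \<longrightarrow>
     (\<lambda>k. poly_eval0 (Q k) a) \<longlonglongrightarrow> b)"

definition cut_down :: "'a::cstar_algebra \<Rightarrow> real \<Rightarrow> 'a" where
  "cut_down a t = fcalc (\<lambda>s. max (s - t) 0) a"

definition cuntz_le :: "'a::cstar_algebra \<Rightarrow> 'a \<Rightarrow> bool" (infix \<open>\<precsim>\<close> 50) where
  "a \<precsim> b \<longleftrightarrow> (\<exists>r :: nat \<Rightarrow> 'a. (\<lambda>n. (r n)\<^sup>\<star> * b * r n) \<longlonglongrightarrow> a)"


section \<open>Lower semicontinuous 2-quasitraces\<close>

definition lsc_on :: "'b::topological_space set \<Rightarrow> ('b \<Rightarrow> ennreal) \<Rightarrow> bool" where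
  "lsc_on S f \<longleftrightarrow> (\<forall>x\<in>S. \<forall>c<f x. \<forall>\<^sub>F y in at x within S. c < f y)"

definition lsc_quasitrace ::
    "('b::real_normed_vector \<Rightarrow> 'b \<Rightarrow> 'b) \<Rightarrow> ('b \<Rightarrow> 'b) \<Rightarrow> ('b \<Rightarrow> ennreal) \<Rightarrow> bool" where
  "lsc_quasitrace mul st \<tau> \<longleftrightarrow>
     lsc_on (pos_cone mul st) \<tau> \<and> \<tau> 0 = 0 \<and>
     (\<forall>t>0. \<forall>a\<in>pos_cone mul st. \<tau> (t *\<^sub>R a) = ennreal t * \<tau> a) \<and>
     (\<forall>a\<in>pos_cone mul st. \<forall>b\<in>pos_cone mul st. mul a b = mul b a \<longrightarrow> \<tau> (a + b) = \<tau> a + \<tau> b) \<and>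
     (\<forall>x. \<tau> (mul (st x) x) = \<tau> (mul x (st x)))"

text \<open>\<open>M\<^sub>2(A)\<close>. The norm of the library type of 2 by 2 matrices is not the C*-norm, but it is
  equivalent to it (both induce entrywise convergence), and only the topology is used.\<close>

definition m2_mult :: "'a::cstar_algebra^2^2 \<Rightarrow> 'a^2^2 \<Rightarrow> 'a^2^2" where
  "m2_mult x y = (\<chi> i j. \<Sum>k\<in>UNIV. x $ i $ k * y $ k $ j)"

definition m2_star :: "'a::cstar_algebra^2^2 \<Rightarrow> 'a^2^2" where
  "m2_star x = (\<chi> i j. (x $ j $ i)\<^sup>\<star>)"

definition m2_corner :: "'a::cstar_algebra \<Rightarrow> 'a^2^2" where
  "m2_corner a = (\<chi> i j. if i = 1 \<and> j = 1 then a else 0)"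

text \<open>Quasitraces are total functions of which only the values on \<open>A\<^sub>+\<close> matter.\<close>

definition lsc_2quasitrace :: "('a::cstar_algebra \<Rightarrow> ennreal) \<Rightarrow> bool" where
  "lsc_2quasitrace \<tau> \<longleftrightarrow> lsc_quasitrace (*) star \<tau> \<and>
     (\<exists>\<tau>2. lsc_quasitrace m2_mult m2_star \<tau>2 \<and> (\<forall>a\<in>positives. \<tau>2 (m2_corner a) = \<tau> a))"

definition dim_fun :: "('a::cstar_algebra \<Rightarrow> ennreal) \<Rightarrow> 'a \<Rightarrow> ennreal" where
  "dim_fun \<tau> a = lim (\<lambda>n. \<tau> (fcalc (root (Suc n)) a))"

definition faithful :: "('a::cstar_algebra \<Rightarrow> ennreal) \<Rightarrow> bool" where
  "faithful \<tau> \<longleftrightarrow> (\<forall>a\<in>positives. \<tau> a = 0 \<longrightarrow> a = 0)"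

definition densely_finite :: "('a::cstar_algebra \<Rightarrow> ennreal) \<Rightarrow> bool" where
  "densely_finite \<tau> \<longleftrightarrow> (\<forall>a\<in>Ped \<inter> positives. dim_fun \<tau> a < \<infinity>)"


section \<open>Admissible quasitracial projection scales\<close>

text \<open>The order \<open>a \<le> b\<close> on self-adjoint elements means \<open>b - a \<in> A\<^sub>+\<close>.\<close>

definition projection_approx_unit :: "(nat \<Rightarrow> 'a::cstar_algebra) \<Rightarrow> bool" where
  "projection_approx_unit p \<longleftrightarrow>
     (\<forall>n\<ge>1. projection (p n)) \<and>
     (\<forall>n\<ge>1. p (Suc n) - p n \<in> positives) \<and>
     (\<forall>a. (\<lambda>n. p n * a) \<longlonglongrightarrow> a \<and> (\<lambda>n. a * p n) \<longlonglongrightarrow> a)"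

definition T_fin :: "('a::cstar_algebra \<Rightarrow> ennreal) set \<Rightarrow> (nat \<Rightarrow> 'a) \<Rightarrow> ('a \<Rightarrow> ennreal) set" where
  "T_fin T p = {\<tau> \<in> T. (SUP n\<in>{1..}. \<tau> (p n)) < \<infinity>}"

definition T_inf :: "('a::cstar_algebra \<Rightarrow> ennreal) set \<Rightarrow> (nat \<Rightarrow> 'a) \<Rightarrow> ('a \<Rightarrow> ennreal) set" where
  "T_inf T p = {\<tau> \<in> T. (SUP n\<in>{1..}. \<tau> (p n)) = \<infinity>}"

definition admissible_scale ::
    "('a::cstar_algebra \<Rightarrow> ennreal) set \<Rightarrow> (nat \<Rightarrow> 'a) \<Rightarrow> real \<Rightarrow> 'a \<Rightarrow> real \<Rightarrow> bool" where
  "admissible_scale T p \<rho> e \<epsilon>0 \<longleftrightarrow>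
     projection_approx_unit p \<and> p 0 = 0 \<and> (\<forall>n\<ge>1. p n - p (n - 1) \<noteq> 0) \<and>
     T \<noteq> {} \<and>
     (\<forall>\<tau>\<in>T. lsc_2quasitrace \<tau> \<and> faithful \<tau> \<and> densely_finite \<tau> \<and> dim_fun \<tau> (p 1) = 1) \<and>
     \<rho> \<ge> 0 \<and> \<epsilon>0 > 0 \<and> e \<in> Ped \<inter> positives \<and>
     (\<forall>n\<ge>1. \<forall>c\<in>positives.
        (\<forall>\<tau>\<in>T. dim_fun \<tau> (p n - p (n - 1)) + ennreal \<rho> < dim_fun \<tau> c) \<longrightarrow>
        p n - p (n - 1) \<precsim> c) \<and>
     (T_inf T p \<noteq> {} \<longrightarrow>
        (\<forall>n\<ge>1. (SUP \<tau>\<in>T_inf T p. \<tau> (p n)) < \<infinity>) \<and>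
        (\<lambda>n. INF \<tau>\<in>T_inf T p. \<tau> (p n)) \<longlonglongrightarrow> \<infinity>) \<and>
     (T_fin T p \<noteq> {} \<longrightarrow>
        (INF \<tau>\<in>T_fin T p. dim_fun \<tau> (cut_down e \<epsilon>0)) > ennreal \<rho> \<and>
        (\<lambda>n. SUP \<tau>\<in>T_fin T p. (SUP j\<in>{1..}. \<tau> (p j)) - \<tau> (p n)) \<longlonglongrightarrow> 0)"

definition simple_cstar :: "'a::cstar_algebra itself \<Rightarrow> bool" where
  "simple_cstar _ \<longleftrightarrow> \<not> (\<exists>J :: 'a set. proper_ideal J \<and> closed J)"

end

theory Submission
  imports Defs "HOL-Complex_Analysis.Cauchy_Integral_Formula"
begin

text \<open>
  Let \<open>J\<close> be a dense maximal ideal; it contains every projection, hence every \<open>p n\<close>. Pick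
  \<open>a \<notin> J\<close>. Factoring \<open>a\<close> along the approximate unit shows \<open>\<Sum> \<gamma>\<^sub>n\<^sup>3 q\<^sub>n \<notin> J\<close> for slowly decaying
  weights \<open>\<gamma>\<close>, and likewise \<open>x\<^sup>3 \<notin> J\<close> for \<open>x = \<Sum> 32\<^sup>-\<^sup>n E\<^sub>n\<close>, where \<open>E\<^sub>n = p (N (n + 1)) - p (N n)\<close>
  are very large blocks. By maximality \<open>J + span A x A = A\<close>, so \<open>y = \<Sum> \<gamma>\<^sub>n E\<^sub>n\<close> has the form
  \<open>j + \<Sum>\<^sub>i\<^sub><\<^sub>m c\<^sub>i x b\<^sub>i\<close> with \<open>j \<in> J\<close>.

  Up to a small tail, \<open>x b\<^sub>i\<close> restricted to \<open>E\<^sub>n\<close> only involves \<open>p (N n) b\<^sub>i E\<^sub>n\<close>, whose support has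
  quasitrace at most \<open>\<tau> (p (N n))\<close>. On unbounded quasitraces this is negligible against
  \<open>\<tau> E\<^sub>n\<close>; on bounded ones the tails of \<open>p\<close> are eventually so small that all later \<open>q\<^sub>n\<close> fit side
  by side below one fixed \<open>P = p N\<^sub>0\<close> with \<open>\<tau> P > \<rho>\<close>. Comparison therefore yields partial isometries \<open>v\<^sub>n\<close>
  with \<open>v\<^sub>n\<^sup>\<star> v\<^sub>n = q\<^sub>n\<close>, range below \<open>P + E\<^sub>n\<close>, almost orthogonal to each other and almost killed,
  on the \<open>E\<^sub>n\<close> side, by all \<open>x b\<^sub>i\<close>. Then \<open>j \<cdot> \<Sum> \<gamma>\<^sub>n E\<^sub>n v\<^sub>n\<close> is \<open>\<Sum> \<gamma>\<^sub>n\<^sup>2 E\<^sub>n v\<^sub>n\<close> up to a left factor \<open>1 - G\<close>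
  with \<open>\<parallel>G\<parallel> < 1\<close>, so \<open>\<Sum> \<gamma>\<^sub>n\<^sup>2 v\<^sub>n \<in> J\<close>, and multiplying by \<open>(\<Sum> \<gamma>\<^sub>n v\<^sub>n)\<^sup>\<star>\<close> puts
  \<open>\<Sum> \<gamma>\<^sub>n\<^sup>3 q\<^sub>n\<close> into \<open>J\<close>, a contradiction.
\<close>

section \<open>Elementary facts and corners\<close>

text \<open>Three obstacles shape the proof. There is no unit: each \<open>1 - G\<close> is inverted
  through a quasi-inverse of \<open>G\<close>, functional calculus lives in corners
  \<open>q A q\<close> with unit \<open>q\<close>, and statements about all of \<open>A\<close> are
  limits along \<open>p n\<close>. No spectrum is available either: everything rests on bounding the
  norm of a polynomial in a self-adjoint element by its supremum on an interval. And a 2-quasitrace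
  is additive only on commuting elements, so the support of a sum has to be estimated in 2 by 2
  matrices. The order of choices matters: \<open>x\<close> is built from the blocks, and only then
  does maximality produce \<open>b i\<close> and \<open>m\<close>. The blocks must therefore serve
  all \<open>b\<close> at once. This is possible because only the number \<open>m\<close> enters the
  size estimates, and \<open>m \<le> n\<close> for all late \<open>n\<close>. Cubes occur twice.
  \<open>A x A\<close> contains \<open>x * x * x\<close> but perhaps not \<open>x\<close>. The third
  power of \<open>\<gamma>\<close> collects one factor from \<open>y\<close>, one from the series of
  the \<open>v n\<close>, and one from its adjoint. The condition
  \<open>(1/2) ^ n \<le> \<gamma> n\<close> lets division by \<open>\<gamma> n\<close> cost at most
  \<open>2 ^ n\<close>, which the geometric error terms absorb.\<close>

lemma star_zero [simp]: "(0::'a::cstar_algebra)\<^sup>\<star> = 0"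
  by (metis add_cancel_right_right star_add)

lemma star_minus: "(- (x::'a::cstar_algebra))\<^sup>\<star> = - (x\<^sup>\<star>)"
  by (metis add.right_inverse minus_unique star_add star_zero)

lemma star_diff: "((x::'a::cstar_algebra) - y)\<^sup>\<star> = x\<^sup>\<star> - y\<^sup>\<star>"
  using star_add[of x "- y"] by (simp add: star_minus)

lemma star_scaleR: "(r *\<^sub>R (x::'a::cstar_algebra))\<^sup>\<star> = r *\<^sub>R x\<^sup>\<star>"
  by (metis complex_cnj_complex_of_real scaleC_of_real star_scaleC)

lemma star_sum: "(\<Sum>i\<in>I. f i :: 'a::cstar_algebra)\<^sup>\<star> = (\<Sum>i\<in>I. (f i)\<^sup>\<star>)"
  by (induction I rule: infinite_finite_induct) (auto simp: star_add)

lemma norm_star [simp]: "norm ((x::'a::cstar_algebra)\<^sup>\<star>) = norm x"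
proof -
  have le: "norm x \<le> norm (x\<^sup>\<star>)" for x :: 'a
  proof (cases "x = 0")
    case False
    have "(norm x)\<^sup>2 \<le> norm (x\<^sup>\<star>) * norm x"
      by (metis cstar_identity norm_mult_ineq)
    then show ?thesis using False by (simp add: power2_eq_square)
  qed simp
  show ?thesis using le[of x] le[of "x\<^sup>\<star>"] by (simp add: star_star)
qed

lemma bounded_linear_star: "bounded_linear (star :: 'a::cstar_algebra \<Rightarrow> 'a)"
  by (rule bounded_linear_intro[where K = 1]) (auto simp: star_add star_scaleR)

lemmas tendsto_star = bounded_linear.tendsto[OF bounded_linear_star]

lemma scaleC_one [simp]: "1 *\<^sub>C (x::'a::cstar_algebra) = x"
  using scaleC_of_real[of 1 x] by simp

lemma scaleC_zero [simp]: "0 *\<^sub>C (x::'a::cstar_algebra) = 0" "c *\<^sub>C (0::'a) = 0"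
  using scaleC_of_real[of 0 x] norm_scaleC[of c "0::'a"] by auto

lemma scaleC_minus: "(- c) *\<^sub>C (x::'a::cstar_algebra) = - (c *\<^sub>C x)" "c *\<^sub>C (- x) = - (c *\<^sub>C x)"
  using scaleC_add_left[of "-c" c x] scaleC_add_right[of c "-x" x] by (auto simp: add_eq_0_iff2)

lemma scaleC_minus_one: "(-1) *\<^sub>C (x::'a::cstar_algebra) = - x"
  by (simp add: scaleC_minus)

lemma scaleC_diff_right: "c *\<^sub>C ((x::'a::cstar_algebra) - y) = c *\<^sub>C x - c *\<^sub>C y"
  using scaleC_add_right[of c x "-y"] by (simp add: scaleC_minus)

lemma norm_selfadjoint_square:
  fixes h :: "'a::cstar_algebra" assumes "h\<^sup>\<star> = h" shows "norm (h * h) = (norm h)\<^sup>2"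
  using cstar_identity[of h] assms by simp

lemma selfadjoint_square_eq_0:
  fixes h :: "'a::cstar_algebra" assumes "h\<^sup>\<star> = h" "h * h = 0" shows "h = 0"
  using norm_selfadjoint_square[OF assms(1)] assms(2) by simp

lemma star_mult_self_eq_0:
  fixes x :: "'a::cstar_algebra" assumes "x\<^sup>\<star> * x = 0" shows "x = 0"
  using cstar_identity[of x] assms by simp

text \<open>With a unit, \<open>1 + H\<close> would be the inverse of \<open>1 - G\<close>. The left
  and the right equation are each solved by contraction; the solutions \<open>H\<close> and
  \<open>K\<close> agree because expanding \<open>H * K\<close> in two ways gives
  \<open>H * G = G * K\<close>.\<close>

lemma quasi_inverse:
  fixes G :: "'a::{real_normed_algebra,banach}"
  assumes "norm G < 1"
  obtains H where "H = G + H * G" "H = G + G * H"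
proof -
  have "\<exists>!H. G + H * G = H"
  proof (rule banach_fix_type[where c = "norm G"])
    show "\<forall>x y. dist (G + x * G) (G + y * G) \<le> norm G * dist x y"
      by (intro allI) (simp add: dist_norm left_diff_distrib[symmetric] mult.commute[of "norm G"] norm_mult_ineq)
  qed (use assms in auto)
  then obtain H where H: "G + H * G = H" by auto
  have "\<exists>!H. G + G * H = H"
  proof (rule banach_fix_type[where c = "norm G"])
    show "\<forall>x y. dist (G + G * x) (G + G * y) \<le> norm G * dist x y"
      by (intro allI) (simp add: dist_norm right_diff_distrib[symmetric] norm_mult_ineq)
  qed (use assms in auto)
  then obtain K where K: "G + G * K = K" by auto
  have "H * K = H * (G + G * K)" using K by simp
  also have "\<dots> = H * G + (H * G) * K" by (simp add: algebra_simps)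
  finally have 1: "H * K = H * G + (H * G) * K" .
  have "H * K = (G + H * G) * K" using H by simp
  then have "H * K = G * K + (H * G) * K" by (simp add: algebra_simps)
  with 1 have "H * G = G * K" by simp
  then have "H = K" using H K by (metis (no_types))
  then show thesis using that[of H] H K by simp
qed

text \<open>The fixed-point equation says \<open>(1 - w)\<^sup>2 = 1 - k\<close>: a square root of \<open>1 - k\<close> without a unit.\<close>

lemma sqrt_one_minus:
  fixes k :: "'a::cstar_algebra"
  assumes sa: "k\<^sup>\<star> = k" and lt: "norm k < 1"
  obtains w where "w\<^sup>\<star> = w" "norm w < 1" "k = 2 *\<^sub>R w - w * w"
    "\<And>x. x * k = k * x \<Longrightarrow> x * w = w * x" "\<And>p. p * k = k \<Longrightarrow> p * w = w"
proof -
  define r where "r = norm k"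
  \<comment> \<open>\<open>c\<close> is the smaller root of \<open>r + c * c = 2 * c\<close>, so
    \<open>f\<close> below maps the ball of radius \<open>c\<close> into itself and contracts there
    by the factor \<open>c < 1\<close>.\<close>
  define c where "c = 1 - sqrt (1 - r)"
  have r: "0 \<le> r" "r < 1" using lt by (auto simp: r_def)
  have c: "0 \<le> c" "c < 1" using r by (auto simp: c_def)
  have "(sqrt (1 - r))\<^sup>2 = 1 - r" using r by simp
  then have cr: "r + c * c = 2 * c" by (simp add: c_def algebra_simps power2_eq_square)
  define f where "f = (\<lambda>w. (1/2) *\<^sub>R (k + w * w))"
  \<comment> \<open>All these conditions are closed and preserved by \<open>f\<close>, so the fixed
    point inherits self-adjointness, commutation with the commutant of \<open>k\<close>, and the
    left units of \<open>k\<close>.\<close>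
  define S where "S = {w::'a. norm w \<le> c \<and> w\<^sup>\<star> = w \<and> (\<forall>x. x * k = k * x \<longrightarrow> x * w = w * x) \<and> (\<forall>p. p * k = k \<longrightarrow> p * w = w)}"
  have "closed S"
  proof -
    have cs: "continuous_on UNIV (star :: 'a \<Rightarrow> 'a)"
      by (rule linear_continuous_on[OF bounded_linear_star])
    have S: "S = {w. norm w \<le> c} \<inter> {w. w\<^sup>\<star> = w} \<inter> (\<Inter>x\<in>{x. x * k = k * x}. {w. x * w = w * x})
      \<inter> (\<Inter>p\<in>{p. p * k = k}. {w. p * w = w})"
      unfolding S_def by blast
    have 1: "closed {w::'a. norm w \<le> c}"
      by (intro closed_Collect_le continuous_intros)
    have 2: "closed {w::'a. w\<^sup>\<star> = w}"
      by (rule closed_Collect_eq[OF cs continuous_on_id])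
    have 3: "closed {w. x * w = w * x}" for x :: 'a
      by (rule closed_Collect_eq) (intro continuous_intros)+
    have 4: "closed {w. x * w = w}" for x :: 'a
      by (rule closed_Collect_eq) (intro continuous_intros)+
    show ?thesis
      unfolding S by (intro closed_Int closed_INT ballI 1 2 3 4)
  qed
  then have "complete S" by (simp add: complete_eq_closed)
  have "0 \<in> S" unfolding S_def using c by simp
  then have "S \<noteq> {}" by blast
  moreover have "f ` S \<subseteq> S"
  proof clarify
    fix w assume w: "w \<in> S"
    have wn: "norm w \<le> c" and ws: "w\<^sup>\<star> = w" using w unfolding S_def by blast+
    have "norm (w * w) \<le> c * c"
      using wn c by (intro order_trans[OF norm_mult_ineq] mult_mono) auto
    then have "norm (k + w * w) \<le> r + c * c"
      unfolding r_def by (intro norm_triangle_le add_left_mono)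
    then have "norm (f w) \<le> c" using cr by (simp add: f_def)
    moreover have "(f w)\<^sup>\<star> = f w" using ws sa by (simp add: f_def star_scaleR star_add star_mult)
    moreover have "x * f w = f w * x" if "x * k = k * x" for x
    proof -
      have "x * w = w * x" using w that unfolding S_def by blast
      then have "x * (w * w) = w * w * x" by (metis mult.assoc)
      then show ?thesis using that by (simp add: f_def algebra_simps)
    qed
    moreover have "p * f w = f w" if "p * k = k" for p
    proof -
      have "p * w = w" using w that unfolding S_def by blast
      then have "p * (w * w) = w * w" by (metis mult.assoc)
      then show ?thesis using that by (simp add: f_def algebra_simps)
    qed
    ultimately show "f w \<in> S" unfolding S_def by blast
  qed
  moreover have "dist (f x) (f y) \<le> c * dist x y" if "x \<in> S" "y \<in> S" for x y
  proof -
    have eq: "f x - f y = (1/2) *\<^sub>R (x * (x - y) + (x - y) * y)" by (simp add: f_def algebra_simps)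
    have "norm x \<le> c" "norm y \<le> c" using that unfolding S_def by blast+
    then have "norm (x * (x - y)) \<le> c * norm (x - y)" "norm ((x - y) * y) \<le> norm (x - y) * c"
      by (auto intro!: order_trans[OF norm_mult_ineq] mult_right_mono mult_left_mono)
    then have "norm (x * (x - y) + (x - y) * y) \<le> c * norm (x - y) + norm (x - y) * c"
      by (rule norm_triangle_mono)
    then show ?thesis unfolding dist_norm eq norm_scaleR by (simp add: mult.commute)
  qed
  ultimately have "\<exists>!x. x \<in> S \<and> f x = x"
    using c \<open>S \<noteq> {}\<close> \<open>complete S\<close> by (intro Banach_fix) blast+
  then obtain w where w: "w \<in> S" "f w = w" by blast
  have "2 *\<^sub>R w = k + w * w" using arg_cong[OF w(2), of "\<lambda>z. 2 *\<^sub>R z"] by (simp add: f_def)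
  then have 2: "k = 2 *\<^sub>R w - w * w" by simp
  have 3: "norm w < 1" "w\<^sup>\<star> = w"
    using w(1) c(2) unfolding S_def by auto
  show thesis
    by (rule that[OF 3(2,1) 2]) (use w(1) in \<open>unfold S_def, blast+\<close>)
qed

text \<open>For a projection this is \<open>p A p\<close>, an algebra with unit \<open>p\<close>.
  Constant terms and differences such as \<open>p - w\<close> make sense in it although
  \<open>A\<close> has no unit.\<close>

definition corner :: "'a::cstar_algebra \<Rightarrow> 'a set" where
  "corner p = {x. p * x = x \<and> x * p = x}"

lemma cornerD: "x \<in> corner p \<Longrightarrow> p * x = x" "x \<in> corner p \<Longrightarrow> x * p = x"
  by (auto simp: corner_def)

lemma corner_self: "projection p \<Longrightarrow> p \<in> corner p"
  by (auto simp: corner_def projection_def)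

lemma corner_zero [simp]: "0 \<in> corner p" by (auto simp: corner_def)

lemma corner_add: "x \<in> corner p \<Longrightarrow> y \<in> corner p \<Longrightarrow> x + y \<in> corner p"
  by (auto simp: corner_def algebra_simps)

lemma corner_diff: "x \<in> corner p \<Longrightarrow> y \<in> corner p \<Longrightarrow> x - y \<in> corner p"
  by (auto simp: corner_def algebra_simps)

lemma corner_mult: "x \<in> corner p \<Longrightarrow> y \<in> corner p \<Longrightarrow> x * y \<in> corner p"
  using mult.assoc[of p x y] mult.assoc[of x y p] by (simp add: corner_def)

lemma corner_scaleR: "x \<in> corner p \<Longrightarrow> r *\<^sub>R x \<in> corner p"
  by (auto simp: corner_def)

lemma corner_scaleC: "x \<in> corner p \<Longrightarrow> r *\<^sub>C x \<in> corner p"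
  by (auto simp: corner_def mult_scaleC_left mult_scaleC_right)

lemma corner_star: "projection p \<Longrightarrow> x \<in> corner p \<Longrightarrow> x\<^sup>\<star> \<in> corner p"
  using star_mult[of p x] star_mult[of x p] by (simp add: corner_def projection_def)

lemma closed_corner: "closed (corner p)"
proof -
  have "corner p = {x. p * x = x} \<inter> {x. x * p = x}" by (auto simp: corner_def)
  then show ?thesis by (auto intro!: closed_Int closed_Collect_eq continuous_intros)
qed

lemma corner_compress: "projection p \<Longrightarrow> p * x * p \<in> corner p"
  by (simp add: corner_def projection_def mult.assoc) (simp add: mult.assoc[symmetric])

lemma norm_projection_le: "projection (p::'a::cstar_algebra) \<Longrightarrow> norm p \<le> 1"
  using cstar_identity[of p] by (cases "p = 0") (auto simp: projection_def power2_eq_square)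

section \<open>Polynomials in a self-adjoint element\<close>

text \<open>The iteration starts at \<open>p\<close>, which plays the part of the zeroth power of
  \<open>x\<close> in the corner of \<open>p\<close>. Started at \<open>a\<close> itself,
  \<open>ev a Q a\<close> is \<open>poly_eval0 Q a\<close>, so both evaluations share the linear
  lemmas.\<close>

definition ev :: "'a::cstar_algebra \<Rightarrow> real poly \<Rightarrow> 'a \<Rightarrow> 'a" where
  "ev p P x = (\<Sum>i\<le>degree P. coeff P i *\<^sub>R ((*) x ^^ i) p)"

lemma ev_extend: "degree P \<le> n \<Longrightarrow> ev p P x = (\<Sum>i\<le>n. coeff P i *\<^sub>R ((*) x ^^ i) p)"
  unfolding ev_def by (rule sum.mono_neutral_left) (auto simp: coeff_eq_0)

lemma ev_0 [simp]: "ev p 0 x = 0" by (simp add: ev_def)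

lemma ev_pCons: "ev p (pCons c P) x = c *\<^sub>R p + x * ev p P x"
proof -
  have "ev p (pCons c P) x = (\<Sum>i\<le>Suc (degree P). coeff (pCons c P) i *\<^sub>R ((*) x ^^ i) p)"
    by (rule ev_extend) (simp add: degree_pCons_le)
  also have "\<dots> = c *\<^sub>R p + x * ev p P x"
    unfolding sum.atMost_Suc_shift by (simp add: ev_def sum_distrib_left)
  finally show ?thesis .
qed

lemma ev_add: "ev p (P + Q) x = ev p P x + ev p Q x"
proof -
  define n where "n = max (degree P) (degree Q)"
  have "degree (P + Q) \<le> n" "degree P \<le> n" "degree Q \<le> n" by (auto simp: n_def degree_add_le_max)
  then show ?thesis by (simp add: ev_extend[of _ n] scaleR_add_left sum.distrib)
qed

lemma ev_smult: "ev p (smult c P) x = c *\<^sub>R ev p P x"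
  by (simp add: ev_extend[of _ "degree P"] degree_smult_le scaleR_sum_right)

lemma ev_diff: "ev p (P - Q) x = ev p P x - ev p Q x"
  using ev_add[of p P "smult (-1) Q" x] unfolding ev_smult by simp

lemma ev_sum: "ev p (sum f I) x = (\<Sum>i\<in>I. ev p (f i) x)"
  by (induction I rule: infinite_finite_induct) (auto simp: ev_add)

context
  fixes p x :: "'a::cstar_algebra"
  assumes p: "projection p" and x: "x \<in> corner p"
begin

lemma ev_corner: "ev p P x \<in> corner p"
  by (induction P) (auto simp: ev_pCons intro!: corner_add corner_mult corner_scaleR x corner_self p)

lemma ev_mult: "ev p (P * Q) x = ev p P x * ev p Q x"
proof (induction P)
  case (pCons c P)
  have "p * ev p Q x = ev p Q x" using ev_corner by (rule cornerD)
  then show ?case using pCons by (simp add: mult_pCons_left ev_add ev_smult ev_pCons algebra_simps)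
qed simp

lemma ev_1: "ev p 1 x = p"
  unfolding one_pCons by (simp add: ev_pCons)

lemma ev_pcompose: "ev p (pcompose P Q) x = ev p P (ev p Q x)"
  by (induction P) (auto simp: pcompose_pCons ev_add ev_pCons ev_mult)

lemma ev_X: "ev p [:0,1:] x = x"
  using x by (simp add: ev_pCons cornerD)

lemma ev_star:
  assumes "x\<^sup>\<star> = x" shows "(ev p P x)\<^sup>\<star> = ev p P x"
proof -
  have c: "ev p P x * x = x * ev p P x" for P
    using ev_mult[of P "[:0,1:]"] ev_mult[of "[:0,1:]" P] ev_X by (simp add: mult.commute)
  show ?thesis
    using p by (induction P) (auto simp: ev_pCons star_add star_scaleR star_mult assms c projection_def)
qed

end

lemma ev_monom: "ev p (monom 1 n) x = ((*) x ^^ n) p"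
  by (induction n) (auto simp: monom_0 monom_Suc ev_pCons)

section \<open>Coefficient bounds on the unit circle, and the norm of a polynomial in a self-adjoint
  element\<close>

abbreviation cpoly :: "real poly \<Rightarrow> complex poly" where
  "cpoly \<equiv> map_poly complex_of_real"

lemma cpoly_add: "cpoly (A + B) = cpoly A + cpoly B"
  by (rule poly_eqI) (simp add: coeff_map_poly)

lemma cpoly_mult: "cpoly (A * B) = cpoly A * cpoly B"
  by (rule poly_eqI) (simp add: coeff_map_poly coeff_mult)

lemma cpoly_sum: "cpoly (sum f I) = (\<Sum>i\<in>I. cpoly (f i))"
  by (induction I rule: infinite_finite_induct) (auto simp: cpoly_add)

lemma cpoly_power: "cpoly (A ^ n) = cpoly A ^ n"
  by (induction n) (auto simp: cpoly_mult map_poly_1)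

lemma higher_deriv_poly: "(deriv ^^ n) (poly P) = poly ((pderiv ^^ n) (P :: complex poly))"
proof (induction n)
  case (Suc n)
  then show ?case by (auto intro!: ext DERIV_imp_deriv simp: poly_DERIV)
qed simp

lemma coeff_le_circle_bound:
  fixes P :: "complex poly"
  assumes "\<And>z. cmod z = 1 \<Longrightarrow> cmod (poly P z) \<le> M"
  shows "cmod (coeff P k) \<le> M"
proof -
  have "cmod ((deriv ^^ k) (poly P) 0) \<le> fact k * M / 1 ^ k"
    by (rule Cauchy_inequality) (use assms in \<open>auto intro!: holomorphic_intros continuous_intros\<close>)
  moreover have "(deriv ^^ k) (poly P) 0 = fact k * coeff P k"
    by (simp add: higher_deriv_poly poly_0_coeff_0 coeff_higher_pderiv pochhammer_fact)
  ultimately show ?thesis by (simp add: norm_mult)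
qed

text \<open>On the unit circle, \<open>z \<cdot> Re z = (1 + z\<^sup>2) / 2\<close>, so \<open>joukowski P\<close> is \<open>z\<^sup>d P(Re z)\<close> there.\<close>

definition joukowski :: "real poly \<Rightarrow> real poly" where
  "joukowski P = (\<Sum>i\<le>degree P. smult (coeff P i) (monom 1 (degree P - i) * [:1/2, 0, 1/2:] ^ i))"

lemma degree_joukowski: "degree (joukowski P) \<le> 2 * degree P"
  unfolding joukowski_def
proof (rule degree_sum_le)
  fix i assume i: "i \<in> {..degree P}"
  have "degree (smult (coeff P i) (monom 1 (degree P - i) * [:1/2, 0, 1/2:] ^ i))
    \<le> degree (monom (1::real) (degree P - i)) + degree ([:1/2, 0, 1/2::real:] ^ i)"
    by (rule order_trans[OF degree_smult_le degree_mult_le])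
  also have "\<dots> \<le> (degree P - i) + degree [:1/2, 0, 1/2::real:] * i"
    by (intro add_mono degree_monom_le degree_power_le)
  also have "\<dots> \<le> 2 * degree P" using i by simp
  finally show "degree (smult (coeff P i) (monom 1 (degree P - i) * [:1/2, 0, 1/2:] ^ i)) \<le> 2 * degree P" .
qed simp

lemma joukowski_circle:
  assumes "cmod z = 1"
  shows "poly (cpoly (joukowski P)) z = z ^ degree P * of_real (poly P (Re z))"
proof -
  have "cnj z * z = 1" using assms by (metis complex_norm_square mult.commute of_real_1 power_one)
  then have "1 + z * z = z * (z + cnj z)" by (simp add: algebra_simps)
  then have z: "1 / 2 + z * z / 2 = z * of_real (Re z)"
    unfolding complex_add_cnj by (simp add: field_simps)
  have m: "cpoly (monom 1 n) = monom 1 n" for n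
    by (rule poly_eqI) (simp add: coeff_map_poly)
  have q: "cpoly [:1/2, 0, 1/2:] = [:1/2, 0, 1/2:]"
    by (simp add: map_poly_pCons)
  have "poly (cpoly (joukowski P)) z
    = (\<Sum>i\<le>degree P. of_real (coeff P i) * (z ^ (degree P - i) * (z * of_real (Re z)) ^ i))"
    by (simp add: joukowski_def cpoly_sum poly_sum map_poly_smult cpoly_mult cpoly_power m q poly_monom z)
  also have "\<dots> = (\<Sum>i\<le>degree P. z ^ degree P * of_real (coeff P i * Re z ^ i))"
  proof (rule sum.cong)
    fix i assume "i \<in> {..degree P}"
    then have "z ^ degree P = z ^ (degree P - i) * z ^ i" by (simp flip: power_add)
    then show "of_real (coeff P i) * (z ^ (degree P - i) * (z * of_real (Re z)) ^ i)
      = z ^ degree P * of_real (coeff P i * Re z ^ i)"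
      by (simp add: power_mult_distrib)
  qed simp
  also have "\<dots> = z ^ degree P * of_real (poly P (Re z))"
    by (simp add: poly_altdef sum_distrib_left)
  finally show ?thesis .
qed

lemma abs_coeff_joukowski_le:
  assumes "\<And>s. \<bar>s\<bar> \<le> 1 \<Longrightarrow> \<bar>poly P s\<bar> \<le> M"
  shows "\<bar>coeff (joukowski P) k\<bar> \<le> M"
proof -
  have "cmod (coeff (cpoly (joukowski P)) k) \<le> M"
  proof (rule coeff_le_circle_bound)
    fix z :: complex assume z: "cmod z = 1"
    then have "\<bar>Re z\<bar> \<le> 1" using abs_Re_le_cmod[of z] by simp
    then show "cmod (poly (cpoly (joukowski P)) z) \<le> M"
      using assms z by (simp add: joukowski_circle norm_mult norm_power)
  qed
  then show ?thesis by (simp add: coeff_map_poly)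
qed

text \<open>A factor linear in \<open>2 ^ n\<close> loses against the geometric decay of
  \<open>(M / a) ^ (2 ^ n)\<close>. It removes constants from norm estimates that can be iterated by
  squaring.\<close>

lemma power_growth_bound:
  fixes a M :: real
  assumes "\<And>n. a ^ (2 ^ n) \<le> (2 * (real d * 2 ^ n) + 1) * M ^ (2 ^ n)" "0 \<le> M" "0 \<le> a"
  shows "a \<le> M"
proof (rule ccontr)
  assume "\<not> a \<le> M"
  then have a: "M < a" "0 < a" using assms by auto
  define c where "c = M / a"
  have c: "0 \<le> c" "c < 1" using a assms by (auto simp: c_def)
  have "(\<lambda>N. (2 * real d) * (real N * c ^ N) + c ^ N) \<longlonglongrightarrow> (2 * real d) * 0 + 0"
    by (intro tendsto_intros powser_times_n_limit_0 LIMSEQ_power_zero) (use c in auto)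
  then have "eventually (\<lambda>N. (2 * real d) * (real N * c ^ N) + c ^ N < 1) sequentially"
    by (rule order_tendstoD) simp
  then obtain N0 where N0: "\<And>N. N \<ge> N0 \<Longrightarrow> (2 * real d) * (real N * c ^ N) + c ^ N < 1"
    by (auto simp: eventually_sequentially)
  have "N0 \<le> 2 ^ N0" by (simp add: less_exp order.strict_implies_order)
  from N0[OF this] have "(2 * (real d * 2 ^ N0) + 1) * c ^ (2 ^ N0) < 1" by (simp add: algebra_simps)
  then have "(2 * (real d * 2 ^ N0) + 1) * M ^ (2 ^ N0) < a ^ (2 ^ N0)"
    using a by (simp add: c_def power_divide field_simps)
  then show False using assms(1)[of N0] by simp
qed

context
  fixes p h :: "'a::cstar_algebra"
  assumes p: "projection p" and h: "h \<in> corner p" and sa: "h\<^sup>\<star> = h"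
begin

text \<open>\<open>u\<close> is a unitary of the corner with real part \<open>h\<close>, so the
  circle identity behind \<open>joukowski\<close> holds for it: the value at \<open>u\<close> is the
  \<open>degree P\<close>-th power of \<open>u\<close> times the value of \<open>P\<close> at
  \<open>h\<close>. Multiplying by \<open>u\<close> does not decrease norms, since the contraction
  \<open>v = u\<^sup>\<star>\<close> undoes it.\<close>

lemma ev_joukowski_unitary:
  assumes lt: "norm h < 1"
  obtains u where "u \<in> corner p" "norm u \<le> 1" "norm (ev p P h) \<le> norm (ev p (joukowski P) u)"
proof -
  have "norm (h * h) < 1"
    using norm_mult_ineq[of h h] lt by (meson le_less_trans mult_left_le norm_ge_zero order_less_imp_le)
  then obtain w where w: "w\<^sup>\<star> = w" "h * h = 2 *\<^sub>R w - w * w"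
    "\<And>x. x * (h * h) = h * h * x \<Longrightarrow> x * w = w * x" "\<And>q. q * (h * h) = h * h \<Longrightarrow> q * w = w"
    using sqrt_one_minus[of "h * h"] sa by (metis star_mult)
  have hw: "h * w = w * h" by (rule w(3)) (simp add: mult.assoc)
  have "p * (h * h) = h * h" using h by (simp add: cornerD mult.assoc[symmetric])
  then have pw: "p * w = w" by (rule w(4))
  then have wp: "w * p = w" using p w(1) by (metis projection_def star_mult)
  have pp: "p * p = p" "p\<^sup>\<star> = p" using p by (auto simp: projection_def)
  have ph: "p * h = h" "h * p = h" using h by (auto simp: cornerD)
  \<comment> \<open>\<open>h * h = 2 *\<^sub>R w - w * w\<close> says that
    \<open>s * s = p - h * h\<close>, so \<open>s\<close> is the sine to the cosine
    \<open>h\<close>.\<close>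
  define s where "s = p - w"
  have s: "s \<in> corner p" "s\<^sup>\<star> = s" "h * s = s * h"
    using pw wp pp ph hw w(1) by (auto simp: s_def corner_def algebra_simps star_diff)
  have ss: "h * h + s * s = p"
    using pw wp pp w(2) by (simp add: s_def algebra_simps scaleR_2)
  define u where "u = h + \<i> *\<^sub>C s"
  define v where "v = h - \<i> *\<^sub>C s"
  have u: "u \<in> corner p" using h s(1) by (auto simp: u_def intro!: corner_add corner_scaleC)
  have v: "v \<in> corner p" using h s(1) by (auto simp: v_def intro!: corner_diff corner_scaleC)
  have us: "u\<^sup>\<star> = v" "v\<^sup>\<star> = u"
    by (simp_all add: u_def v_def star_add star_diff star_scaleC sa s(2) scaleC_minus)
  have vu: "v * u = p" "u * v = p"
    using ss s(3) by (simp_all add: u_def v_def algebra_simps mult_scaleC_left mult_scaleC_right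
      scaleC_scaleC scaleC_minus_one scaleC_add_right scaleC_diff_right)
  have uh2: "u + v = 2 *\<^sub>R h" by (simp add: u_def v_def scaleR_2)
  have uh: "u * h = h * u" using s(3) by (simp add: u_def algebra_simps mult_scaleC_left mult_scaleC_right)
  have "(norm u)\<^sup>2 \<le> 1\<^sup>2" using cstar_identity[of u] us vu norm_projection_le[OF p] by simp
  then have nu: "norm u \<le> 1" by (rule power2_le_imp_le) simp
  then have nv: "norm v \<le> 1" using us norm_star by metis
  let ?E = "\<lambda>P. ev p P u" and ?F = "\<lambda>P. ev p P h"
  have T: "?E [:1/2, 0, 1/2:] = u * h"
  proof -
    have "2 *\<^sub>R (u * h) = u * (u + v)" by (simp add: uh2)
    also have "\<dots> = u * u + p" using vu by (simp add: algebra_simps)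
    finally have "u * h = (1/2) *\<^sub>R (u * u + p)" by (metis scaleR_half_double scaleR_2 scaleR_scaleR scaleR_add_right)
    then show ?thesis using u by (simp add: ev_pCons cornerD algebra_simps)
  qed
  let ?m = "\<lambda>x n. ((*) x ^^ n) p"
  have mh: "?m h n \<in> corner p" for n by (metis ev_corner[OF p h] ev_monom)
  have mu: "?m u n \<in> corner p" for n by (metis ev_corner[OF p u] ev_monom)
  have huc: "?m h n * u = u * ?m h n" for n
    by (induction n) (use u uh in \<open>auto simp: cornerD\<close>, metis mult.assoc)
  have Ti: "?E ([:1/2, 0, 1/2:] ^ i) = ?m u i * ?m h i" for i
  proof (induction i)
    case 0 then show ?case using pp by (simp add: ev_1[OF p u])
  next
    case (Suc i)
    have "?E ([:1/2, 0, 1/2:] ^ Suc i) = u * h * (?m u i * ?m h i)"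
      using Suc T by (simp only: power_Suc ev_mult[OF p u])
    also have "h * ?m u i = ?m u i * h"
      by (induction i) (use ph uh in \<open>auto\<close>, metis mult.assoc)
    then have "u * h * (?m u i * ?m h i) = ?m u (Suc i) * ?m h (Suc i)"
      by (simp add: mult.assoc) (simp add: mult.assoc[symmetric])
    finally show ?case .
  qed
  have muu: "?m u (a + b) = ?m u a * ?m u b" for a b
    using mu by (induction a) (auto simp: cornerD mult.assoc)
  have "?E (joukowski P) = (\<Sum>i\<le>degree P. coeff P i *\<^sub>R (?m u (degree P) * ?m h i))"
    unfolding joukowski_def ev_sum
  proof (rule sum.cong)
    fix i assume "i \<in> {..degree P}"
    then have "?m u (degree P) = ?m u (degree P - i) * ?m u i" by (simp flip: muu)
    then show "?E (smult (coeff P i) (monom 1 (degree P - i) * [:1/2, 0, 1/2:] ^ i))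
      = coeff P i *\<^sub>R (?m u (degree P) * ?m h i)"
      by (simp add: ev_smult ev_mult[OF p u] Ti ev_monom mult.assoc)
  qed simp
  also have "\<dots> = ?m u (degree P) * ?F P" by (simp add: ev_def sum_distrib_left)
  finally have eq: "?E (joukowski P) = ?m u (degree P) * ?F P" .
  have "norm (?F P) \<le> norm (?m u n * ?F P)" for n
  proof (induction n)
    case 0 then show ?case using ev_corner[OF p h] by (simp add: cornerD)
  next
    case (Suc n)
    have "?m u n * ?F P = v * (?m u (Suc n) * ?F P)"
      using mu[of n] vu by (simp add: mult.assoc[symmetric] cornerD)
    then have "norm (?m u n * ?F P) \<le> norm v * norm (?m u (Suc n) * ?F P)" by (metis norm_mult_ineq)
    also have "\<dots> \<le> norm (?m u (Suc n) * ?F P)" using nv by (simp add: mult_left_le_one_le)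
    finally show ?case using Suc by simp
  qed
  then show thesis using that[OF u nu] eq by metis
qed

text \<open>Powers of the contraction \<open>u\<close> have norm at most 1, and
  \<open>joukowski P\<close> contributes at most \<open>2 * degree P + 1\<close> coefficients, none
  exceeding \<open>M\<close> in absolute value.\<close>

lemma norm_ev_le_degree:
  assumes lt: "norm h < 1" and M: "\<And>s. \<bar>s\<bar> \<le> 1 \<Longrightarrow> \<bar>poly P s\<bar> \<le> M"
  shows "norm (ev p P h) \<le> (2 * real (degree P) + 1) * M"
proof -
  obtain u where u: "u \<in> corner p" "norm u \<le> 1" "norm (ev p P h) \<le> norm (ev p (joukowski P) u)"
    using ev_joukowski_unitary[OF lt] by blast
  have mu: "norm (((*) u ^^ n) p) \<le> 1" for n
  proof (induction n)
    case (Suc n)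
    have "norm (u * ((*) u ^^ n) p) \<le> norm u * norm (((*) u ^^ n) p)" by (rule norm_mult_ineq)
    also have "\<dots> \<le> 1" using u(2) Suc by (simp add: mult_le_one)
    finally show ?case by simp
  qed (simp add: norm_projection_le p)
  have "ev p (joukowski P) u = (\<Sum>i\<le>2 * degree P. coeff (joukowski P) i *\<^sub>R ((*) u ^^ i) p)"
    by (rule ev_extend[OF degree_joukowski])
  also have "norm \<dots> \<le> (\<Sum>i\<le>2 * degree P. M)"
  proof (rule order_trans[OF norm_sum sum_mono])
    fix i
    have "\<bar>coeff (joukowski P) i\<bar> * norm (((*) u ^^ i) p) \<le> M * 1"
      using abs_coeff_joukowski_le[OF M, of i] mu[of i] by (intro mult_mono) auto
    then show "norm (coeff (joukowski P) i *\<^sub>R ((*) u ^^ i) p) \<le> M" by simp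
  qed
  also have "\<dots> = (2 * real (degree P) + 1) * M" by (simp add: algebra_simps)
  finally show ?thesis using u(3) by simp
qed

text \<open>The factor depending on the degree disappears by applying the bound to \<open>P ^ (2 ^ n)\<close>:
  the norm is multiplicative on squares of self-adjoint elements, and the degree grows only linearly.\<close>

lemma norm_ev_le_contraction:
  assumes lt: "norm h < 1" and M: "\<And>s. \<bar>s\<bar> \<le> 1 \<Longrightarrow> \<bar>poly P s\<bar> \<le> M"
  shows "norm (ev p P h) \<le> M"
proof (rule power_growth_bound[where d = "degree P"])
  fix n
  have "norm (ev p P h) ^ (2 ^ n) = norm (ev p (P ^ (2 ^ n)) h)"
  proof (induction n)
    case (Suc n)
    have "ev p (P ^ (2 ^ Suc n)) h = ev p (P ^ (2 ^ n)) h * ev p (P ^ (2 ^ n)) h"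
      by (simp add: ev_mult[OF p h, symmetric] mult_2 power_add)
    then show ?case
      using Suc norm_selfadjoint_square[OF ev_star[OF p h sa, of "P ^ (2 ^ n)"]]
      by (simp add: mult_2 power_add power2_eq_square)
  qed simp
  also have "\<dots> \<le> (2 * real (degree (P ^ (2 ^ n))) + 1) * M ^ (2 ^ n)"
    by (rule norm_ev_le_degree[OF lt]) (auto simp: power_abs M intro!: power_mono)
  also have "\<dots> \<le> (2 * (real (degree P) * 2 ^ n) + 1) * M ^ (2 ^ n)"
  proof (rule mult_right_mono)
    have "degree (P ^ 2 ^ n) \<le> degree P * 2 ^ n" by (rule degree_power_le)
    then have "real (degree (P ^ 2 ^ n)) \<le> real (degree P * 2 ^ n)" by (simp only: of_nat_le_iff)
    then show "2 * real (degree (P ^ 2 ^ n)) + 1 \<le> 2 * (real (degree P) * 2 ^ n) + 1" by simp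
  qed (use M[of 0] in auto)
  finally show "norm (ev p P h) ^ (2 ^ n) \<le> (2 * (real (degree P) * 2 ^ n) + 1) * M ^ (2 ^ n)" .
qed (use M[of 0] in auto)

end

text \<open>This inequality stands in for the spectral theorem. The contraction bound requires a
  norm strictly below 1, so it is applied to \<open>(t / R) *\<^sub>R h\<close> and the rescaled
  polynomial for \<open>t < 1\<close>; then \<open>t\<close> tends to 1.\<close>

lemma norm_ev_le:
  assumes p: "projection p" and h: "h \<in> corner p" and sa: "h\<^sup>\<star> = h"
    and R: "norm h \<le> R" and M: "\<And>s. \<bar>s\<bar> \<le> R \<Longrightarrow> \<bar>poly P s\<bar> \<le> M"
  shows "norm (ev p P h) \<le> M"
proof (cases "h = 0")
  case True
  have "ev p P 0 = poly P 0 *\<^sub>R p" by (cases P) (simp add: ev_pCons)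
  moreover have "\<bar>poly P 0\<bar> * norm p \<le> M * 1"
    by (rule mult_mono) (use R M[of 0] norm_projection_le[OF p] True in auto)
  ultimately show ?thesis using True by simp
next
  case False
  then have R0: "0 < R" using R by (meson less_le_trans zero_less_norm_iff)
  have bound: "norm (ev p P (t *\<^sub>R h)) \<le> M" if t: "0 < t" "t < 1" for t
  proof -
    define h' where "h' = (t / R) *\<^sub>R h"
    have h': "h' \<in> corner p" "h'\<^sup>\<star> = h'" using h sa by (auto simp: h'_def star_scaleR intro: corner_scaleR)
    have "norm h' \<le> t" using R R0 t by (simp add: h'_def field_simps)
    then have n: "norm h' < 1" using t by simp
    have "ev p [:0, R:] h' = t *\<^sub>R h"
      using R0 h by (simp add: h'_def ev_pCons cornerD)
    then have "ev p P (t *\<^sub>R h) = ev p (pcompose P [:0, R:]) h'"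
      by (simp add: ev_pcompose[OF p h'(1)])
    also have "norm \<dots> \<le> M"
    proof (rule norm_ev_le_contraction[OF p h' n])
      fix s :: real assume s: "\<bar>s\<bar> \<le> 1"
      then have "\<bar>s * R\<bar> \<le> R" using R0 by (simp add: abs_mult)
      then show "\<bar>poly (pcompose P [:0, R:]) s\<bar> \<le> M" using M by (simp add: poly_pcompose)
    qed
    finally show ?thesis .
  qed
  have "((\<lambda>t. ev p P (t *\<^sub>R h)) \<longlongrightarrow> ev p P (1 *\<^sub>R h)) (at_left 1)"
  proof (induction P)
    case (pCons a P)
    then show ?case unfolding ev_pCons by (intro tendsto_intros)
  qed simp
  moreover have "eventually (\<lambda>t. norm (ev p P (t *\<^sub>R h)) \<le> M) (at_left 1)"
    unfolding eventually_at_left_field using bound by (intro exI[of _ 0]) auto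
  ultimately show ?thesis
    using tendsto_upperbound[OF tendsto_norm] trivial_limit_at_left_real by fastforce
qed

abbreviation cont :: "(real \<Rightarrow> real) \<Rightarrow> bool" where "cont \<equiv> continuous_on UNIV"

lemma polynomial_approximation:
  fixes f :: "real \<Rightarrow> real"
  assumes "continuous_on {a..b} f"
  shows "\<exists>P :: nat \<Rightarrow> real poly. uniform_limit {a..b} (\<lambda>k. poly (P k)) f sequentially"
proof -
  have "\<exists>P. \<forall>s\<in>{a..b}. \<bar>poly P s - f s\<bar> < 1 / real (Suc k)" for k
  proof -
    obtain g where g: "real_polynomial_function g" "\<And>s. s \<in> {a..b} \<Longrightarrow> \<bar>f s - g s\<bar> < 1 / real (Suc k)"
      using Stone_Weierstrass_real_polynomial_function[OF compact_Icc assms, of "1 / real (Suc k)"] by auto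
    obtain c n where "g = (\<lambda>x. \<Sum>i\<le>n. c i * x ^ i)"
      using g(1) by (auto simp: real_polynomial_function_iff_sum)
    then have "g = poly (\<Sum>i\<le>n. monom (c i) i)" by (simp add: fun_eq_iff poly_sum poly_monom)
    then show ?thesis
      using g(2) by (intro exI[of _ "\<Sum>i\<le>n. monom (c i) i"]) (simp add: abs_minus_commute)
  qed
  then obtain P where P: "\<forall>k. \<forall>s\<in>{a..b}. \<bar>poly (P k) s - f s\<bar> < 1 / real (Suc k)"
    by (rule choice[OF allI, THEN exE])
  have "uniform_limit {a..b} (\<lambda>k. poly (P k)) f sequentially"
  proof (rule uniform_limitI)
    fix e :: real assume "0 < e"
    then obtain N where N: "1 / real (Suc N) < e" using nat_approx_posE by blast
    show "\<forall>\<^sub>F k in sequentially. \<forall>s\<in>{a..b}. dist (poly (P k) s) (f s) < e"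
    proof (rule eventually_sequentiallyI[of N], rule ballI)
      fix k s assume "N \<le> k" "s \<in> {a..b}"
      then have "1 / real (Suc k) \<le> 1 / real (Suc N)" by (simp add: frac_le)
      then show "dist (poly (P k) s) (f s) < e"
        using P[rule_format, OF \<open>s \<in> _\<close>, of k] N by (simp add: dist_real_def)
    qed
  qed
  then show ?thesis by blast
qed

section \<open>Functional calculus of self-adjoint elements of a corner\<close>

definition fc :: "'a::cstar_algebra \<Rightarrow> 'a \<Rightarrow> (real \<Rightarrow> real) \<Rightarrow> 'a" where
  "fc p h f = lim (\<lambda>k. ev p ((SOME P. uniform_limit {- norm h..norm h} (\<lambda>k. poly (P k)) f sequentially) k) h)"

definition sa :: "'a::cstar_algebra \<Rightarrow> 'a \<Rightarrow> bool" where
  "sa p h \<longleftrightarrow> projection p \<and> h \<in> corner p \<and> h\<^sup>\<star> = h"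

lemma uniform_limit_polyD:
  fixes f :: "real \<Rightarrow> real"
  assumes "uniform_limit S (\<lambda>k. poly (P k)) f sequentially" "0 < e"
  obtains N where "\<forall>k\<ge>N. \<forall>s\<in>S. \<bar>poly (P k) s - f s\<bar> < e"
  using uniform_limitD[OF assms] unfolding eventually_sequentially dist_real_def by blast

text \<open>A sup-norm contractive evaluation extends to uniform limits. It is abstract because it
  serves twice: for \<open>poly\<close> in a corner (\<open>fc\<close>) and for
  \<open>s * poly Q s\<close> in the whole algebra (\<open>fcalc\<close>).\<close>

lemma uniform_eval_limit:
  fixes \<Phi> :: "'b \<Rightarrow> 'a::banach" and u :: "'b \<Rightarrow> real \<Rightarrow> real"
  assumes \<Phi>: "\<And>P Q r. (\<And>s. s \<in> S \<Longrightarrow> \<bar>u P s - u Q s\<bar> \<le> r) \<Longrightarrow> norm (\<Phi> P - \<Phi> Q) \<le> r"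
    and P: "uniform_limit S (\<lambda>k. u (P k)) f sequentially" and Q: "uniform_limit S (\<lambda>k. u (Q k)) f sequentially"
  shows "convergent (\<lambda>k. \<Phi> (P k))" "(\<lambda>k. \<Phi> (P k) - \<Phi> (Q k)) \<longlonglongrightarrow> 0"
proof -
  have d: "\<exists>N. \<forall>k\<ge>N. \<forall>l\<ge>N. norm (\<Phi> (P k) - \<Phi> (Q l)) < e"
    if P: "uniform_limit S (\<lambda>k. u (P k)) f sequentially" and Q: "uniform_limit S (\<lambda>k. u (Q k)) f sequentially"
      and "0 < e" for P Q e
  proof -
    have e: "0 < e / 3" using \<open>0 < e\<close> by simp
    obtain N1 N2 where N: "\<forall>k\<ge>N1. \<forall>s\<in>S. \<bar>u (P k) s - f s\<bar> < e / 3" "\<forall>k\<ge>N2. \<forall>s\<in>S. \<bar>u (Q k) s - f s\<bar> < e / 3"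
      using uniform_limitD[OF P e] uniform_limitD[OF Q e] unfolding eventually_sequentially dist_real_def by blast
    have "norm (\<Phi> (P k) - \<Phi> (Q l)) < e" if "k \<ge> max N1 N2" "l \<ge> max N1 N2" for k l
    proof -
      have "norm (\<Phi> (P k) - \<Phi> (Q l)) \<le> 2 * e / 3"
      proof (rule \<Phi>)
        fix s assume "s \<in> S"
        then have "\<bar>u (P k) s - f s\<bar> < e / 3" "\<bar>u (Q l) s - f s\<bar> < e / 3" using N that by auto
        then show "\<bar>u (P k) s - u (Q l) s\<bar> \<le> 2 * e / 3" by linarith
      qed
      then show ?thesis using \<open>0 < e\<close> by linarith
    qed
    then show ?thesis by blast
  qed
  have "Cauchy (\<lambda>k. \<Phi> (P k))" by (rule CauchyI[OF d[OF P P]])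
  then show "convergent (\<lambda>k. \<Phi> (P k))" by (rule Cauchy_convergent)
  show "(\<lambda>k. \<Phi> (P k) - \<Phi> (Q k)) \<longlonglongrightarrow> 0"
  proof (rule LIMSEQ_I)
    fix e :: real assume "0 < e"
    from d[OF P Q this] show "\<exists>N. \<forall>k\<ge>N. norm (\<Phi> (P k) - \<Phi> (Q k) - 0) < e" by auto
  qed
qed

context
  fixes p h :: "'a::cstar_algebra"
  assumes sah: "sa p h"
begin

lemma sa_projection: "projection p" and sa_corner: "h \<in> corner p" and sa_star: "h\<^sup>\<star> = h"
  using sah by (auto simp: sa_def)

lemmas sa_ev = ev_corner[OF sa_projection sa_corner] ev_mult[OF sa_projection sa_corner]
  ev_star[OF sa_projection sa_corner sa_star] ev_X[OF sa_projection sa_corner]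

lemma sa_norm_ev_le:
  "norm h \<le> R \<Longrightarrow> (\<And>s. s \<in> {-R..R} \<Longrightarrow> \<bar>poly P s\<bar> \<le> M) \<Longrightarrow> norm (ev p P h) \<le> M"
  by (rule norm_ev_le[OF sa_projection sa_corner sa_star, of R]) (simp_all add: abs_le_iff)

lemma fc_limit:
  assumes f: "cont f" and R: "norm h \<le> R" and P: "uniform_limit {-R..R} (\<lambda>k. poly (P k)) f sequentially"
  shows "(\<lambda>k. ev p (P k) h) \<longlonglongrightarrow> fc p h f"
proof -
  let ?I = "{- norm h..norm h}"
  define Q where "Q = (SOME P. uniform_limit ?I (\<lambda>k. poly (P k)) f sequentially)"
  have Q: "uniform_limit ?I (\<lambda>k. poly (Q k)) f sequentially"
    unfolding Q_def by (rule someI_ex[OF polynomial_approximation[OF continuous_on_subset[OF f]]]) simp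
  have P': "uniform_limit ?I (\<lambda>k. poly (P k)) f sequentially"
    by (rule uniform_limit_on_subset[OF P]) (use R in auto)
  have \<Phi>: "norm (ev p A h - ev p B h) \<le> r" if "\<And>s. s \<in> ?I \<Longrightarrow> \<bar>poly A s - poly B s\<bar> \<le> r" for A B r
    unfolding ev_diff[symmetric] by (rule sa_norm_ev_le[OF order_refl]) (use that in simp)
  have "(\<lambda>k. ev p (Q k) h) \<longlonglongrightarrow> fc p h f"
    using uniform_eval_limit(1)[of ?I poly "\<lambda>A. ev p A h", OF \<Phi> Q Q] unfolding fc_def Q_def by (simp add: convergent_LIMSEQ_iff)
  from tendsto_add[OF uniform_eval_limit(2)[of ?I poly "\<lambda>A. ev p A h", OF \<Phi> P' Q] this] show ?thesis by simp
qed

lemma fc_approx: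
  assumes f: "cont f" and R: "norm h \<le> R"
  obtains P where "uniform_limit {-R..R} (\<lambda>k. poly (P k)) f sequentially" "(\<lambda>k. ev p (P k) h) \<longlonglongrightarrow> fc p h f"
  using polynomial_approximation[OF continuous_on_subset[OF f], of "-R" R] fc_limit[OF f R] by auto

lemma fc_poly: "fc p h (poly P) = ev p P h"
proof -
  have "(\<lambda>k. ev p P h) \<longlonglongrightarrow> fc p h (poly P)"
    by (rule fc_limit[OF _ order_refl]) (auto intro!: continuous_intros uniform_limit_const)
  then show ?thesis by (simp add: LIMSEQ_const_iff)
qed

lemma fc_const: "fc p h (\<lambda>_. c) = c *\<^sub>R p"
proof -
  have "poly [:c:] = (\<lambda>_. c)" by auto
  then show ?thesis using fc_poly[of "[:c:]"] by (simp add: ev_pCons)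
qed

lemma fc_id: "fc p h (\<lambda>s. s) = h"
proof -
  have "poly [:0,1:] = (\<lambda>s::real. s)" by auto
  then show ?thesis using fc_poly[of "[:0,1:]"] by (simp add: sa_ev)
qed

lemma fc_corner: "cont f \<Longrightarrow> fc p h f \<in> corner p"
  by (rule fc_approx[OF _ order_refl], assumption)
    (rule closed_sequentially[OF closed_corner], rule sa_ev(1))

lemma fc_star: "cont f \<Longrightarrow> (fc p h f)\<^sup>\<star> = fc p h f"
proof (rule fc_approx[OF _ order_refl], assumption)
  fix P assume "(\<lambda>k. ev p (P k) h) \<longlonglongrightarrow> fc p h f"
  from tendsto_star[OF this] this show ?thesis by (simp add: sa_ev(3) LIMSEQ_unique)
qed

lemma fc_sa: "cont f \<Longrightarrow> sa p (fc p h f)"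
  by (simp add: sa_def fc_star fc_corner sa_projection)

lemma fc_add:
  assumes "cont f" "cont g" shows "fc p h (\<lambda>s. f s + g s) = fc p h f + fc p h g"
proof -
  obtain P where P: "uniform_limit {-norm h..norm h} (\<lambda>k. poly (P k)) f sequentially" "(\<lambda>k. ev p (P k) h) \<longlonglongrightarrow> fc p h f"
    using fc_approx[OF assms(1) order_refl] by blast
  obtain Q where Q: "uniform_limit {-norm h..norm h} (\<lambda>k. poly (Q k)) g sequentially" "(\<lambda>k. ev p (Q k) h) \<longlonglongrightarrow> fc p h g"
    using fc_approx[OF assms(2) order_refl] by blast
  have "(\<lambda>k. ev p (P k + Q k) h) \<longlonglongrightarrow> fc p h (\<lambda>s. f s + g s)"
  proof (rule fc_limit[OF _ order_refl])
    show "uniform_limit {- norm h..norm h} (\<lambda>k. poly (P k + Q k)) (\<lambda>s. f s + g s) sequentially"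
      using uniform_limit_add[OF P(1) Q(1)] by (simp add: poly_add[abs_def])
  qed (intro continuous_intros assms)
  moreover have "(\<lambda>k. ev p (P k + Q k) h) \<longlonglongrightarrow> fc p h f + fc p h g"
    unfolding ev_add by (intro tendsto_intros P Q)
  ultimately show ?thesis by (rule LIMSEQ_unique)
qed

lemma fc_mult:
  assumes "cont f" "cont g" shows "fc p h (\<lambda>s. f s * g s) = fc p h f * fc p h g"
proof -
  obtain P where P: "uniform_limit {-norm h..norm h} (\<lambda>k. poly (P k)) f sequentially" "(\<lambda>k. ev p (P k) h) \<longlonglongrightarrow> fc p h f"
    using fc_approx[OF assms(1) order_refl] by blast
  obtain Q where Q: "uniform_limit {-norm h..norm h} (\<lambda>k. poly (Q k)) g sequentially" "(\<lambda>k. ev p (Q k) h) \<longlonglongrightarrow> fc p h g"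
    using fc_approx[OF assms(2) order_refl] by blast
  have b: "bounded (f' ` {-norm h..norm h})" if "cont f'" for f' :: "real \<Rightarrow> real"
    by (intro compact_imp_bounded compact_continuous_image compact_Icc continuous_on_subset[OF that]) simp
  have "(\<lambda>k. ev p (P k * Q k) h) \<longlonglongrightarrow> fc p h (\<lambda>s. f s * g s)"
  proof (rule fc_limit[OF _ order_refl])
    show "uniform_limit {- norm h..norm h} (\<lambda>k. poly (P k * Q k)) (\<lambda>s. f s * g s) sequentially"
      using uniform_lim_mult[OF P(1) Q(1) b[OF assms(1)] b[OF assms(2)]] by (simp add: poly_mult[abs_def])
  qed (intro continuous_intros assms)
  moreover have "(\<lambda>k. ev p (P k * Q k) h) \<longlonglongrightarrow> fc p h f * fc p h g"
    unfolding sa_ev by (intro tendsto_intros P Q)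
  ultimately show ?thesis by (rule LIMSEQ_unique)
qed

lemma fc_scaleR: "cont f \<Longrightarrow> fc p h (\<lambda>s. c * f s) = c *\<^sub>R fc p h f"
  using fc_mult[of "\<lambda>_. c" f] fc_corner[of f] by (simp add: fc_const cornerD)

lemma fc_diff:
  assumes "cont f" "cont g" shows "fc p h (\<lambda>s. f s - g s) = fc p h f - fc p h g"
proof -
  have "cont (\<lambda>s. -1 * g s)" by (intro continuous_intros assms)
  from fc_add[OF assms(1) this] fc_scaleR[OF assms(2), of "-1"] show ?thesis by simp
qed

lemma fc_norm_le:
  assumes f: "cont f" and R: "norm h \<le> R" and M: "\<And>s. \<bar>s\<bar> \<le> R \<Longrightarrow> \<bar>f s\<bar> \<le> M"
  shows "norm (fc p h f) \<le> M"
proof (rule field_le_epsilon)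
  fix e :: real assume e: "0 < e"
  obtain P where P: "uniform_limit {-R..R} (\<lambda>k. poly (P k)) f sequentially" "(\<lambda>k. ev p (P k) h) \<longlonglongrightarrow> fc p h f"
    using fc_approx[OF f R] by blast
  have "\<forall>\<^sub>F k in sequentially. norm (ev p (P k) h) \<le> M + e"
    using uniform_limitD[OF P(1) e]
  proof eventually_elim
    case (elim k)
    show ?case
    proof (rule sa_norm_ev_le[OF R])
      fix s assume s: "s \<in> {-R..R}"
      have "\<bar>poly (P k) s - f s\<bar> < e" using elim s by (auto simp: dist_real_def)
      moreover have "\<bar>f s\<bar> \<le> M" using M[of s] s by auto
      ultimately show "\<bar>poly (P k) s\<bar> \<le> M + e" by linarith
    qed
  qed
  then show "norm (fc p h f) \<le> M + e"
    by (rule tendsto_upperbound[OF tendsto_norm[OF P(2)]]) simp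
qed

lemma fc_cong:
  assumes "cont f" "cont g" "\<And>s. \<bar>s\<bar> \<le> norm h \<Longrightarrow> f s = g s"
  shows "fc p h f = fc p h g"
proof -
  have "norm (fc p h (\<lambda>s. f s - g s)) \<le> 0"
    by (rule fc_norm_le[OF _ order_refl]) (use assms in \<open>auto intro!: continuous_intros\<close>)
  then show ?thesis using fc_diff[OF assms(1,2)] by simp
qed

end

lemma cont_bounded_interval:
  assumes "cont g" obtains R where "0 \<le> R" "\<And>s. \<bar>s\<bar> \<le> r \<Longrightarrow> \<bar>g s\<bar> \<le> R"
proof -
  have "bounded (g ` {-r..r})"
    by (intro compact_imp_bounded compact_continuous_image compact_Icc continuous_on_subset[OF assms]) simp
  then obtain R where "\<forall>s\<in>{-r..r}. \<bar>g s\<bar> \<le> R" unfolding bounded_iff by auto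
  then have "\<bar>g s\<bar> \<le> max R 0" if "\<bar>s\<bar> \<le> r" for s
    using that by (simp add: abs_le_iff le_max_iff_disj)
  then show thesis by (intro that[of "max R 0"]) auto
qed

lemma fc_comp:
  assumes h: "sa p h" and f: "cont f" and g: "cont g"
  shows "fc p (fc p h g) f = fc p h (\<lambda>s. f (g s))"
proof -
  obtain R where R: "\<And>s. \<bar>s\<bar> \<le> norm h \<Longrightarrow> \<bar>g s\<bar> \<le> R"
    using cont_bounded_interval[OF g] by blast
  have fg: "cont (\<lambda>s. f (g s))" using continuous_on_compose2[OF f g] by simp
  have n: "norm (fc p h g) \<le> R" by (rule fc_norm_le[OF h g order_refl R])
  obtain P where P: "uniform_limit {-R..R} (\<lambda>k. poly (P k)) f sequentially"
     "(\<lambda>k. ev p (P k) (fc p h g)) \<longlonglongrightarrow> fc p (fc p h g) f"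
    using fc_approx[OF fc_sa[OF h g] f n] by blast
  have pc: "cont (\<lambda>s. poly Q (g s))" for Q by (intro continuous_intros g)
  have ev: "ev p Q (fc p h g) = fc p h (\<lambda>s. poly Q (g s))" for Q
  proof (induction Q)
    case (pCons a Q)
    have "fc p h (\<lambda>s. a + g s * poly Q (g s)) = a *\<^sub>R p + fc p h g * fc p h (\<lambda>s. poly Q (g s))"
      using fc_add[OF h, of "\<lambda>_. a" "\<lambda>s. g s * poly Q (g s)"] fc_mult[OF h g pc]
      by (simp add: fc_const[OF h] continuous_intros g)
    then show ?case using pCons by (simp add: ev_pCons)
  qed (simp add: fc_const[OF h])
  have "(\<lambda>k. ev p (P k) (fc p h g)) \<longlonglongrightarrow> fc p h (\<lambda>s. f (g s))"
  proof (rule LIMSEQ_I)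
    fix e :: real assume "0 < e"
    then have e: "0 < e / 2" by simp
    obtain N where N: "\<forall>k\<ge>N. \<forall>s\<in>{-R..R}. \<bar>poly (P k) s - f s\<bar> < e / 2"
      using uniform_limit_polyD[OF P(1) e] .
    have "norm (ev p (P k) (fc p h g) - fc p h (\<lambda>s. f (g s))) \<le> e / 2" if "k \<ge> N" for k
      unfolding ev fc_diff[OF h pc fg, symmetric]
    proof (rule fc_norm_le[OF h _ order_refl])
      fix s assume "\<bar>s\<bar> \<le> norm h"
      then have "g s \<in> {-R..R}" using R by (auto simp: abs_le_iff minus_le_iff)
      then show "\<bar>poly (P k) (g s) - f (g s)\<bar> \<le> e / 2" using N that less_imp_le by blast
    qed (intro continuous_intros pc fg)
    with \<open>0 < e\<close> show "\<exists>N. \<forall>n\<ge>N. norm (ev p (P n) (fc p h g) - fc p h (\<lambda>s. f (g s))) < e"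
      by (intro exI[of _ N]) (auto intro: le_less_trans[of _ "e/2"])
  qed
  with P(2) show ?thesis by (rule LIMSEQ_unique)
qed

text \<open>The relation passes through polynomials factor by factor, then to limits. The intended
  case is \<open>h = x\<^sup>\<star> * x\<close>, \<open>h' = x * x\<^sup>\<star>\<close>,
  \<open>y = x\<close>.\<close>

lemma fc_intertwine:
  assumes h: "sa p h" and h': "sa p h'" and y: "y \<in> corner p" and eq: "y * h = h' * y" and f: "cont f"
  shows "y * fc p h f = fc p h' f * y"
proof -
  define R where "R = max (norm h) (norm h')"
  obtain P where P: "uniform_limit {-R..R} (\<lambda>k. poly (P k)) f sequentially" "(\<lambda>k. ev p (P k) h) \<longlonglongrightarrow> fc p h f"
    using fc_approx[OF h f, of R] by (auto simp: R_def)
  have P': "(\<lambda>k. ev p (P k) h') \<longlonglongrightarrow> fc p h' f" by (rule fc_limit[OF h' f _ P(1)]) (simp add: R_def)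
  have "y * ev p Q h = ev p Q h' * y" for Q
  proof (induction Q)
    case (pCons a Q)
    have "y * (h * ev p Q h) = h' * (y * ev p Q h)" using eq by (simp add: mult.assoc[symmetric])
    then show ?case using pCons y by (simp add: ev_pCons algebra_simps cornerD)
  qed simp
  then have "(\<lambda>k. y * ev p (P k) h) \<longlonglongrightarrow> fc p h' f * y"
    using tendsto_mult_right[OF P', of y] by simp
  then show ?thesis using tendsto_mult_left[OF P(2), of y] LIMSEQ_unique by blast
qed

lemma fc_tendsto:
  assumes hn: "\<And>n. sa p (H n)" and h: "sa p h" and lim: "H \<longlonglongrightarrow> h" and f: "cont f"
  shows "(\<lambda>n. fc p (H n) f) \<longlonglongrightarrow> fc p h f"
proof (rule LIMSEQ_I)
  fix e :: real assume "0 < e"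
  then have e: "0 < e / 4" by simp
  have "Bseq H" using lim by (auto intro: convergent_imp_Bseq convergentI)
  then obtain R where R: "\<And>n. norm (H n) \<le> R" by (auto simp: Bseq_def)
  have Rh: "norm h \<le> R" by (rule LIMSEQ_le_const2[OF tendsto_norm[OF lim]]) (use R in auto)
  obtain P where P: "uniform_limit {-R..R} (\<lambda>k. poly (P k)) f sequentially"
    using fc_approx[OF h f Rh] by blast
  obtain k where k: "\<forall>s\<in>{-R..R}. \<bar>poly (P k) s - f s\<bar> < e / 4"
    using uniform_limit_polyD[OF P e] by (metis order_refl)
  have d: "norm (ev p (P k) x - fc p x f) \<le> e / 4" if x: "sa p x" "norm x \<le> R" for x
  proof -
    have "norm (fc p x (\<lambda>s. poly (P k) s - f s)) \<le> e / 4"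
    proof (rule fc_norm_le[OF x(1) _ x(2)])
      fix s assume "\<bar>s\<bar> \<le> R"
      then have "s \<in> {-R..R}" by (simp add: abs_le_iff)
      then show "\<bar>poly (P k) s - f s\<bar> \<le> e / 4" using k less_imp_le by blast
    qed (intro continuous_intros f)
    then show ?thesis using fc_diff[OF x(1) _ f, of "poly (P k)"] fc_poly[OF x(1)] by (simp add: continuous_intros)
  qed
  have "(\<lambda>n. ev p Q (H n)) \<longlonglongrightarrow> ev p Q h" for Q
    by (induction Q) (auto simp: ev_pCons intro!: tendsto_intros lim)
  from LIMSEQ_D[OF this e] obtain N where N: "\<And>n. n \<ge> N \<Longrightarrow> norm (ev p (P k) (H n) - ev p (P k) h) < e / 4" by blast
  have "norm (fc p (H n) f - fc p h f) < e" if "n \<ge> N" for n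
  proof -
    have "fc p (H n) f - fc p h f = (ev p (P k) (H n) - ev p (P k) h)
       - (ev p (P k) (H n) - fc p (H n) f) + (ev p (P k) h - fc p h f)" by simp
    also have "norm \<dots> \<le> norm (ev p (P k) (H n) - ev p (P k) h) + norm (ev p (P k) (H n) - fc p (H n) f)
        + norm (ev p (P k) h - fc p h f)"
      by (rule norm_triangle_le[OF add_right_mono[OF norm_triangle_ineq4]])
    finally show ?thesis using N[OF that] d[OF hn R, of n] d[OF h Rh] \<open>0 < e\<close> by linarith
  qed
  then show "\<exists>N. \<forall>n\<ge>N. norm (fc p (H n) f - fc p h f) < e" by blast
qed

section \<open>Positivity in a corner\<close>

text \<open>The condition says that the spectrum of \<open>h\<close> lies in \<open>[0, 2 M]\<close>; in this form stability
  under sums is the triangle inequality.\<close>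

definition nn :: "'a::cstar_algebra \<Rightarrow> 'a \<Rightarrow> bool" where
  "nn p h \<longleftrightarrow> sa p h \<and> (\<exists>M\<ge>0. norm (h - M *\<^sub>R p) \<le> M)"

lemma nn_sa: "nn p h \<Longrightarrow> sa p h" by (simp add: nn_def)

lemma sa_add: "sa p a \<Longrightarrow> sa p b \<Longrightarrow> sa p (a + b)"
  by (auto simp: sa_def star_add corner_add)

lemma sa_scaleR: "sa p a \<Longrightarrow> sa p (c *\<^sub>R a)"
  by (auto simp: sa_def star_scaleR corner_scaleR)

lemma sa_self: "projection p \<Longrightarrow> sa p p"
  by (auto simp: sa_def corner_self projection_def)

lemma nn_zero: "projection p \<Longrightarrow> nn p 0"
  by (auto simp: nn_def sa_def intro!: exI[of _ 0])

lemma nn_add: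
  assumes "nn p a" "nn p b" shows "nn p (a + b)"
proof -
  from assms obtain M N where M: "M \<ge> 0" "norm (a - M *\<^sub>R p) \<le> M" "N \<ge> 0" "norm (b - N *\<^sub>R p) \<le> N"
    by (auto simp: nn_def)
  have "a + b - (M + N) *\<^sub>R p = (a - M *\<^sub>R p) + (b - N *\<^sub>R p)" by (simp add: algebra_simps)
  then have "norm (a + b - (M + N) *\<^sub>R p) \<le> M + N" using M by (metis norm_triangle_mono)
  then show ?thesis using assms M by (auto simp: nn_def sa_add intro!: exI[of _ "M + N"])
qed

lemma nn_scaleR:
  assumes "nn p a" "c \<ge> 0" shows "nn p (c *\<^sub>R a)"
proof -
  from assms obtain M where M: "M \<ge> 0" "norm (a - M *\<^sub>R p) \<le> M" by (auto simp: nn_def)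
  have "c *\<^sub>R a - (c * M) *\<^sub>R p = c *\<^sub>R (a - M *\<^sub>R p)" by (simp add: algebra_simps)
  then have "norm (c *\<^sub>R a - (c * M) *\<^sub>R p) \<le> c * M" using M assms by (simp add: mult_left_mono)
  then show ?thesis using assms M by (auto simp: nn_def sa_scaleR intro!: exI[of _ "c * M"])
qed

lemma nn_square:
  assumes r: "sa p r" shows "nn p (r * r)"
proof -
  have c: "cont (\<lambda>s. s * s)" "cont (\<lambda>s. s * s - (norm r)\<^sup>2)" by (intro continuous_intros)+
  have "fc p r (\<lambda>s. s * s - (norm r)\<^sup>2) = r * r - (norm r)\<^sup>2 *\<^sub>R p"
    using fc_diff[OF r c(1), of "\<lambda>_. (norm r)\<^sup>2"] fc_mult[OF r, of "\<lambda>s. s" "\<lambda>s. s"]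
    by (simp add: fc_id[OF r] fc_const[OF r] continuous_intros)
  moreover have "norm (fc p r (\<lambda>s. s * s - (norm r)\<^sup>2)) \<le> (norm r)\<^sup>2"
  proof (rule fc_norm_le[OF r c(2) order_refl])
    fix s :: real assume "\<bar>s\<bar> \<le> norm r"
    then have "s\<^sup>2 \<le> (norm r)\<^sup>2" by (metis abs_norm_cancel abs_le_square_iff)
    then show "\<bar>s * s - (norm r)\<^sup>2\<bar> \<le> (norm r)\<^sup>2" using zero_le_square[of s] by (simp add: power2_eq_square[of s] abs_le_iff)
  qed
  moreover have "sa p (r * r)" using r by (auto simp: sa_def star_mult corner_mult)
  ultimately show ?thesis by (auto simp: nn_def intro!: exI[of _ "(norm r)\<^sup>2"])
qed

lemma fc_sqrt:
  assumes h: "sa p h" and f: "cont f" "\<And>s. 0 \<le> f s"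
  shows "fc p h f = fc p h (\<lambda>s. sqrt (f s)) * fc p h (\<lambda>s. sqrt (f s))"
proof -
  have "cont (\<lambda>s. sqrt (f s))" by (intro continuous_intros f)
  from fc_mult[OF h this this] show ?thesis using f(2) by simp
qed

lemma fc_positive:
  assumes h: "sa p h" and f: "cont f" "\<And>s. 0 \<le> f s"
  shows "fc p h f \<in> positives"
proof -
  have "cont (\<lambda>s. sqrt (f s))" by (intro continuous_intros f)
  from fc_star[OF h this] have "fc p h f = (fc p h (\<lambda>s. sqrt (f s)))\<^sup>\<star> * fc p h (\<lambda>s. sqrt (f s))"
    using fc_sqrt[OF h f] by simp
  then show ?thesis by (auto simp: positives_def pos_cone_def)
qed

lemma nn_fc:
  assumes h: "sa p h" and f: "cont f" "\<And>s. 0 \<le> f s"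
  shows "nn p (fc p h f)"
proof -
  have "cont (\<lambda>s. sqrt (f s))" by (intro continuous_intros f)
  from nn_square[OF fc_sa[OF h this]] fc_sqrt[OF h f] show ?thesis by simp
qed

text \<open>\<open>h - M *\<^sub>R p\<close> has norm at most \<open>M\<close>, so a function
  vanishing on \<open>[-M, M]\<close> sends it to 0. Translated by \<open>M\<close>, this applies to
  \<open>f s - f (max s 0)\<close>, so values of \<open>f\<close> at negative arguments do not
  matter.\<close>

lemma fc_cong_nn:
  assumes h: "nn p h" and f: "cont f" and g: "cont g" and eq: "\<And>s. 0 \<le> s \<Longrightarrow> s \<le> norm h \<Longrightarrow> f s = g s"
  shows "fc p h f = fc p h g"
proof -
  have half: "fc p h f = fc p h (\<lambda>s. f (max s 0))" if f: "cont f" for f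
  proof -
    obtain M where M: "M \<ge> 0" "norm (h - M *\<^sub>R p) \<le> M" using h by (auto simp: nn_def)
    note h = nn_sa[OF h]
    define d where "d = (\<lambda>s. f s - f (max s 0))"
    have fm: "cont (\<lambda>s. f (max s 0))" by (rule continuous_on_compose2[OF f]) (auto intro!: continuous_intros)
    have d: "cont d" unfolding d_def by (intro continuous_intros f fm)
    have h': "h - M *\<^sub>R p = fc p h (\<lambda>s. s - M)"
      using fc_diff[OF h, of "\<lambda>s. s" "\<lambda>_. M"] by (simp add: fc_id[OF h] fc_const[OF h] continuous_intros)
    have dM: "cont (\<lambda>s. d (s + M))" by (rule continuous_on_compose2[OF d]) (auto intro!: continuous_intros)
    have sM: "cont (\<lambda>s. s - M)" by (intro continuous_intros)
    have "norm (fc p (h - M *\<^sub>R p) (\<lambda>s. d (s + M))) \<le> 0"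
      by (rule fc_norm_le[OF _ dM M(2)]) (auto simp: h' fc_sa[OF h sM] d_def)
    then have "fc p h d = 0"
      unfolding h' fc_comp[OF h dM sM] by simp
    then show ?thesis unfolding d_def using fc_diff[OF h f fm] by simp
  qed
  have *: "cont (\<lambda>s. f (max s 0))" if "cont f" for f :: "real \<Rightarrow> real"
    by (rule continuous_on_compose2[OF that]) (auto intro!: continuous_intros)
  have "fc p h (\<lambda>s. f (max s 0)) = fc p h (\<lambda>s. g (max s 0))"
    by (rule fc_cong[OF nn_sa[OF h] *[OF f] *[OF g]]) (auto intro!: eq)
  then show ?thesis using half[OF f] half[OF g] by simp
qed

lemma fc_norm_le_nn:
  assumes h: "nn p h" and f: "cont f" and M: "\<And>s. 0 \<le> s \<Longrightarrow> s \<le> norm h \<Longrightarrow> \<bar>f s\<bar> \<le> M"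
  shows "norm (fc p h f) \<le> M"
proof -
  have c: "cont (\<lambda>s. f (max s 0))" by (rule continuous_on_compose2[OF f]) (auto intro!: continuous_intros)
  have "fc p h f = fc p h (\<lambda>s. f (max s 0))" by (rule fc_cong_nn[OF h f c]) auto
  moreover have "norm \<dots> \<le> M" by (rule fc_norm_le[OF nn_sa[OF h] c order_refl]) (auto intro!: M)
  ultimately show ?thesis by simp
qed

text \<open>For \<open>N = norm (a + b)\<close>, the element \<open>N *\<^sub>R p - a\<close> is the
  sum of \<open>N *\<^sub>R p - (a + b)\<close> and \<open>b\<close>, hence nonnegative. So the part
  of \<open>a\<close> above \<open>N\<close> vanishes.\<close>

lemma nn_norm_mono:
  assumes a: "nn p a" and b: "nn p b" shows "norm a \<le> norm (a + b)"
proof -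
  define N where "N = norm (a + b)"
  note sab = nn_sa[OF nn_add[OF a b]] and saa = nn_sa[OF a]
  have c: "cont (\<lambda>s. max (N - s) 0)" "cont (\<lambda>s. N - s)" "cont (\<lambda>s. max (-s) 0)" "cont (\<lambda>s. min s N)"
    "cont (\<lambda>s. max (s - N) 0)" "cont (\<lambda>s. s)"
    by (intro continuous_intros)+
  have comp: "fc p x (\<lambda>s. N - s) = N *\<^sub>R p - x" if "sa p x" for x
    using fc_diff[OF that, of "\<lambda>_. N" "\<lambda>s. s"] that by (simp add: fc_id fc_const continuous_intros)
  have "nn p (fc p (a + b) (\<lambda>s. max (N - s) 0))" by (rule nn_fc[OF sab c(1)]) simp
  also have "fc p (a + b) (\<lambda>s. max (N - s) 0) = fc p (a + b) (\<lambda>s. N - s)"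
    by (rule fc_cong[OF sab c(1,2)]) (simp add: N_def)
  finally have "nn p (N *\<^sub>R p - (a + b))" using comp[OF sab] by simp
  from nn_add[OF this b] have "nn p (N *\<^sub>R p - a)" by (simp add: algebra_simps)
  then have nn: "nn p (fc p a (\<lambda>s. N - s))" by (simp add: comp[OF saa])
  have "norm (fc p (fc p a (\<lambda>s. N - s)) (\<lambda>s. max (-s) 0)) \<le> 0"
    by (rule fc_norm_le_nn[OF nn c(3)]) simp
  then have "fc p a (\<lambda>s. max (s - N) 0) = 0" unfolding fc_comp[OF saa c(3,2)] by simp
  moreover have "a = fc p a (\<lambda>s. min s N + max (s - N) 0)"
  proof -
    have "(\<lambda>s. min s N + max (s - N) 0) = (\<lambda>s::real. s)" by (auto simp: fun_eq_iff)
    then show ?thesis by (simp add: fc_id[OF saa])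
  qed
  ultimately have "a = fc p a (\<lambda>s. min s N)" using fc_add[OF saa c(4,5)] by simp
  moreover have "norm (fc p a (\<lambda>s. min s N)) \<le> N"
    by (rule fc_norm_le_nn[OF a c(4)]) (auto simp: N_def abs_if min_def)
  ultimately show ?thesis by (simp add: N_def)
qed

text \<open>Let \<open>k\<close> be the negative part of \<open>y\<^sup>\<star> * y\<close> and
  multiply \<open>y\<close> by its root to get \<open>x\<close> with
  \<open>x\<^sup>\<star> * x = - (k * k)\<close>. Since
  \<open>x * x\<^sup>\<star> + x\<^sup>\<star> * x\<close> is half a sum of two squares of
  self-adjoint elements, \<open>x * x\<^sup>\<star>\<close> is nonnegative. Intertwining the
  positive parts of \<open>x\<^sup>\<star> * x\<close> (zero) and \<open>x * x\<^sup>\<star>\<close>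
  (everything) by \<open>x\<close> gives \<open>x * x\<^sup>\<star> * x = 0\<close>, hence
  \<open>k = 0\<close>.\<close>

theorem nn_star_mult_self:
  assumes p: "projection p" and y: "y \<in> corner p" shows "nn p (y\<^sup>\<star> * y)"
proof -
  define h where "h = y\<^sup>\<star> * y"
  have ys: "y\<^sup>\<star> \<in> corner p" using p y by (rule corner_star)
  have h: "sa p h" using p y ys by (auto simp: sa_def h_def star_mult star_star corner_mult)
  let ?neg = "\<lambda>s::real. max (-s) 0"
  have c: "cont ?neg" "cont (\<lambda>s. sqrt (?neg s))" "cont (\<lambda>s. s)" "cont (\<lambda>s. max s 0)" "cont (\<lambda>s. -(s * s))"
    "cont (\<lambda>s. s * sqrt (?neg s))"
    by (intro continuous_intros)+
  define g where "g = fc p h (\<lambda>s. sqrt (?neg s))"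
  define k where "k = fc p h ?neg"
  have g: "sa p g" and k: "sa p k" using fc_sa[OF h] c by (auto simp: g_def k_def)
  define x where "x = y * g"
  have x: "x \<in> corner p" "x\<^sup>\<star> \<in> corner p" using y g p by (auto simp: x_def sa_def intro!: corner_mult corner_star)
  have "x\<^sup>\<star> * x = g * h * g" using g by (simp add: x_def h_def star_mult sa_def mult.assoc)
  also have "\<dots> = fc p h (\<lambda>s. sqrt (?neg s) * (s * sqrt (?neg s)))"
    unfolding fc_mult[OF h c(2,6)] fc_mult[OF h c(3,2)] fc_id[OF h] g_def by (simp add: mult.assoc)
  also have "(\<lambda>s. sqrt (?neg s) * (s * sqrt (?neg s))) = (\<lambda>s. -1 * (?neg s * ?neg s))"
    by (auto simp: fun_eq_iff max_def) (simp add: mult.left_commute)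
  also have "fc p h \<dots> = - (k * k)"
    using fc_scaleR[OF h, of "\<lambda>s. ?neg s * ?neg s" "-1"] fc_mult[OF h c(1,1)] by (simp add: k_def continuous_intros)
  finally have xx: "x\<^sup>\<star> * x = - (k * k)" .
  have xsa: "sa p (x\<^sup>\<star> * x)" "sa p (x * x\<^sup>\<star>)"
    using x p by (auto simp: sa_def star_mult star_star corner_mult)
  define A where "A = x + x\<^sup>\<star>"
  define B where "B = \<i> *\<^sub>C (x - x\<^sup>\<star>)"
  have A: "sa p A" using x p by (auto simp: A_def sa_def star_add star_star corner_add add.commute)
  have B: "sa p B"
    using x p by (auto simp: B_def sa_def star_scaleC star_diff star_star corner_diff corner_scaleC scaleC_minus scaleC_diff_right)
  have "A * A + B * B = 2 *\<^sub>R (x * x\<^sup>\<star>) + 2 *\<^sub>R (x\<^sup>\<star> * x)"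
    by (simp add: A_def B_def mult_scaleC_left mult_scaleC_right scaleC_scaleC scaleC_minus_one scaleC_diff_right algebra_simps scaleR_2)
  then have "2 *\<^sub>R (x * x\<^sup>\<star>) = A * A + B * B + 2 *\<^sub>R (k * k)" by (simp add: xx)
  moreover have "nn p ((1/2) *\<^sub>R (A * A + B * B + 2 *\<^sub>R (k * k)))"
    by (intro nn_scaleR nn_add nn_square A B k) auto
  ultimately have "nn p ((1/2) *\<^sub>R (2 *\<^sub>R (x * x\<^sup>\<star>)))" by (simp only:)
  then have nn: "nn p (x * x\<^sup>\<star>)" by simp
  have kk: "- (k * k) = fc p k (\<lambda>s. -(s * s))"
    using fc_scaleR[OF k, of "\<lambda>s. s * s" "-1"] fc_mult[OF k c(3,3)] by (simp add: fc_id[OF k] continuous_intros)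
  have "(\<lambda>s::real. max (- (s * s)) 0) = (\<lambda>s. 0)" by (simp add: fun_eq_iff)
  then have "fc p (x\<^sup>\<star> * x) (\<lambda>s. max s 0) = 0"
    unfolding xx kk fc_comp[OF k c(4,5)] by (simp add: fc_const[OF k])
  moreover have "fc p (x * x\<^sup>\<star>) (\<lambda>s. max s 0) = x * x\<^sup>\<star>"
    using fc_cong_nn[OF nn c(4,3)] by (simp add: fc_id[OF xsa(2)])
  ultimately have "x * x\<^sup>\<star> * x = 0"
    using fc_intertwine[OF xsa x(1) _ c(4)] by (simp add: mult.assoc)
  then have "(x\<^sup>\<star> * x) * (x\<^sup>\<star> * x) = 0" by (simp add: mult.assoc)
  then have "x\<^sup>\<star> * x = 0" using selfadjoint_square_eq_0[of "x\<^sup>\<star> * x"] xsa by (simp add: sa_def)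
  then have "k = 0" using xx selfadjoint_square_eq_0[of k] k by (simp add: sa_def)
  moreover have "h = fc p h (\<lambda>s. max s 0) - k"
  proof -
    have "(\<lambda>s. max s 0 - ?neg s) = (\<lambda>s. s)" by (auto simp: fun_eq_iff)
    then show ?thesis using fc_diff[OF h c(4,1)] by (simp add: k_def fc_id[OF h])
  qed
  moreover have "nn p (fc p h (\<lambda>s. max s 0))" by (rule nn_fc[OF h c(4)]) simp
  ultimately show ?thesis by (simp add: h_def)
qed

lemma norm_diff_unit_le:
  assumes h: "nn p h" and N: "norm h \<le> N" shows "norm (h - N *\<^sub>R p) \<le> N"
proof -
  have "norm (fc p h (\<lambda>s. s - N)) \<le> N"
    by (rule fc_norm_le_nn[OF h]) (use N in \<open>auto intro!: continuous_intros\<close>)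
  then show ?thesis
    using fc_diff[OF nn_sa[OF h], of "\<lambda>s. s" "\<lambda>_. N"]
    by (simp add: fc_id[OF nn_sa[OF h]] fc_const[OF nn_sa[OF h]] continuous_intros)
qed

lemma norm_ev_nn_le:
  assumes h: "nn p h" and M: "\<And>s. 0 \<le> s \<Longrightarrow> s \<le> norm h \<Longrightarrow> \<bar>poly P s\<bar> \<le> M"
  shows "norm (ev p P h) \<le> M"
  unfolding fc_poly[OF nn_sa[OF h], symmetric] by (rule fc_norm_le_nn[OF h _ M]) (intro continuous_intros)

section \<open>Positive elements of an algebra with an approximate unit of projections\<close>

lemma norm_limit_le: "X \<longlonglongrightarrow> x \<Longrightarrow> (\<And>n. norm (X n) \<le> M) \<Longrightarrow> norm x \<le> M"
  by (rule LIMSEQ_le_const2[OF tendsto_norm]) auto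

lemma positivesI: "x\<^sup>\<star> * x \<in> positives"
  by (auto simp: positives_def pos_cone_def)

lemma positivesE: "a \<in> positives \<Longrightarrow> (\<And>x. a = x\<^sup>\<star> * x \<Longrightarrow> thesis) \<Longrightarrow> thesis"
  by (auto simp: positives_def pos_cone_def)

lemma positives_star: "a \<in> positives \<Longrightarrow> a\<^sup>\<star> = a"
  by (auto elim!: positivesE simp: star_mult star_star)

lemma projection_positive: "projection q \<Longrightarrow> q \<in> positives"
  using positivesI[of q] by (simp add: projection_def)

lemma nn_positive: assumes "nn q h" shows "h \<in> positives"
proof -
  have c: "cont (\<lambda>s. max s 0)" "cont (\<lambda>s. s)" by (intro continuous_intros)+
  have "fc q h (\<lambda>s. max s 0) = fc q h (\<lambda>s. s)" by (rule fc_cong_nn[OF assms c]) auto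
  then have "h = fc q h (\<lambda>s. max s 0)" by (simp add: fc_id[OF nn_sa[OF assms]])
  also have "\<dots> \<in> positives" by (rule fc_positive[OF nn_sa[OF assms] c(1)]) simp
  finally show ?thesis .
qed

lemma poly_eval0_ev: "poly_eval0 Q a = ev a Q a"
  by (simp add: poly_eval0_def ev_def)

lemma poly_eval0_corner: "a \<in> corner q \<Longrightarrow> poly_eval0 Q a = ev q (pCons 0 Q) a"
  unfolding poly_eval0_ev
  by (induction Q) (auto simp: ev_pCons cornerD algebra_simps)

lemma poly_eval0_orthogonal:
  assumes "a * b = 0" "b * a = 0"
  shows "poly_eval0 Q (a + b) = poly_eval0 Q a + poly_eval0 Q b"
proof -
  have o: "a * ev b Q b = 0" "b * ev a Q a = 0" for Q
    using assms by (induction Q) (auto simp: ev_pCons algebra_simps, (metis mult.assoc mult_zero_left)+)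
  show ?thesis unfolding poly_eval0_ev
    by (induction Q) (auto simp: ev_pCons algebra_simps o)
qed

lemma tendsto_poly_eval0:
  assumes "(A \<longlongrightarrow> a) F" shows "((\<lambda>n. poly_eval0 Q (A n)) \<longlongrightarrow> poly_eval0 Q a) F"
  unfolding poly_eval0_ev
proof (induction Q)
  case (pCons c Q)
  then show ?case unfolding ev_pCons by (intro tendsto_intros assms)
qed simp

lemma polynomial_approximation_0:
  assumes f: "cont f" "f 0 = 0" and ab: "a \<le> 0" "0 \<le> b"
  obtains Q where "uniform_limit {a..b} (\<lambda>k s. s * poly (Q k) s) f sequentially"
proof -
  obtain P where P: "uniform_limit {a..b} (\<lambda>k. poly (P k)) f sequentially"
    using polynomial_approximation[OF continuous_on_subset[OF f(1)]] by blast
  have "\<exists>Q. \<forall>k. P k = pCons (poly (P k) 0) (Q k)"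
    by (rule choice) (metis pCons_cases poly_pCons add.right_neutral mult_zero_left)
  then obtain Q where Q: "\<And>k. P k = pCons (poly (P k) 0) (Q k)" by blast
  have Qs: "s * poly (Q k) s = poly (P k) s - poly (P k) 0" for k s
    using arg_cong[OF Q[of k], of "\<lambda>P. poly P s"] by simp
  have "uniform_limit {a..b} (\<lambda>k s. s * poly (Q k) s) f sequentially"
  proof (rule uniform_limitI)
    fix e :: real assume "0 < e"
    then have "0 < e / 2" by simp
    from uniform_limitD[OF P this] show "\<forall>\<^sub>F k in sequentially. \<forall>s\<in>{a..b}. dist (s * poly (Q k) s) (f s) < e"
    proof eventually_elim
      case (elim k)
      show ?case
      proof
        fix s assume "s \<in> {a..b}"
        then have "\<bar>poly (P k) s - f s\<bar> < e / 2" "\<bar>poly (P k) 0 - f 0\<bar> < e / 2"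
          using elim ab unfolding dist_real_def by auto
        then show "dist (s * poly (Q k) s) (f s) < e"
          unfolding Qs dist_real_def using f(2) by linarith
      qed
    qed
  qed
  then show thesis using that by blast
qed

section \<open>Transfer from corners to the whole algebra, and the functional calculus
  \<open>fcalc\<close>\<close>

locale projection_unit =
  fixes p :: "nat \<Rightarrow> 'a::cstar_algebra"
  assumes proj: "projection (p n)"
    and left_unit: "(\<lambda>n. p n * a) \<longlonglongrightarrow> a"
    and right_unit: "(\<lambda>n. a * p n) \<longlonglongrightarrow> a"
begin

definition compress :: "nat \<Rightarrow> 'a \<Rightarrow> 'a" where "compress n x = p n * x * p n"

lemma norm_p_mult_le: "norm (p n * x) \<le> norm x" "norm (x * p n) \<le> norm x"
  using norm_mult_ineq[of "p n" x] norm_mult_ineq[of x "p n"]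
    mult_left_le_one_le[of "norm x" "norm (p n)"] mult_right_le_one_le[of "norm x" "norm (p n)"]
    norm_projection_le[OF proj, of n] by auto

lemma tendsto_compress: assumes "X \<longlonglongrightarrow> x" shows "(\<lambda>n. compress n (X n)) \<longlonglongrightarrow> x"
proof -
  have pX: "(\<lambda>n. p n * X n) \<longlonglongrightarrow> x"
  proof -
    have "(\<lambda>n. p n * (X n - x)) \<longlonglongrightarrow> 0"
      by (rule Lim_null_comparison[of _ "\<lambda>n. norm (X n - x)"])
        (use norm_p_mult_le assms in \<open>auto simp: tendsto_norm_zero_iff LIM_zero_iff\<close>)
    from tendsto_add[OF this left_unit[of x]] show ?thesis by (simp add: algebra_simps)
  qed
  have "(\<lambda>n. (p n * X n - x) * p n) \<longlonglongrightarrow> 0"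
    by (rule Lim_null_comparison[of _ "\<lambda>n. norm (p n * X n - x)"])
      (use norm_p_mult_le pX in \<open>auto simp: tendsto_norm_zero_iff LIM_zero_iff\<close>)
  from tendsto_add[OF this right_unit[of x]] show ?thesis by (simp add: compress_def algebra_simps)
qed

text \<open>The bridge from corners to \<open>A\<close>. Compressing the factor \<open>x\<close> of
  \<open>e = x\<^sup>\<star> * x\<close>, rather than \<open>e\<close>, gives positivity by
  \<open>nn_star_mult_self\<close> and the norm bound by the C*-identity.\<close>

lemma positive_approx:
  assumes "(e::'a) \<in> positives"
  shows "\<exists>E. (\<forall>n. nn (p n) (E n) \<and> norm (E n) \<le> norm e) \<and> E \<longlonglongrightarrow> e"
proof -
  obtain x where x: "e = x\<^sup>\<star> * x" using assms by (rule positivesE)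
  define E where "E n = (compress n x)\<^sup>\<star> * compress n x" for n
  have "nn (p n) (E n)" for n
    unfolding E_def compress_def by (intro nn_star_mult_self proj corner_compress)
  moreover have "norm (E n) \<le> norm e" for n
  proof -
    have "norm (compress n x) \<le> norm x"
      unfolding compress_def using norm_p_mult_le order_trans by blast
    then show ?thesis unfolding E_def x cstar_identity by (simp add: power_mono)
  qed
  moreover have "E \<longlonglongrightarrow> e"
    unfolding E_def x by (intro tendsto_intros tendsto_star tendsto_compress)
  ultimately show ?thesis by blast
qed

lemma norm_poly_eval0_le:
  assumes e: "(e::'a) \<in> positives" and M: "\<And>s. 0 \<le> s \<Longrightarrow> s \<le> norm e \<Longrightarrow> \<bar>s * poly Q s\<bar> \<le> M"
  shows "norm (poly_eval0 Q e) \<le> M"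
proof -
  obtain E where E0: "\<forall>n. nn (p n) (E n) \<and> norm (E n) \<le> norm e" "E \<longlonglongrightarrow> e"
    using positive_approx[OF e] by blast
  note E = E0(1)[rule_format, THEN conjunct1] E0(1)[rule_format, THEN conjunct2] E0(2)
  have "norm (poly_eval0 Q (E n)) \<le> M" for n
  proof -
    have "E n \<in> corner (p n)" using nn_sa[OF E(1)] by (simp add: sa_def)
    then have "poly_eval0 Q (E n) = ev (p n) (pCons 0 Q) (E n)" by (rule poly_eval0_corner)
    moreover have "norm (ev (p n) (pCons 0 Q) (E n)) \<le> M"
      using E(2)[of n] by (intro norm_ev_nn_le[OF E(1)]) (simp add: M)
    ultimately show ?thesis by simp
  qed
  then show ?thesis by (rule norm_limit_le[OF tendsto_poly_eval0[OF E(3)]])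
qed

lemma norm_mono:
  assumes a: "(a::'a) \<in> positives" and b: "b \<in> positives" shows "norm a \<le> norm (a + b)"
proof -
  obtain E where E0: "\<forall>n. nn (p n) (E n) \<and> norm (E n) \<le> norm a" "E \<longlonglongrightarrow> a"
    using positive_approx[OF a] by blast
  note E = E0(1)[rule_format, THEN conjunct1] E0(1)[rule_format, THEN conjunct2] E0(2)
  obtain F where F0: "\<forall>n. nn (p n) (F n) \<and> norm (F n) \<le> norm b" "F \<longlonglongrightarrow> b"
    using positive_approx[OF b] by blast
  note F = F0(1)[rule_format, THEN conjunct1] F0(1)[rule_format, THEN conjunct2] F0(2)
  show ?thesis
    by (rule LIMSEQ_le[OF tendsto_norm[OF E(3)] tendsto_norm[OF tendsto_add[OF E(3) F(3)]]])
      (intro exI allI impI nn_norm_mono[OF E(1) F(1)])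
qed

text \<open>The projection \<open>q\<close> is unrelated to the \<open>p n\<close>. The estimate of
  \<open>E n - norm e *\<^sub>R p n\<close> in the corner of \<open>p n\<close> is compressed by
  \<open>q\<close>, and the limit is the required estimate of
  \<open>e - norm e *\<^sub>R q\<close>.\<close>

lemma nn_of_positive:
  assumes q: "projection q" and e: "(e::'a) \<in> positives" "e \<in> corner q"
  shows "nn q e"
proof -
  obtain E where E0: "\<forall>n. nn (p n) (E n) \<and> norm (E n) \<le> norm e" "E \<longlonglongrightarrow> e"
    using positive_approx[OF e(1)] by blast
  note E = E0(1)[rule_format, THEN conjunct1] E0(1)[rule_format, THEN conjunct2] E0(2)
  have le: "norm (q * (E n - norm e *\<^sub>R p n) * q) \<le> norm e" for n
  proof -
    have "norm (q * (E n - norm e *\<^sub>R p n) * q) \<le> norm q * norm (E n - norm e *\<^sub>R p n) * norm q"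
      using norm_mult_ineq[of "q * (E n - norm e *\<^sub>R p n)" q] norm_mult_ineq[of q "E n - norm e *\<^sub>R p n"]
      by (meson mult_right_mono norm_ge_zero order_trans)
    also have "\<dots> \<le> 1 * norm e * 1"
      by (intro mult_mono norm_projection_le q norm_diff_unit_le E) auto
    finally show ?thesis by simp
  qed
  have "(\<lambda>n. q * E n * q - norm e *\<^sub>R (q * p n * q)) \<longlonglongrightarrow> q * e * q - norm e *\<^sub>R (q * q)"
    by (intro tendsto_intros E right_unit)
  then have "(\<lambda>n. q * (E n - norm e *\<^sub>R p n) * q) \<longlonglongrightarrow> e - norm e *\<^sub>R q"
    using e(2) q by (simp add: algebra_simps cornerD projection_def)
  from this le have "norm (e - norm e *\<^sub>R q) \<le> norm e" by (rule norm_limit_le)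
  then show ?thesis using q e by (auto simp: nn_def sa_def positives_star intro!: exI[of _ "norm e"])
qed

text \<open>This justifies the definite description in \<open>fcalc\<close>. The interval may be
  larger than \<open>{0..norm e}\<close>, so one approximating sequence can serve several elements,
  or \<open>fcalc\<close> and \<open>fc\<close> together.\<close>

lemma fcalc_limit:
  assumes e: "(e::'a) \<in> positives" and f: "cont f" "f 0 = 0" and R: "a \<le> 0" "norm e \<le> R"
    and Q: "uniform_limit {a..R} (\<lambda>k s. s * poly (Q k) s) f sequentially"
  shows "(\<lambda>k. poly_eval0 (Q k) e) \<longlonglongrightarrow> fcalc f e"
proof -
  let ?I = "{0..norm e}"
  have \<Phi>: "norm (poly_eval0 A e - poly_eval0 B e) \<le> r"
    if "\<And>s. s \<in> ?I \<Longrightarrow> \<bar>s * poly A s - s * poly B s\<bar> \<le> r" for A B r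
    unfolding poly_eval0_ev ev_diff[symmetric] unfolding poly_eval0_ev[symmetric]
    by (rule norm_poly_eval0_le[OF e]) (use that in \<open>simp add: right_diff_distrib\<close>)
  have Q': "uniform_limit ?I (\<lambda>k s. s * poly (Q k) s) f sequentially"
    by (rule uniform_limit_on_subset[OF Q]) (use R in auto)
  obtain b where b: "(\<lambda>k. poly_eval0 (Q k) e) \<longlonglongrightarrow> b"
    using uniform_eval_limit(1)[of ?I "\<lambda>A s. s * poly A s" "\<lambda>A. poly_eval0 A e", OF \<Phi> Q' Q']
    by (auto simp: convergent_def)
  have all: "(\<lambda>k. poly_eval0 (P k) e) \<longlonglongrightarrow> b"
    if P: "uniform_limit ?I (\<lambda>k s. s * poly (P k) s) f sequentially" for P
    using tendsto_add[OF uniform_eval_limit(2)[of ?I "\<lambda>A s. s * poly A s" "\<lambda>A. poly_eval0 A e", OF \<Phi> P Q'] b] by simp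
  have "fcalc f e = b" unfolding fcalc_def
  proof (rule the_equality)
    fix b' assume "\<forall>Q. uniform_limit ?I (\<lambda>k s. s * poly (Q k) s) f sequentially \<longrightarrow> (\<lambda>k. poly_eval0 (Q k) e) \<longlonglongrightarrow> b'"
    then show "b' = b" using Q' b LIMSEQ_unique by blast
  qed (use all in blast)
  then show ?thesis using b by simp
qed

text \<open>Rules for \<open>fcalc\<close> are obtained from those for \<open>fc\<close> along this
  limit. One fixed polynomial approximates \<open>f\<close> for all \<open>E n\<close> at once,
  because their norms stay below \<open>norm e\<close>.\<close>

lemma fcalc_tendsto:
  assumes e: "(e::'a) \<in> positives" and f: "cont f" "f 0 = 0"
    and E: "\<forall>n. nn (p n) (E n) \<and> norm (E n) \<le> norm e" "E \<longlonglongrightarrow> e"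
  shows "(\<lambda>n. fc (p n) (E n) f) \<longlonglongrightarrow> fcalc f e"
proof (rule LIMSEQ_I)
  fix r :: real assume "0 < r"
  then have r: "0 < r / 3" by simp
  obtain Q where Q: "uniform_limit {0..norm e} (\<lambda>k s. s * poly (Q k) s) f sequentially"
    using polynomial_approximation_0[OF f, of 0 "norm e"] by auto
  obtain k where k: "\<forall>s\<in>{0..norm e}. \<bar>s * poly (Q k) s - f s\<bar> < r / 3" "norm (poly_eval0 (Q k) e - fcalc f e) < r / 3"
    using eventually_conj[OF uniform_limitD[OF Q r] tendstoD[OF fcalc_limit[OF e f order_refl order_refl Q] r]]
    by (auto simp: eventually_sequentially dist_norm)
  obtain N where N: "\<forall>n\<ge>N. norm (poly_eval0 (Q k) (E n) - poly_eval0 (Q k) e) < r / 3"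
    using LIMSEQ_D[OF tendsto_poly_eval0[OF E(2)] r] by blast
  have "norm (fc (p n) (E n) f - fcalc f e) < r" if n: "n \<ge> N" for n
  proof -
    note nE = E(1)[rule_format, of n, THEN conjunct1]
    let ?q = "poly (pCons 0 (Q k))"
    have c: "cont ?q" by (intro continuous_intros)
    have "poly_eval0 (Q k) (E n) = fc (p n) (E n) ?q"
      unfolding fc_poly[OF nn_sa[OF nE]] by (rule poly_eval0_corner[OF sa_corner[OF nn_sa[OF nE]]])
    moreover have "norm (fc (p n) (E n) (\<lambda>s. f s - ?q s)) \<le> r / 3"
    proof (rule fc_norm_le_nn[OF nE])
      fix s assume "0 \<le> s" "s \<le> norm (E n)"
      then have "s \<in> {0..norm e}" using E(1)[rule_format, of n] by auto
      then show "\<bar>f s - ?q s\<bar> \<le> r / 3" using k(1) by (auto simp: abs_minus_commute less_imp_le)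
    qed (intro continuous_intros f c)
    ultimately have "norm (fc (p n) (E n) f - poly_eval0 (Q k) (E n)) \<le> r / 3"
      using fc_diff[OF nn_sa[OF nE] f(1) c] by simp
    then show ?thesis
      using N n k(2) norm_triangle_ineq[of "fc (p n) (E n) f - poly_eval0 (Q k) (E n)" "poly_eval0 (Q k) (E n) - fcalc f e"]
        norm_triangle_ineq[of "poly_eval0 (Q k) (E n) - poly_eval0 (Q k) e" "poly_eval0 (Q k) e - fcalc f e"]
      by fastforce
  qed
  then show "\<exists>N. \<forall>n\<ge>N. norm (fc (p n) (E n) f - fcalc f e) < r" by blast
qed

lemma fcalc_eq_fc:
  assumes h: "sa q h" and pos: "(h::'a) \<in> positives" and f: "cont f" "f 0 = 0"
  shows "fcalc f h = fc q h f"
proof -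
  obtain Q where Q: "uniform_limit {-norm h..norm h} (\<lambda>k s. s * poly (Q k) s) f sequentially"
    using polynomial_approximation_0[OF f, of "-norm h" "norm h"] by auto
  have "(\<lambda>k. poly_eval0 (Q k) h) \<longlonglongrightarrow> fcalc f h"
    by (rule fcalc_limit[OF pos f _ order_refl Q]) simp
  moreover have "(\<lambda>k. poly_eval0 (Q k) h) \<longlonglongrightarrow> fc q h f"
    using fc_limit[OF h f(1) order_refl, of "\<lambda>k. pCons 0 (Q k)"] Q poly_eval0_corner[OF sa_corner[OF h]]
    by (simp add: poly_pCons[abs_def])
  ultimately show ?thesis by (rule LIMSEQ_unique)
qed

lemma fcalc_orthogonal:
  assumes a: "(a::'a) \<in> positives" and b: "b \<in> positives" and ab: "a + b \<in> positives" "a * b = 0" "b * a = 0"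
    and f: "cont f" "f 0 = 0"
  shows "fcalc f (a + b) = fcalc f a + fcalc f b"
proof -
  define R where "R = max (norm a) (max (norm b) (norm (a + b)))"
  obtain Q where Q: "uniform_limit {0..R} (\<lambda>k s. s * poly (Q k) s) f sequentially"
    using polynomial_approximation_0[OF f, of 0 R] by (auto simp: R_def le_max_iff_disj)
  have "(\<lambda>k. poly_eval0 (Q k) (a + b)) \<longlonglongrightarrow> fcalc f (a + b)" "(\<lambda>k. poly_eval0 (Q k) a) \<longlonglongrightarrow> fcalc f a"
    "(\<lambda>k. poly_eval0 (Q k) b) \<longlonglongrightarrow> fcalc f b"
    by (rule fcalc_limit[OF _ f order_refl _ Q]; use a b ab in \<open>simp add: R_def\<close>)+
  from LIMSEQ_unique[OF this(1)[unfolded poly_eval0_orthogonal[OF ab(2,3)]] tendsto_add[OF this(2,3)]]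
  show ?thesis .
qed

context
  fixes e :: 'a and f :: "real \<Rightarrow> real"
  assumes e: "e \<in> positives" and f: "cont f" "f 0 = 0"
begin

lemma fcalc_mult:
  assumes g: "cont g" "g 0 = 0" shows "fcalc (\<lambda>s. f s * g s) e = fcalc f e * fcalc g e"
proof -
  obtain E where E: "\<forall>n. nn (p n) (E n) \<and> norm (E n) \<le> norm e" "E \<longlonglongrightarrow> e" using positive_approx[OF e] by blast
  have "fc (p n) (E n) (\<lambda>s. f s * g s) = fc (p n) (E n) f * fc (p n) (E n) g" for n
    by (rule fc_mult[OF nn_sa f(1) g(1)]) (use E in blast)
  moreover have "(\<lambda>n. fc (p n) (E n) (\<lambda>s. f s * g s)) \<longlonglongrightarrow> fcalc (\<lambda>s. f s * g s) e"
    by (rule fcalc_tendsto[OF e _ _ E]) (use f g in \<open>auto intro!: continuous_intros\<close>)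
  ultimately show ?thesis
    using LIMSEQ_unique tendsto_mult[OF fcalc_tendsto[OF e f E] fcalc_tendsto[OF e g E]] by simp
qed

lemma fcalc_add:
  assumes g: "cont g" "g 0 = 0" shows "fcalc (\<lambda>s. f s + g s) e = fcalc f e + fcalc g e"
proof -
  obtain E where E: "\<forall>n. nn (p n) (E n) \<and> norm (E n) \<le> norm e" "E \<longlonglongrightarrow> e" using positive_approx[OF e] by blast
  have "fc (p n) (E n) (\<lambda>s. f s + g s) = fc (p n) (E n) f + fc (p n) (E n) g" for n
    by (rule fc_add[OF nn_sa f(1) g(1)]) (use E in blast)
  moreover have "(\<lambda>n. fc (p n) (E n) (\<lambda>s. f s + g s)) \<longlonglongrightarrow> fcalc (\<lambda>s. f s + g s) e"
    by (rule fcalc_tendsto[OF e _ _ E]) (use f g in \<open>auto intro!: continuous_intros\<close>)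
  ultimately show ?thesis
    using LIMSEQ_unique tendsto_add[OF fcalc_tendsto[OF e f E] fcalc_tendsto[OF e g E]] by simp
qed

lemma fcalc_scaleR: "fcalc (\<lambda>s. c * f s) e = c *\<^sub>R fcalc f e"
proof -
  obtain E where E: "\<forall>n. nn (p n) (E n) \<and> norm (E n) \<le> norm e" "E \<longlonglongrightarrow> e" using positive_approx[OF e] by blast
  have "fc (p n) (E n) (\<lambda>s. c * f s) = c *\<^sub>R fc (p n) (E n) f" for n
    by (rule fc_scaleR[OF nn_sa f(1)]) (use E in blast)
  moreover have "(\<lambda>n. fc (p n) (E n) (\<lambda>s. c * f s)) \<longlonglongrightarrow> fcalc (\<lambda>s. c * f s) e"
    by (rule fcalc_tendsto[OF e _ _ E]) (use f in \<open>auto intro!: continuous_intros\<close>)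
  ultimately show ?thesis
    using LIMSEQ_unique tendsto_scaleR[OF tendsto_const[of c] fcalc_tendsto[OF e f E]] by simp
qed

lemma fcalc_star: "(fcalc f e)\<^sup>\<star> = fcalc f e"
proof -
  obtain E where E: "\<forall>n. nn (p n) (E n) \<and> norm (E n) \<le> norm e" "E \<longlonglongrightarrow> e" using positive_approx[OF e] by blast
  have "(fc (p n) (E n) f)\<^sup>\<star> = fc (p n) (E n) f" for n by (rule fc_star[OF nn_sa f(1)]) (use E in blast)
  then show ?thesis
    using LIMSEQ_unique tendsto_star[OF fcalc_tendsto[OF e f E]] fcalc_tendsto[OF e f E] by simp
qed

lemma fcalc_norm_le:
  assumes M: "\<And>s. 0 \<le> s \<Longrightarrow> s \<le> norm e \<Longrightarrow> \<bar>f s\<bar> \<le> M" shows "norm (fcalc f e) \<le> M"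
proof -
  obtain E where E: "\<forall>n. nn (p n) (E n) \<and> norm (E n) \<le> norm e" "E \<longlonglongrightarrow> e" using positive_approx[OF e] by blast
  show ?thesis
  proof (rule norm_limit_le[OF fcalc_tendsto[OF e f E] fc_norm_le_nn[OF _ f(1)]])
    show "\<bar>f s\<bar> \<le> M" if "0 \<le> s" "s \<le> norm (E n)" for n s
      using M[of s] that E(1)[rule_format, of n] by linarith
  qed (use E in blast)
qed

end

lemma fcalc_positive:
  assumes e: "(e::'a) \<in> positives" and f: "cont f" "f 0 = 0" "\<And>s. 0 \<le> s \<Longrightarrow> s \<le> norm e \<Longrightarrow> 0 \<le> f s"
  shows "fcalc f e \<in> positives"
proof -
  have c: "cont (\<lambda>s. sqrt \<bar>f s\<bar>)" "sqrt \<bar>f 0\<bar> = 0" "cont (\<lambda>s. \<bar>f s\<bar>)" "\<bar>f 0\<bar> = 0"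
    "cont (\<lambda>s. -1 * \<bar>f s\<bar>)" "-1 * \<bar>f 0\<bar> = 0"
    using f by (auto intro!: continuous_intros)
  have "norm (fcalc (\<lambda>s. f s + -1 * \<bar>f s\<bar>) e) \<le> 0"
    by (rule fcalc_norm_le[OF e]) (use f(2,3) c in \<open>auto intro!: continuous_intros f(1)\<close>)
  then have "fcalc f e = fcalc (\<lambda>s. \<bar>f s\<bar>) e"
    unfolding fcalc_add[OF e f(1,2) c(5,6)] fcalc_scaleR[OF e c(3,4)] by simp
  also have "(\<lambda>s. \<bar>f s\<bar>) = (\<lambda>s. sqrt \<bar>f s\<bar> * sqrt \<bar>f s\<bar>)" by simp
  also have "fcalc \<dots> e = (fcalc (\<lambda>s. sqrt \<bar>f s\<bar>) e)\<^sup>\<star> * fcalc (\<lambda>s. sqrt \<bar>f s\<bar>) e"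
    unfolding fcalc_mult[OF e c(1,2,1,2)] fcalc_star[OF e c(1,2)] ..
  finally show ?thesis using positivesI by simp
qed

text \<open>Compress \<open>q' - q = x\<^sup>\<star> * x\<close> by the formal complement of
  \<open>q'\<close>: the result is positive, being \<open>y\<^sup>\<star> * y\<close>, and equals
  \<open>- (w\<^sup>\<star> * w)\<close>. Norm monotonicity then forces
  \<open>w = 0\<close>.\<close>

lemma projection_le:
  assumes q: "projection q" "projection q'" and pos: "q' - q \<in> (positives :: 'a set)"
  shows "q' * q = q" "q * q' = q"
proof -
  obtain x where x: "q' - q = x\<^sup>\<star> * x" using pos by (rule positivesE)
  have qq: "q * q = q" "q' * q' = q'" "q\<^sup>\<star> = q" "q'\<^sup>\<star> = q'" using q by (auto simp: projection_def)
  define y where "y = x - x * q'"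
  define w where "w = q - q * q'"
  have "y\<^sup>\<star> * y = (q' - q) - (q' - q) * q' - q' * (q' - q) + q' * (q' - q) * q'"
    by (simp add: y_def x star_diff star_mult qq algebra_simps)
  also have "\<dots> = - (w\<^sup>\<star> * w)"
    using qq(1,2) mult.assoc[of q q q'] mult.assoc[of q' q' q'] mult.assoc[of q' q' q]
    by (simp add: w_def star_diff star_mult qq algebra_simps)
  finally have yw: "w\<^sup>\<star> * w + y\<^sup>\<star> * y = 0" by (simp only: right_minus)
  have "norm (w\<^sup>\<star> * w) \<le> norm (w\<^sup>\<star> * w + y\<^sup>\<star> * y)" by (rule norm_mono[OF positivesI positivesI])
  then have "w\<^sup>\<star> * w = 0" unfolding yw by simp
  then have "w = 0" by (rule star_mult_self_eq_0)
  then show 1: "q * q' = q" by (simp add: w_def)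
  from arg_cong[OF 1, of star] show "q' * q = q" by (simp add: star_mult qq)
qed

end

section \<open>Quasitraces\<close>

lemma quasitrace_limit_le:
  assumes lsc: "lsc_on S t" and X: "\<And>n. X n \<in> S" "x \<in> S" "X \<longlonglongrightarrow> x" and B: "\<And>n. t (X n) \<le> B"
  shows "t x \<le> (B::ennreal)"
proof (rule ccontr)
  assume "\<not> t x \<le> B"
  then have less: "B < t x" by simp
  with lsc X(2) have "\<forall>\<^sub>F y in at x within S. B < t y" by (auto simp: lsc_on_def)
  then have "\<forall>\<^sub>F y in nhds x. y \<noteq> x \<longrightarrow> y \<in> S \<longrightarrow> B < t y" by (simp add: eventually_at_filter)
  then have "\<forall>\<^sub>F n in sequentially. X n \<noteq> x \<longrightarrow> X n \<in> S \<longrightarrow> B < t (X n)"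
    using X(3) by (rule eventually_compose_filterlim)
  then obtain n where "X n \<noteq> x \<longrightarrow> X n \<in> S \<longrightarrow> B < t (X n)"
    by (auto simp: eventually_sequentially)
  \<comment> \<open>The filter \<open>at x within S\<close> says nothing about \<open>x\<close>
    itself, so terms equal to \<open>x\<close> are treated separately.\<close>
  then have "B < t (X n)" using X(1)[of n] less by (cases "X n = x") auto
  then show False using B[of n] by simp
qed

definition mat2 :: "'a \<Rightarrow> 'a \<Rightarrow> 'a \<Rightarrow> 'a \<Rightarrow> 'a::cstar_algebra^2^2" where
  "mat2 a b c d = (\<chi> i j. if i = 1 then if j = 1 then a else b else if j = 1 then c else d)"

lemma mat2_simps:
  "m2_mult (mat2 a b c d) (mat2 a' b' c' d') = mat2 (a * a' + b * c') (a * b' + b * d') (c * a' + d * c') (c * b' + d * d')"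
  "m2_star (mat2 a b c d) = mat2 (a\<^sup>\<star>) (c\<^sup>\<star>) (b\<^sup>\<star>) (d\<^sup>\<star>)"
  "mat2 a b c d + mat2 a' b' c' d' = mat2 (a + a') (b + b') (c + c') (d + d')"
  "m2_corner a = mat2 a 0 0 0"
  by (simp_all add: m2_mult_def m2_star_def m2_corner_def mat2_def vec_eq_iff forall_2 sum_2)

lemma fc_zero: "projection q \<Longrightarrow> cont f \<Longrightarrow> f 0 = 0 \<Longrightarrow> fc q 0 f = 0"
  using fc_norm_le[of q 0 f 0 0] by (simp add: sa_def)

definition sum_star_mult :: "(nat \<Rightarrow> 'a::cstar_algebra) \<Rightarrow> nat \<Rightarrow> 'a" where
  "sum_star_mult z m = (\<Sum>i<m. (z i)\<^sup>\<star> * z i)"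

context projection_unit
begin

lemma nn_star_mult_corner:
  assumes q: "projection q" and z: "(z::'a) * q = z" shows "nn q (z\<^sup>\<star> * z)"
proof (rule nn_of_positive[OF q positivesI])
  have "q * z\<^sup>\<star> = z\<^sup>\<star>" using q arg_cong[OF z, of star] by (simp add: star_mult projection_def)
  then show "z\<^sup>\<star> * z \<in> corner q" using z by (simp add: corner_def mult.assoc) (simp add: mult.assoc[symmetric])
qed

lemma nn_sum_star_mult:
  assumes q: "projection q" and z: "\<And>i. i < m \<Longrightarrow> (z i::'a) * q = z i"
  shows "nn q (sum_star_mult z m)"
  using z unfolding sum_star_mult_def
  by (induction m) (auto intro!: nn_add nn_star_mult_corner nn_zero q)

lemma fcalc_root_positive: "(b::'a) \<in> positives \<Longrightarrow> fcalc (root (Suc n)) b \<in> positives"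
  by (rule fcalc_positive) (auto intro!: continuous_intros)

lemma fcalc_scale_root:
  "(b::'a) \<in> positives \<Longrightarrow> fcalc (\<lambda>s. c * root (Suc n) s) b = c *\<^sub>R fcalc (root (Suc n)) b"
  by (rule fcalc_scaleR) (auto intro!: continuous_intros)

context
  fixes \<tau> :: "'a \<Rightarrow> ennreal"
  assumes qt: "lsc_2quasitrace \<tau>"
begin

lemma qt_zero: "\<tau> 0 = 0"
  and qt_scale: "t > 0 \<Longrightarrow> a \<in> positives \<Longrightarrow> \<tau> (t *\<^sub>R a) = ennreal t * \<tau> a"
  and qt_add: "a \<in> positives \<Longrightarrow> b \<in> positives \<Longrightarrow> a * b = b * a \<Longrightarrow> \<tau> (a + b) = \<tau> a + \<tau> b"
  and qt_lsc: "lsc_on positives \<tau>"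
  using qt unfolding lsc_2quasitrace_def lsc_quasitrace_def positives_def by blast+

lemma qt_limit_le:
  "(\<And>n. X n \<in> positives) \<Longrightarrow> x \<in> positives \<Longrightarrow> X \<longlonglongrightarrow> x \<Longrightarrow> (\<And>n. \<tau> (X n) \<le> B) \<Longrightarrow> \<tau> x \<le> B"
  by (rule quasitrace_limit_le[OF qt_lsc])

lemma qt_fc_split:
  assumes h: "sa q h" and f: "cont f" "\<And>s. 0 \<le> f s" "\<And>s. f s \<le> 1"
  shows "\<tau> q = \<tau> (fc q h f) + \<tau> (fc q h (\<lambda>s. 1 - f s))"
proof -
  have c: "cont (\<lambda>s. 1 - f s)" by (intro continuous_intros f)
  have "fc q h f * fc q h (\<lambda>s. 1 - f s) = fc q h (\<lambda>s. 1 - f s) * fc q h f"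
    unfolding fc_mult[OF h f(1) c, symmetric] fc_mult[OF h c f(1), symmetric] by (simp add: mult.commute)
  then have "\<tau> (fc q h f + fc q h (\<lambda>s. 1 - f s)) = \<tau> (fc q h f) + \<tau> (fc q h (\<lambda>s. 1 - f s))"
    by (intro qt_add fc_positive h f c) (simp add: f)
  also have "fc q h f + fc q h (\<lambda>s. 1 - f s) = q"
    unfolding fc_add[OF h f(1) c, symmetric] by (simp add: fc_const[OF h])
  finally show ?thesis .
qed

lemma qt_le_corner:
  assumes h: "nn q h" and N: "norm h \<le> N" "0 < N"
  shows "\<tau> h \<le> ennreal N * \<tau> q"
proof -
  note hs = nn_sa[OF h]
  have c: "cont (\<lambda>s. max 0 (min 1 (s / N)))" "cont (\<lambda>s. s / N)" "cont (\<lambda>s. s)" by (intro continuous_intros; use N in simp)+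
  have "fc q h (\<lambda>s. max 0 (min 1 (s / N))) = fc q h (\<lambda>s. s / N)"
    by (rule fc_cong_nn[OF h c(1,2)]) (use N in auto)
  also have "\<dots> = (1 / N) *\<^sub>R h"
    using fc_scaleR[OF hs c(3), of "1 / N"] by (simp add: fc_id[OF hs])
  finally have "\<tau> ((1 / N) *\<^sub>R h) \<le> \<tau> q"
    using qt_fc_split[OF hs c(1)] by simp
  then have "ennreal N * \<tau> ((1 / N) *\<^sub>R h) \<le> ennreal N * \<tau> q" by (rule mult_left_mono) simp
  moreover have "ennreal N * \<tau> ((1 / N) *\<^sub>R h) = \<tau> (N *\<^sub>R ((1 / N) *\<^sub>R h))"
    by (rule qt_scale[symmetric]) (use N h in \<open>auto intro!: nn_positive nn_scaleR\<close>)
  ultimately show ?thesis using N by simp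
qed

lemma qt_le_norm:
  assumes b: "b \<in> positives" shows "\<tau> b \<le> ennreal (norm b) * (SUP n. \<tau> (p n))"
proof (cases "b = 0")
  case False
  then have N: "0 < norm b" by simp
  obtain E where E: "\<forall>n. nn (p n) (E n) \<and> norm (E n) \<le> norm b" "E \<longlonglongrightarrow> b"
    using positive_approx[OF b] by blast
  show ?thesis
  proof (rule qt_limit_le[OF _ b E(2)])
    fix n
    show "E n \<in> positives" using E nn_positive by blast
    have "\<tau> (E n) \<le> ennreal (norm b) * \<tau> (p n)" using E(1) N by (intro qt_le_corner) auto
    also have "\<dots> \<le> ennreal (norm b) * (SUP n. \<tau> (p n))"
      by (intro mult_left_mono SUP_upper) auto
    finally show "\<tau> (E n) \<le> ennreal (norm b) * (SUP n. \<tau> (p n))" .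
  qed
qed (simp add: qt_zero)

text \<open>Additivity on commuting elements suffices, because \<open>f\<close> and
  \<open>g - f\<close> are applied to the same \<open>b\<close>.\<close>

lemma qt_fcalc_mono:
  assumes b: "b \<in> positives" and f: "cont f" "f 0 = 0" and g: "cont g" "g 0 = 0"
    and le: "\<And>s. 0 \<le> s \<Longrightarrow> s \<le> norm b \<Longrightarrow> 0 \<le> f s \<and> f s \<le> g s"
  shows "\<tau> (fcalc f b) \<le> \<tau> (fcalc g b)"
proof -
  have d: "cont (\<lambda>s. g s - f s)" "g 0 - f 0 = 0" using f g by (auto intro!: continuous_intros)
  have "fcalc f b * fcalc (\<lambda>s. g s - f s) b = fcalc (\<lambda>s. g s - f s) b * fcalc f b"
    unfolding fcalc_mult[OF b f d, symmetric] fcalc_mult[OF b d f, symmetric] by (simp add: mult.commute)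
  then have "\<tau> (fcalc f b + fcalc (\<lambda>s. g s - f s) b) = \<tau> (fcalc f b) + \<tau> (fcalc (\<lambda>s. g s - f s) b)"
    by (intro qt_add fcalc_positive[OF b f] fcalc_positive[OF b d]) (use le in auto)
  moreover have "fcalc f b + fcalc (\<lambda>s. g s - f s) b = fcalc g b"
    unfolding fcalc_add[OF b f d, symmetric] by simp
  ultimately show ?thesis by simp
qed

text \<open>Roots increase with their index only for numbers in \<open>[0, 1]\<close>, hence the
  division by \<open>N\<close>.\<close>

lemma qt_root_incseq:
  assumes b: "b \<in> positives" and N: "norm b \<le> N" "0 < N"
  shows "incseq (\<lambda>n. \<tau> ((1 / root (Suc n) N) *\<^sub>R fcalc (root (Suc n)) b))"
proof (rule incseq_SucI)
  fix n
  have c: "cont (\<lambda>s. root k s)" for k by (intro continuous_intros)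
  have c': "cont (\<lambda>s. 1 / root k N * root k s)" for k by (intro continuous_intros)
  have "\<tau> (fcalc (\<lambda>s. 1 / root (Suc n) N * root (Suc n) s) b)
    \<le> \<tau> (fcalc (\<lambda>s. 1 / root (Suc (Suc n)) N * root (Suc (Suc n)) s) b)"
  proof (rule qt_fcalc_mono[OF b c' _ c'])
    fix s assume s: "0 \<le> s" "s \<le> norm b"
    have "root (Suc n) (s / N) \<le> root (Suc (Suc n)) (s / N)"
    proof (cases "s = 0")
      case False
      then show ?thesis using s N by (intro real_root_increasing) auto
    qed simp
    then show "0 \<le> 1 / root (Suc n) N * root (Suc n) s \<and>
      1 / root (Suc n) N * root (Suc n) s \<le> 1 / root (Suc (Suc n)) N * root (Suc (Suc n)) s"
      using s N by (simp add: real_root_divide)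
  qed auto
  then show "\<tau> ((1 / root (Suc n) N) *\<^sub>R fcalc (root (Suc n)) b)
    \<le> \<tau> ((1 / root (Suc (Suc n)) N) *\<^sub>R fcalc (root (Suc (Suc n))) b)"
    unfolding fcalc_scale_root[OF b] .
qed

lemma le_dim_fun:
  assumes b: "b \<in> positives" "norm b \<le> 1" and B: "\<And>n. B \<le> \<tau> (fcalc (root (Suc n)) b)"
  shows "B \<le> dim_fun \<tau> b"
proof -
  have "incseq (\<lambda>n. \<tau> (fcalc (root (Suc n)) b))" using qt_root_incseq[OF b] by simp
  then have "dim_fun \<tau> b = (SUP n. \<tau> (fcalc (root (Suc n)) b))"
    unfolding dim_fun_def by (intro limI LIMSEQ_SUP)
  also have "\<dots> \<ge> B" using B[of 0] by (intro SUP_upper2[of 0]) auto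
  finally show ?thesis .
qed

text \<open>Since \<open>dim_fun\<close> is a \<open>lim\<close>, convergence has to be proved
  first. The roots of \<open>b\<close> divided by \<open>t n\<close> are contractions with
  increasing quasitraces, and the correction \<open>t n = root (Suc n) N\<close> tends to 1.\<close>

lemma dim_fun_le_SUP:
  assumes b: "b \<in> positives" shows "dim_fun \<tau> b \<le> (SUP n. \<tau> (p n))"
proof -
  define N where "N = max 1 (norm b)"
  have N: "norm b \<le> N" "0 < N" "1 \<le> N" by (auto simp: N_def)
  define r where "r n = fcalc (root (Suc n)) b" for n
  define t where "t n = root (Suc n) N" for n
  have t: "0 < t n" for n using N by (simp add: t_def)
  let ?X = "\<lambda>n. \<tau> ((1 / t n) *\<^sub>R r n)"
  have X: "?X \<longlonglongrightarrow> (SUP n. ?X n)"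
    using qt_root_incseq[OF b N(1,2)] unfolding r_def t_def by (rule LIMSEQ_SUP)
  have rp: "r n \<in> positives" for n unfolding r_def by (rule fcalc_root_positive[OF b])
  have "?X n \<le> (SUP n. \<tau> (p n))" for n
  proof -
    have "norm (r n) \<le> t n"
      unfolding r_def t_def using N
      by (intro fcalc_norm_le[OF b]) (auto intro!: continuous_intros)
    then have n1: "norm ((1 / t n) *\<^sub>R r n) \<le> 1" using t[of n] by simp
    have "(1 / t n) *\<^sub>R r n = fcalc (\<lambda>s. 1 / t n * root (Suc n) s) b"
      unfolding r_def by (rule fcalc_scale_root[OF b, symmetric])
    also have "\<dots> \<in> positives"
      using t[of n] by (intro fcalc_positive[OF b]) (auto intro!: continuous_intros)
    finally have "?X n \<le> ennreal (norm ((1 / t n) *\<^sub>R r n)) * (SUP n. \<tau> (p n))" by (rule qt_le_norm)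
    also have "\<dots> \<le> 1 * (SUP n. \<tau> (p n))" using n1 by (intro mult_right_mono) (auto simp: ennreal_le_1)
    finally show ?thesis by simp
  qed
  then have S: "(SUP n. ?X n) \<le> (SUP n. \<tau> (p n))" by (rule SUP_least)
  have tl: "t \<longlonglongrightarrow> 1"
    unfolding t_def using LIMSEQ_root_const[OF N(2)] by (rule LIMSEQ_Suc)
  have "(\<lambda>n. ennreal (t n) * ?X n) \<longlonglongrightarrow> ennreal 1 * (SUP n. ?X n)"
    by (intro tendsto_mult_ennreal tendsto_ennrealI tl X) auto
  moreover have "ennreal (t n) * ?X n = \<tau> (r n)" for n
  proof -
    have "(1 / t n) *\<^sub>R r n \<in> positives"
      unfolding r_def fcalc_scale_root[OF b, symmetric]
      using t[of n] by (intro fcalc_positive[OF b]) (auto intro!: continuous_intros)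
    from qt_scale[OF t[of n] this] t[of n] show ?thesis by simp
  qed
  ultimately have "(\<lambda>n. \<tau> (r n)) \<longlonglongrightarrow> (SUP n. ?X n)" by simp
  then have "dim_fun \<tau> b = (SUP n. ?X n)" unfolding dim_fun_def r_def[symmetric] by (rule limI)
  then show ?thesis using S by simp
qed

lemma dim_fun_projection:
  assumes q: "projection q" shows "dim_fun \<tau> q = \<tau> q"
proof -
  have "fcalc (root (Suc n)) q = q" for n
  proof -
    have c: "cont (root (Suc n))" "cont (\<lambda>_::real. 1::real)" by (intro continuous_intros)+
    have "fcalc (root (Suc n)) q = fc q q (root (Suc n))"
      by (rule fcalc_eq_fc[OF sa_self[OF q] projection_positive[OF q] c(1)]) simp
    also have "\<dots> = fc q (fc q q (\<lambda>_. 1)) (root (Suc n))" by (simp add: fc_const[OF sa_self[OF q]])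
    also have "\<dots> = q" unfolding fc_comp[OF sa_self[OF q] c] by (simp add: fc_const[OF sa_self[OF q]])
    finally show ?thesis .
  qed
  then show ?thesis by (simp add: dim_fun_def limI)
qed

section \<open>Subadditivity via two by two matrices\<close>

text \<open>For the row \<open>Z = (r, z\<^sup>\<star>)\<close>, \<open>f(ZZ\<^sup>\<star>) = XX\<^sup>\<star>\<close> with \<open>X = \<surd>k(ZZ\<^sup>\<star>) Z\<close>, \<open>f = s k(s)\<close>. The diagonal
  matrix \<open>U = (g, P)\<close> is a unit for \<open>Z\<close>, and \<open>U\<^sup>2 - X\<^sup>\<star>X = (U - Z\<^sup>\<star>k'(ZZ\<^sup>\<star>)Z)\<^sup>2\<close> for
  \<open>k' = (1 - \<surd>(1 - f)) / s\<close>, so \<open>X\<^sup>\<star>X\<close> has quasitrace at most that of \<open>U\<^sup>2\<close>.\<close>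

lemma qt_fc_row_le:
  assumes h: "nn Q h" and P: "projection P" and z: "P * z = z" "z * Q = z"
    and f: "cont f" "\<And>s. 0 \<le> f s" "\<And>s. f s \<le> 1" "0 < \<epsilon>" "\<And>s. s \<le> \<epsilon> \<Longrightarrow> f s = 0"
    and d: "0 < \<delta>"
  defines "r \<equiv> fc Q h (\<lambda>s. sqrt (max (s - \<delta>) 0))"
  defines "g \<equiv> fc Q h (\<lambda>s. max 0 (min 1 (2 * s / \<delta> - 1)))"
  shows "\<tau> (fc Q (r * r + z\<^sup>\<star> * z) f) \<le> \<tau> (g * g) + \<tau> P"
proof -
  note hs = nn_sa[OF h]
  have Q: "projection Q" using hs by (simp add: sa_def)
  have cr: "cont (\<lambda>s. sqrt (max (s - \<delta>) 0))" and cg: "cont (\<lambda>s. max 0 (min 1 (2 * s / \<delta> - 1)))"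
    by (intro continuous_intros; use d in simp)+
  have r: "sa Q r" and g: "sa Q g" unfolding r_def g_def using hs cr cg by (auto intro: fc_sa)
  have rs: "r\<^sup>\<star> = r" "g\<^sup>\<star> = g" "P\<^sup>\<star> = P" "P * P = P" using r g P by (auto simp: sa_def projection_def)
  \<comment> \<open>\<open>g\<close> is cut off to be 1 from \<open>\<delta>\<close> on, where
    \<open>r\<close> lives, so \<open>g * r = r\<close>; below \<open>\<delta> / 2\<close> it
    vanishes, which makes its square a test function for \<open>support_le\<close>.\<close>
  have sqm: "max 0 (min 1 (2 * s / \<delta> - 1)) * sqrt (max (s - \<delta>) 0) = sqrt (max (s - \<delta>) 0)" for s
  proof (cases "s \<le> \<delta>")
    case False
    then have "1 \<le> 2 * s / \<delta> - 1" using d by (simp add: field_simps)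
    then show ?thesis by simp
  qed simp
  have gr: "g * r = r" "r * g = r"
    unfolding r_def g_def fc_mult[OF hs cg cr, symmetric] fc_mult[OF hs cr cg, symmetric] sqm
    using sqm by (simp_all only: mult.commute)
  have zs: "z\<^sup>\<star> * P = z\<^sup>\<star>" using arg_cong[OF z(1), of star] by (simp add: star_mult rs)
  define h' where "h' = r * r + z\<^sup>\<star> * z"
  have h': "sa Q h'"
    unfolding h'_def by (intro sa_add nn_sa nn_square[OF r] nn_star_mult_corner[OF Q z(2)])
  \<comment> \<open>\<open>max s \<epsilon>\<close> keeps the quotients continuous and changes
    nothing, as \<open>f\<close> vanishes up to \<open>\<epsilon>\<close>. The identity
    \<open>kk'\<close> below is \<open>1 - f s = (1 - s * k' s)\<^sup>2\<close> divided by
    \<open>s\<close>.\<close>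
  define k where "k s = f s / max s \<epsilon>" for s
  define k' where "k' s = (1 - sqrt (1 - f s)) / max s \<epsilon>" for s
  have mx: "max s \<epsilon> \<noteq> 0" "0 < max s \<epsilon>" for s using f(4) by (auto simp: max_def)
  have ck: "cont k" "cont k'" "cont (\<lambda>s. sqrt (k s))" "cont (\<lambda>s. s)"
    unfolding k_def k'_def by (intro continuous_intros f(1); use mx in simp)+
  have k0: "0 \<le> k s" for s using f(2) mx(2)[of s] by (simp add: k_def)
  have sk: "s * k s = f s" for s using f(4) f(5)[of s] by (cases "s \<le> \<epsilon>") (auto simp: k_def)
  have kk': "k s = 2 * k' s - k' s * (s * k' s)" for s
  proof (cases "s \<le> \<epsilon>")
    case True then show ?thesis using f(5) by (simp add: k_def k'_def)
  next
    case False
    then have s: "max s \<epsilon> = s" "s \<noteq> 0" using f(4) by auto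
    have "(sqrt (1 - f s))\<^sup>2 = 1 - f s" using f(3) by simp
    then have "f s = 2 * (1 - sqrt (1 - f s)) - (1 - sqrt (1 - f s)) * (1 - sqrt (1 - f s))"
      by (simp add: power2_eq_square algebra_simps)
    then show ?thesis unfolding k_def k'_def s(1) using s(2) by (simp add: field_simps)
  qed
  define R where "R = fc Q h' (\<lambda>s. sqrt (k s))"
  define K where "K = fc Q h' k"
  define K' where "K' = fc Q h' k'"
  have R: "R\<^sup>\<star> = R" and Ks: "K'\<^sup>\<star> = K'" unfolding R_def K'_def using ck by (auto intro!: fc_star h')
  have RR: "R * R = K" unfolding R_def K_def using fc_sqrt[OF h' ck(1) k0] by simp
  have fR: "R * h' * R = fc Q h' f"
  proof -
    have c: "cont (\<lambda>s. sqrt (k s) * s)" by (intro continuous_intros ck)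
    have "R * h' * R = fc Q h' (\<lambda>s. sqrt (k s) * s * sqrt (k s))"
      unfolding fc_mult[OF h' c ck(3)] fc_mult[OF h' ck(3,4)] fc_id[OF h'] R_def ..
    also have "(\<lambda>s. sqrt (k s) * s * sqrt (k s)) = f"
    proof
      fix s
      have "sqrt (k s) * s * sqrt (k s) = s * (sqrt (k s) * sqrt (k s))" by (simp only: mult_ac)
      then show "sqrt (k s) * s * sqrt (k s) = f s" using k0 sk by simp
    qed
    finally show ?thesis .
  qed
  have KK: "K = 2 *\<^sub>R K' - K' * h' * K'"
  proof -
    have c: "cont (\<lambda>s. s * k' s)" "cont (\<lambda>s. k' s * (s * k' s))" "cont (\<lambda>s. 2 * k' s)"
      by (intro continuous_intros ck)+
    have "fc Q h' (\<lambda>s. 2 * k' s - k' s * (s * k' s)) = 2 *\<^sub>R K' - K' * (h' * K')"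
      unfolding fc_diff[OF h' c(3,2)] fc_scaleR[OF h' ck(2)] fc_mult[OF h' ck(2) c(1)]
        fc_mult[OF h' ck(4,2)] fc_id[OF h'] K'_def ..
    moreover have "k = (\<lambda>s. 2 * k' s - k' s * (s * k' s))" by (rule ext) (rule kk')
    ultimately show ?thesis unfolding K_def mult.assoc by (simp only:)
  qed
  obtain \<tau>2 where t2: "lsc_quasitrace m2_mult m2_star \<tau>2" "\<forall>a\<in>positives. \<tau>2 (m2_corner a) = \<tau> a"
    using qt by (auto simp: lsc_2quasitrace_def)
  have add2: "\<tau>2 (a + b) = \<tau>2 a + \<tau>2 b"
    if "a \<in> pos_cone m2_mult m2_star" "b \<in> pos_cone m2_mult m2_star" "m2_mult a b = m2_mult b a" for a b
    using t2(1) that unfolding lsc_quasitrace_def by blast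
  have swap2: "\<tau>2 (m2_mult (m2_star x) x) = \<tau>2 (m2_mult x (m2_star x))" for x
    using t2(1) unfolding lsc_quasitrace_def by blast
  have pc: "m2_mult (m2_star x) x \<in> pos_cone m2_mult m2_star" for x :: "'a^2^2"
    unfolding pos_cone_def by blast
  define x where "x = mat2 (R * r) (R * z\<^sup>\<star>) 0 0"
  \<comment> \<open>\<open>x\<close> is the row \<open>X\<close>, padded by a zero row.
    \<open>W\<close> is the self-adjoint matrix \<open>U\<close> minus the \<open>K'\<close> term,
    and \<open>KK\<close> makes its square equal to \<open>U\<close> squared minus
    \<open>m2_mult (m2_star x) x\<close>.\<close>
  define W where "W = mat2 (g - r * K' * r) (- (r * K' * z\<^sup>\<star>)) (- (z * K' * r)) (P - z * K' * z\<^sup>\<star>)"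
  have xx: "m2_mult (m2_star x) x = mat2 (r * K * r) (r * K * z\<^sup>\<star>) (z * K * r) (z * K * z\<^sup>\<star>)"
    unfolding x_def mat2_simps RR[symmetric] by (simp add: star_mult star_star rs R mult.assoc)
  have xx': "m2_mult x (m2_star x) = m2_corner (fc Q h' f)"
    unfolding x_def mat2_simps fR[symmetric] by (simp add: star_mult star_star rs R h'_def algebra_simps)
  have gr': "g * (r * y) = r * y" "r * (g * y) = r * y" "P * (z * y) = z * y" "z\<^sup>\<star> * (P * y) = z\<^sup>\<star> * y"
    "P * (P * y) = P * y" for y
    unfolding mult.assoc[symmetric] gr z zs rs by simp_all
  have WW: "m2_mult (m2_star W) W =
    mat2 (g * g - r * K * r) (- (r * K * z\<^sup>\<star>)) (- (z * K * r)) (P - z * K * z\<^sup>\<star>)"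
    unfolding W_def mat2_simps KK h'_def
    by (simp add: star_mult star_star star_diff star_minus rs Ks gr gr' z zs algebra_simps scaleR_2)
  have comm: "m2_mult (m2_mult (m2_star x) x) (m2_mult (m2_star W) W)
    = m2_mult (m2_mult (m2_star W) W) (m2_mult (m2_star x) x)"
    unfolding xx WW mat2_simps by (simp add: gr gr' z zs algebra_simps)
  \<comment> \<open>\<open>\<tau>2\<close> is known only on the upper left corner; \<open>Y\<close>
    carries the lower right \<open>P\<close> there.\<close>
  define Y where "Y = mat2 0 P 0 0"
  have Y: "m2_mult (m2_star Y) Y = mat2 0 0 0 P" "m2_mult Y (m2_star Y) = m2_corner P"
    by (simp_all add: Y_def mat2_simps rs)
  define V where "V = mat2 g 0 0 0"
  have V: "m2_mult (m2_star V) V = m2_corner (g * g)" by (simp add: V_def mat2_simps rs)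
  have gp: "g * g \<in> positives" using positivesI[of g] by (simp add: rs)
  have fp: "fc Q h' f \<in> positives" by (rule fc_positive[OF h' f(1,2)])
  have "\<tau> (fc Q h' f) = \<tau>2 (m2_mult (m2_star x) x)" unfolding swap2 xx' using t2(2) fp by simp
  also have "\<dots> \<le> \<tau>2 (m2_mult (m2_star x) x) + \<tau>2 (m2_mult (m2_star W) W)" by simp
  also have "\<dots> = \<tau>2 (m2_mult (m2_star x) x + m2_mult (m2_star W) W)"
    by (rule add2[OF pc pc comm, symmetric])
  also have "m2_mult (m2_star x) x + m2_mult (m2_star W) W = m2_mult (m2_star V) V + m2_mult (m2_star Y) Y"
    unfolding xx WW V Y mat2_simps by simp
  also have "\<tau>2 \<dots> = \<tau>2 (m2_mult (m2_star V) V) + \<tau>2 (m2_mult (m2_star Y) Y)"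
    by (rule add2[OF pc pc]) (simp add: V Y mat2_simps)
  also have "\<dots> = \<tau> (g * g) + \<tau> P"
    unfolding swap2[of Y] unfolding V Y using t2(2) gp projection_positive[OF P] by simp
  finally show ?thesis unfolding h'_def .
qed

text \<open>A substitute for bounding the quasitrace of the support projection of \<open>h\<close>,
  which need not lie in the algebra: \<open>\<tau>\<close> is tested on functions of
  \<open>h\<close> with values in \<open>[0, 1]\<close> that vanish near 0.\<close>

definition support_le :: "'a \<Rightarrow> 'a \<Rightarrow> ennreal \<Rightarrow> bool" where
  "support_le Q h B \<longleftrightarrow> (\<forall>f \<epsilon>. cont f \<longrightarrow> (\<forall>s. 0 \<le> f s \<and> f s \<le> 1) \<longrightarrow> 0 < \<epsilon> \<longrightarrow> (\<forall>s\<le>\<epsilon>. f s = 0) \<longrightarrow>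
     \<tau> (fc Q h f) \<le> B)"

text \<open>The row estimate needs a local unit, so \<open>h\<close> is first cut down to
  \<open>r n * r n\<close>, at distance at most \<open>d n\<close>. The squared unit
  \<open>g n * g n\<close> vanishes below \<open>d n / 2\<close>, hence is bounded by
  \<open>B\<close>. Lower semicontinuity carries the estimate to the limit.\<close>

lemma support_le_add:
  assumes h: "nn Q h" and B: "support_le Q h B" and P: "projection P" and z: "P * z = z" "z * Q = z"
  shows "support_le Q (h + z\<^sup>\<star> * z) (B + \<tau> P)"
  unfolding support_le_def
proof (intro allI impI)
  fix f \<epsilon> assume f: "cont f" "\<forall>s. 0 \<le> f s \<and> f s \<le> 1" "0 < \<epsilon>" "\<forall>s\<le>\<epsilon>. f s = 0"
  note hs = nn_sa[OF h]
  have Q: "projection Q" using hs by (simp add: sa_def)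
  define d where "d n = 1 / real (Suc n)" for n
  have d: "0 < d n" for n by (simp add: d_def)
  define r where "r n = fc Q h (\<lambda>s. sqrt (max (s - d n) 0))" for n
  define g where "g n = fc Q h (\<lambda>s. max 0 (min 1 (2 * s / d n - 1)))" for n
  define H where "H n = r n * r n + z\<^sup>\<star> * z" for n
  have cr: "cont (\<lambda>s. sqrt (max (s - d n) 0))" "cont (\<lambda>s. max (s - d n) 0)" for n
    by (intro continuous_intros)+
  have r: "sa Q (r n)" for n unfolding r_def by (rule fc_sa[OF hs cr(1)])
  have zz: "sa Q (z\<^sup>\<star> * z)" by (rule nn_sa[OF nn_star_mult_corner[OF Q z(2)]])
  have H: "sa Q (H n)" for n unfolding H_def by (intro sa_add zz nn_sa[OF nn_square[OF r]])
  have "(\<lambda>n. r n * r n - h) \<longlonglongrightarrow> 0"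
  proof (rule Lim_null_comparison[of _ d])
    have "norm (r n * r n - h) \<le> d n" for n
    proof -
      have "r n * r n = fc Q h (\<lambda>s. max (s - d n) 0)" unfolding r_def by (rule fc_sqrt[OF hs cr(2), symmetric]) simp
      then have "r n * r n - h = fc Q h (\<lambda>s. max (s - d n) 0 - s)"
        using fc_diff[OF hs cr(2), of "\<lambda>s. s"] by (simp add: fc_id[OF hs])
      also have "norm \<dots> \<le> d n"
      proof (rule fc_norm_le_nn[OF h])
        show "cont (\<lambda>s. max (s - d n) 0 - s)" by (intro continuous_intros)
      qed (use d[of n] in \<open>auto simp: max_def\<close>)
      finally show ?thesis .
    qed
    then show "\<forall>\<^sub>F n in sequentially. norm (r n * r n - h) \<le> d n" by simp
    show "d \<longlonglongrightarrow> 0" unfolding d_def by (rule lim_inverse_n'[THEN LIMSEQ_Suc])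
  qed
  from tendsto_add[OF this tendsto_const[of "h + z\<^sup>\<star> * z"]] have lim: "H \<longlonglongrightarrow> h + z\<^sup>\<star> * z"
    by (simp add: H_def[abs_def] algebra_simps)
  have hz: "sa Q (h + z\<^sup>\<star> * z)" by (intro sa_add hs zz)
  show "\<tau> (fc Q (h + z\<^sup>\<star> * z) f) \<le> B + \<tau> P"
  proof (rule qt_limit_le[OF _ _ fc_tendsto[OF H hz lim f(1)]])
    fix n
    show "fc Q (H n) f \<in> positives" using f by (intro fc_positive H) auto
    have cg: "cont (\<lambda>s. max 0 (min 1 (2 * s / d n - 1)))" by (intro continuous_intros) (use d[of n] in simp)
    have "\<tau> (fc Q (H n) f) \<le> \<tau> (g n * g n) + \<tau> P"
      unfolding H_def r_def g_def using f d by (intro qt_fc_row_le[OF h P z, of f \<epsilon>]) auto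
    also have "g n * g n = fc Q h (\<lambda>s. max 0 (min 1 (2 * s / d n - 1)) * max 0 (min 1 (2 * s / d n - 1)))"
      unfolding g_def by (rule fc_mult[OF hs cg cg, symmetric])
    also have "\<tau> \<dots> \<le> B"
    proof (rule B[unfolded support_le_def, rule_format, of _ "d n / 2"])
      show "cont (\<lambda>s. max 0 (min 1 (2 * s / d n - 1)) * max 0 (min 1 (2 * s / d n - 1)))"
        by (intro continuous_intros cg)
    qed (use d[of n] in \<open>auto simp: field_simps max_def min_def intro!: mult_le_one\<close>)
    finally show "\<tau> (fc Q (H n) f) \<le> B + \<tau> P" by (simp add: add_right_mono)
  qed (use f in \<open>auto intro!: fc_positive hz\<close>)
qed

lemma support_le_sum:
  assumes Q: "projection Q"
    and z: "\<And>i. i < m \<Longrightarrow> projection (P i) \<and> P i * z i = z i \<and> z i * Q = z i"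
  shows "support_le Q (sum_star_mult z m) (\<Sum>i<m. \<tau> (P i))"
  using z
proof (induction m)
  case 0
  show ?case by (auto simp: support_le_def sum_star_mult_def fc_zero[OF Q] qt_zero)
next
  case (Suc m)
  have "nn Q (sum_star_mult z m)" by (rule nn_sum_star_mult[OF Q]) (use Suc in auto)
  from support_le_add[OF this Suc.IH, of "P m" "z m"] Suc.prems show ?case
    by (simp add: sum_star_mult_def)
qed

end

text \<open>\<open>g\<close> and \<open>k\<close> are cut-offs near 0 of the sum \<open>h\<close> of
  all \<open>(z i)\<^sup>\<star> * z i\<close>, so every \<open>z i\<close> is small on
  \<open>k\<close>. The complement of a root of \<open>g * g\<close> lives where \<open>h\<close> is
  bounded away from 0 and is controlled by the supports \<open>P i\<close>. The last bound is stated
  for every root, to survive in \<open>dim_fun\<close>, and additively, to avoid subtraction in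
  \<open>ennreal\<close>.\<close>

lemma approximate_kernel:
  fixes z :: "nat \<Rightarrow> 'a"
  assumes Q: "projection (Q::'a)" and d: "0 < \<delta>"
    and z: "\<And>i. i < m \<Longrightarrow> projection (P i) \<and> P i * z i = z i \<and> z i * Q = z i"
  obtains g k where "sa Q g" "sa Q k" "k * g = g" "g * k = g" "norm g \<le> 1" "norm k \<le> 1" "\<And>i. i < m \<Longrightarrow> norm (z i * k) \<le> \<delta>"
    "\<And>\<tau> n. lsc_2quasitrace \<tau> \<Longrightarrow> \<tau> Q \<le> \<tau> (fcalc (root (Suc n)) (g * g)) + (\<Sum>i<m. \<tau> (P i))"
proof -
  define h where "h = sum_star_mult z m"
  have h: "nn Q h" unfolding h_def by (rule nn_sum_star_mult[OF Q]) (use z in auto)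
  note hs = nn_sa[OF h]
  define \<epsilon> where "\<epsilon> = \<delta>\<^sup>2 / 3"
  have e: "0 < \<epsilon>" "3 * \<epsilon> = \<delta>\<^sup>2" using d by (auto simp: \<epsilon>_def)
  \<comment> \<open>\<open>f\<close> falls from 1 to 0 between \<open>\<epsilon>\<close> and
    \<open>2 * \<epsilon>\<close>, \<open>l\<close> between \<open>2 * \<epsilon>\<close> and
    \<open>3 * \<epsilon> = \<delta>\<^sup>2\<close>. So \<open>l\<close> is 1 wherever
    \<open>f\<close> is nonzero, and \<open>k * h * k\<close> has norm at most
    \<open>\<delta>\<^sup>2\<close>.\<close>
  define f where "f s = max 0 (min 1 (2 - s / \<epsilon>))" for s
  define l where "l s = max 0 (min 1 (3 - s / \<epsilon>))" for s
  have c: "cont f" "cont l" "cont (\<lambda>s. s)" unfolding f_def l_def by (intro continuous_intros; use e in simp)+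
  have fl: "f s * l s = f s" "l s * f s = f s" for s
  proof -
    have "f s * l s = f s"
    proof (cases "s \<le> 2 * \<epsilon>")
      case True
      then have "l s = 1" using e by (simp add: l_def field_simps)
      then show ?thesis by simp
    next
      case False
      then have "f s = 0" using e by (simp add: f_def field_simps)
      then show ?thesis by simp
    qed
    then show "f s * l s = f s" "l s * f s = f s" by (simp_all add: mult.commute)
  qed
  have f01: "0 \<le> f s" "f s \<le> 1" for s by (auto simp: f_def)
  have l01: "0 \<le> l s" "l s \<le> 1" for s by (auto simp: l_def)
  define g where "g = fc Q h f"
  define k where "k = fc Q h l"
  have g: "sa Q g" and k: "sa Q k" unfolding g_def k_def using hs c by (auto intro: fc_sa)
  have kg: "k * g = g" "g * k = g"
    unfolding g_def k_def fc_mult[OF hs c(1,2), symmetric] fc_mult[OF hs c(2,1), symmetric] fl by auto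
  have g1: "norm g \<le> 1" unfolding g_def by (rule fc_norm_le_nn[OF h c(1)]) (use f01 in auto)
  have k1: "norm k \<le> 1" unfolding k_def by (rule fc_norm_le_nn[OF h c(2)]) (use l01 in auto)
  have zk: "norm (z i * k) \<le> \<delta>" if i: "i < m" for i
  proof -
    have ks: "k\<^sup>\<star> = k" "k * Q = k" using k by (auto simp: sa_def cornerD)
    have "(\<Sum>j<m. (z j * k)\<^sup>\<star> * (z j * k)) = k * h * k"
      by (simp add: h_def sum_star_mult_def star_mult ks sum_distrib_left sum_distrib_right mult.assoc)
    also have "\<dots> = fc Q h (\<lambda>s. l s * s * l s)"
    proof -
      have cc: "cont (\<lambda>s. l s * s)" by (intro continuous_intros c)
      show ?thesis unfolding fc_mult[OF hs cc c(2)] fc_mult[OF hs c(2,3)] fc_id[OF hs] k_def ..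
    qed
    finally have khk: "(\<Sum>j<m. (z j * k)\<^sup>\<star> * (z j * k)) = fc Q h (\<lambda>s. l s * s * l s)" .
    have le1: "norm (fc Q h (\<lambda>s. l s * s * l s)) \<le> 3 * \<epsilon>"
    proof (rule fc_norm_le_nn[OF h])
      fix s :: real assume s: "0 \<le> s"
      show "\<bar>l s * s * l s\<bar> \<le> 3 * \<epsilon>"
      proof (cases "s \<le> 3 * \<epsilon>")
        case True
        have "l s * s * l s \<le> 1 * s * 1" using s l01[of s] by (intro mult_mono) auto
        then show ?thesis using True s l01[of s] by simp
      next
        case False
        then have "l s = 0" using e by (simp add: l_def field_simps)
        then show ?thesis using e by simp
      qed
    qed (intro continuous_intros c)
    have le2: "norm ((z i * k)\<^sup>\<star> * (z i * k)) \<le> norm (\<Sum>j<m. (z j * k)\<^sup>\<star> * (z j * k))"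
    proof -
      have "nn Q (\<Sum>j\<in>J. (z j * k)\<^sup>\<star> * (z j * k))" for J
        by (induction J rule: infinite_finite_induct)
          (auto intro!: nn_zero Q nn_add nn_star_mult_corner simp: mult.assoc ks)
      then have "(\<Sum>j\<in>{..<m} - {i}. (z j * k)\<^sup>\<star> * (z j * k)) \<in> positives" by (rule nn_positive)
      from norm_mono[OF positivesI this] show ?thesis
        using i by (subst sum.remove[of _ i]) auto
    qed
    have "(norm (z i * k))\<^sup>2 \<le> \<delta>\<^sup>2"
      using order_trans[OF le2[unfolded khk] le1] unfolding cstar_identity e(2) .
    then show ?thesis by (rule power2_le_imp_le) (use d in simp)
  qed
  have "\<tau> Q \<le> \<tau> (fcalc (root (Suc n)) (g * g)) + (\<Sum>i<m. \<tau> (P i))" if t: "lsc_2quasitrace \<tau>" for \<tau> n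
  proof -
    have cc: "cont (root (Suc n))" "cont (\<lambda>s. f s * f s)" "cont (\<lambda>s. root (Suc n) (f s * f s))"
      by (intro continuous_intros c)+
    have gg: "g * g = fc Q h (\<lambda>s. f s * f s)" unfolding g_def by (rule fc_mult[OF hs c(1,1), symmetric])
    have "fcalc (root (Suc n)) (g * g) = fc Q (g * g) (root (Suc n))"
      by (rule fcalc_eq_fc[OF _ _ cc(1)]) (auto simp: gg fc_sa[OF hs cc(2)] intro!: fc_positive hs cc)
    also have "\<dots> = fc Q h (\<lambda>s. root (Suc n) (f s * f s))"
      unfolding gg by (rule fc_comp[OF hs cc(1,2)])
    finally have root: "fcalc (root (Suc n)) (g * g) = fc Q h (\<lambda>s. root (Suc n) (f s * f s))" .
    have r01: "0 \<le> root (Suc n) (f s * f s)" "root (Suc n) (f s * f s) \<le> 1" for s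
    proof -
      have "f s * f s \<le> 1" using f01[of s] by (simp add: mult_le_one)
      then have "root (Suc n) (f s * f s) \<le> root (Suc n) 1" by (subst real_root_le_iff) auto
      then show "root (Suc n) (f s * f s) \<le> 1" by simp
    qed simp
    have "support_le \<tau> Q h (\<Sum>i<m. \<tau> (P i))"
      unfolding h_def by (rule support_le_sum[OF t Q z])
    then have "\<tau> (fc Q h (\<lambda>s. 1 - root (Suc n) (f s * f s))) \<le> (\<Sum>i<m. \<tau> (P i))"
      unfolding support_le_def[OF t]
    proof (elim allE[of _ "\<lambda>s. 1 - root (Suc n) (f s * f s)"] allE[of _ \<epsilon>] impE, goal_cases)
      case 1
      show ?case by (intro continuous_intros c)
    next
      case 4
      have "f s = 1" if "s \<le> \<epsilon>" for s using that e by (simp add: f_def field_simps)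
      then show ?case by simp
    qed (use r01 e in auto)
    then show ?thesis
      unfolding qt_fc_split[OF t hs cc(3) r01] root by (rule add_left_mono)
  qed
  then show thesis using that[OF g k kg g1 k1 zk] by blast
qed

end

section \<open>Partial isometries from Cuntz subequivalence\<close>

text \<open>Once \<open>(r n)\<^sup>\<star> * (g * g) * r n\<close> is within 1 of \<open>q\<close>,
  its compression \<open>t\<close> is invertible in the corner of \<open>q\<close>, and
  \<open>g * r n * q\<close> can be normalized by the inverse square root of \<open>t\<close>. The
  left factor \<open>g\<close> gives the last property.\<close>

lemma partial_isometry_of_cuntz_le:
  assumes q: "projection q" and g: "g\<^sup>\<star> = g" and le: "q \<precsim> g * g"
  obtains v where "v\<^sup>\<star> * v = q" "v * q = v" "\<And>k. k * g = g \<Longrightarrow> k * v = v"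
proof -
  have qq: "q * q = q" "q\<^sup>\<star> = q" using q by (auto simp: projection_def)
  obtain r where "(\<lambda>n. (r n)\<^sup>\<star> * (g * g) * r n) \<longlonglongrightarrow> q" using le by (auto simp: cuntz_le_def)
  from LIMSEQ_D[OF this zero_less_one] obtain n where n: "norm ((r n)\<^sup>\<star> * (g * g) * r n - q) < 1" by blast
  define t where "t = q * ((r n)\<^sup>\<star> * (g * g) * r n) * q"
  define K where "K = q - t"
  have ts: "t\<^sup>\<star> = t" by (simp add: t_def star_mult star_star qq g mult.assoc)
  have qt: "q * t = t" "t * q = t" using qq(1) by (simp_all add: t_def mult.assoc) (simp_all add: mult.assoc[symmetric])
  have K: "K\<^sup>\<star> = K" "q * K = K" using ts qt qq by (simp_all add: K_def star_diff algebra_simps)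
  have "K = - (q * ((r n)\<^sup>\<star> * (g * g) * r n - q) * q)"
    unfolding K_def t_def left_diff_distrib right_diff_distrib qq by simp
  then have "norm K = norm (q * ((r n)\<^sup>\<star> * (g * g) * r n - q) * q)" by (simp only: norm_minus_cancel)
  also have "\<dots> \<le> norm (q * ((r n)\<^sup>\<star> * (g * g) * r n - q)) * 1"
    by (rule order_trans[OF norm_mult_ineq mult_left_mono[OF norm_projection_le[OF q]]]) simp
  also have "\<dots> \<le> (1 * norm ((r n)\<^sup>\<star> * (g * g) * r n - q)) * 1"
    by (intro mult_right_mono order_trans[OF norm_mult_ineq mult_right_mono[OF norm_projection_le[OF q]]]) auto
  finally have "norm K < 1" using n by simp
  then obtain w where w: "w\<^sup>\<star> = w" "norm w < 1" "K = 2 *\<^sub>R w - w * w" "q * w = w"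
    using sqrt_one_minus[OF K(1)] K(2) by (smt (verit, best))
  have wq: "w * q = w" using arg_cong[OF w(4), of star] by (simp add: star_mult qq w(1))
  obtain H where H: "H = w + H * w" "H = w + w * H" using quasi_inverse[OF w(2)] by blast
  have "q * H = q * w + q * w * H" using arg_cong[OF H(2), of "\<lambda>x. q * x"] by (simp add: algebra_simps)
  then have qH: "q * H = H" using H(2) w(4) by simp
  have "H * q = w * q + H * (w * q)" using arg_cong[OF H(1), of "\<lambda>x. x * q"] by (simp add: algebra_simps)
  then have Hq: "H * q = H" using H(1) wq by simp
  have inv: "(q - w) * (q + H) = q"
  proof -
    have "(q - w) * (q + H) = q + H - (w + w * H)" by (simp add: algebra_simps qq qH wq)
    then show ?thesis using H(2) by simp
  qed
  have sq: "(q - w) * (q - w) = t"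
    using w(3,4) wq qq by (simp add: K_def algebra_simps scaleR_2)
  define s where "s = r n * q"
  \<comment> \<open>\<open>q - w\<close> is the square root of \<open>t\<close>, and
    \<open>q + H\<close> is its inverse in the corner.\<close>
  define v where "v = g * s * (q + H)"
  have "v\<^sup>\<star> * v = (q + H)\<^sup>\<star> * t * (q + H)"
    by (simp add: v_def s_def t_def star_mult star_star g qq mult.assoc)
  also have "\<dots> = ((q - w) * (q + H))\<^sup>\<star> * ((q - w) * (q + H))"
    unfolding sq[symmetric] star_mult by (simp add: star_diff w(1) qq mult.assoc)
  also have "\<dots> = q" unfolding inv qq ..
  finally have "v\<^sup>\<star> * v = q" .
  moreover have "v * q = v" by (simp add: v_def mult.assoc distrib_right qq Hq)
  moreover have "k * v = v" if "k * g = g" for k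
    unfolding v_def mult.assoc using that by (simp add: mult.assoc[symmetric])
  ultimately show thesis using that by blast
qed

text \<open>By orthogonality \<open>(a + b) * (a + b) = a * a + b * b\<close> is again such a sum,
  so repeated squaring keeps the bound 2, and taking \<open>2 ^ n\<close>-th roots removes
  it.\<close>

lemma norm_orthogonal_add_le:
  fixes a b :: "'a::cstar_algebra"
  assumes "a\<^sup>\<star> = a" "b\<^sup>\<star> = b" "a * b = 0" "b * a = 0" "norm a \<le> 1" "norm b \<le> 1"
  shows "norm (a + b) \<le> 1"
proof (rule power_growth_bound[where d = 1])
  fix n
  have "norm (a + b) ^ 2 ^ n \<le> 2" using assms
  proof (induction n arbitrary: a b)
    case 0
    then show ?case using norm_triangle_ineq[of a b] by simp
  next
    case (Suc n)
    have "norm (a * a) \<le> 1" "norm (b * b) \<le> 1"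
      using Suc.prems norm_mult_ineq[of a a] norm_mult_ineq[of b b]
      by (meson mult_le_one norm_ge_zero order_trans)+
    moreover have "(a * a) * (b * b) = 0" "(b * b) * (a * a) = 0"
      using Suc.prems(3,4) by (metis mult.assoc mult_zero_left mult_zero_right)+
    ultimately have "norm (a * a + b * b) ^ 2 ^ n \<le> 2"
      using Suc.prems by (intro Suc.IH) (auto simp: star_mult)
    moreover have "norm (a * a + b * b) = (norm (a + b))\<^sup>2"
      using norm_selfadjoint_square[of "a + b"] Suc.prems by (simp add: star_add algebra_simps)
    ultimately show ?case by (simp add: power_mult)
  qed
  also have "(2::real) \<le> (2 * (real 1 * 2 ^ n) + 1) * 1 ^ 2 ^ n"
    using one_le_power[of "2::real" n] by (simp del: one_le_power)
  finally show "norm (a + b) ^ 2 ^ n \<le> (2 * (real 1 * 2 ^ n) + 1) * 1 ^ 2 ^ n" .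
qed auto

section \<open>Ideals\<close>

lemma ideal_diff: "is_ideal J \<Longrightarrow> x \<in> J \<Longrightarrow> y \<in> J \<Longrightarrow> x - y \<in> J"
  using scaleC_minus_one[of y] unfolding is_ideal_def by (metis add_uminus_conv_diff)

lemma ideal_add: "is_ideal J \<Longrightarrow> x \<in> J \<Longrightarrow> y \<in> J \<Longrightarrow> x + y \<in> J"
  and ideal_left: "is_ideal J \<Longrightarrow> x \<in> J \<Longrightarrow> a * x \<in> J"
  and ideal_right: "is_ideal J \<Longrightarrow> x \<in> J \<Longrightarrow> x * a \<in> J"
  and ideal_zero: "is_ideal J \<Longrightarrow> 0 \<in> J"
  by (auto simp: is_ideal_def)

lemma ideal_scaleR: "is_ideal J \<Longrightarrow> x \<in> J \<Longrightarrow> c *\<^sub>R x \<in> J"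
  using scaleC_of_real[of c x] unfolding is_ideal_def by metis

lemma ideal_sum: "is_ideal J \<Longrightarrow> (\<And>i. i \<in> I \<Longrightarrow> f i \<in> J) \<Longrightarrow> sum f I \<in> J"
  by (induction I rule: infinite_finite_induct) (auto intro: ideal_add ideal_zero)

text \<open>Left multiplication by \<open>1 + H\<close>, with the quasi-inverse \<open>H\<close> of
  \<open>G\<close>, recovers \<open>X\<close>.\<close>

lemma ideal_cancel:
  assumes J: "is_ideal J" and G: "norm G < 1" and X: "X - G * X \<in> J" shows "X \<in> J"
proof -
  obtain H where H: "H = G + H * G" using quasi_inverse[OF G] by blast
  have "H * X = G * X + H * (G * X)" using arg_cong[OF H, of "\<lambda>y. y * X"] by (simp add: algebra_simps)
  then have "(X - G * X) + H * (X - G * X) = X" by (simp add: algebra_simps)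
  then show ?thesis using ideal_add[OF J X ideal_left[OF J X, of H]] by simp
qed

text \<open>For \<open>x \<in> J\<close> close to \<open>q\<close>, the element
  \<open>q * x * q\<close> of \<open>J\<close> is \<open>q\<close> up to the left factor
  \<open>1 - q * (q - x)\<close>, which can be cancelled.\<close>

lemma projection_in_dense_ideal:
  assumes J: "is_ideal J" "norm_dense J" and q: "projection q" shows "q \<in> J"
proof -
  have "q \<in> closure J" using J by (simp add: norm_dense_def)
  then obtain x where x: "x \<in> J" "dist x q < 1" unfolding closure_approachable by (meson zero_less_one)
  have qq: "q * q = q" using q by (simp add: projection_def)
  have "norm (q * (q - x)) \<le> 1 * norm (q - x)"
    by (rule order_trans[OF norm_mult_ineq mult_right_mono[OF norm_projection_le[OF q]]]) simp
  then have n: "norm (q * (q - x)) < 1" using x(2) by (simp add: dist_norm norm_minus_commute)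
  have "q - q * (q - x) * q = q * x * q" by (simp add: algebra_simps qq)
  then have "q - q * (q - x) * q \<in> J" using x(1) J by (simp add: ideal_left ideal_right)
  then show ?thesis by (rule ideal_cancel[OF J(1) n])
qed

lemma ideal_closure: assumes J: "is_ideal J" shows "is_ideal (closure J)"
proof -
  have bl: "f ` closure J \<subseteq> closure J" if "bounded_linear f" "f ` J \<subseteq> J" for f :: "'a::cstar_algebra \<Rightarrow> 'a"
    using closure_bounded_linear_image_subset[OF that(1), of J] closure_mono[OF that(2)] by blast
  have sc: "bounded_linear (\<lambda>x::'a. c *\<^sub>C x)" for c
    by (rule bounded_linear_intro[where K = "cmod c"])
      (auto simp: scaleC_add_right norm_scaleC mult.commute scaleC_scaleC scaleC_of_real[symmetric])
  have 1: "x + y \<in> closure J" if "x \<in> closure J" "y \<in> closure J" for x y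
  proof -
    obtain f g where fg: "\<forall>n. f n \<in> J" "f \<longlonglongrightarrow> x" "\<forall>n. g n \<in> J" "g \<longlonglongrightarrow> y"
      using \<open>x \<in> _\<close> \<open>y \<in> _\<close> unfolding closure_sequential by blast
    then have "\<forall>n. f n + g n \<in> J" using ideal_add[OF J] by blast
    then show ?thesis unfolding closure_sequential
      using tendsto_add[OF fg(2,4)] by (intro exI[of _ "\<lambda>n. f n + g n"]) simp
  qed
  have 2: "c *\<^sub>C x \<in> closure J" if "x \<in> closure J" for c x
    using bl[OF sc[of c]] that J unfolding is_ideal_def by blast
  have 3: "a * x \<in> closure J" "x * a \<in> closure J" if "x \<in> closure J" for a x
    using bl[OF bounded_linear_mult_right[of a]] bl[OF bounded_linear_mult_left[of a]] that
      ideal_left[OF J] ideal_right[OF J] by blast+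
  have 4: "0 \<in> closure J" using J closure_subset ideal_zero by blast
  show ?thesis unfolding is_ideal_def by (intro conjI ballI allI 1 2 3 4)
qed

section \<open>Weighted sums\<close>

text \<open>Summation by parts; it covers both Dirichlet's test (\<open>t n\<close> minus a partial sum) and
  the factorization of \<open>a\<close> along an approximate unit.\<close>

lemma abel_summable:
  fixes t :: "nat \<Rightarrow> 'a::banach"
  assumes lim: "(\<lambda>n. b n *\<^sub>R t n) \<longlonglongrightarrow> 0" and sm: "summable (\<lambda>n. \<bar>b (Suc n) - b n\<bar> * norm (t (Suc n)))"
  shows "summable (\<lambda>n. b n *\<^sub>R (t n - t (Suc n)))"
proof -
  have s: "summable (\<lambda>n. (b (Suc n) - b n) *\<^sub>R t (Suc n))"
    by (rule summable_norm_cancel) (use sm in simp)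
  have "summable (\<lambda>n. b n *\<^sub>R t n - b (Suc n) *\<^sub>R t (Suc n))"
    by (rule telescope_summable'[OF lim])
  from summable_add[OF this s] show ?thesis by (simp add: algebra_simps)
qed

lemma summable_abs_diff_decseq:
  fixes b :: "nat \<Rightarrow> real"
  assumes "decseq b" "b \<longlonglongrightarrow> 0" shows "summable (\<lambda>n. \<bar>b (Suc n) - b n\<bar>)"
proof -
  have "\<bar>b (Suc n) - b n\<bar> = b n - b (Suc n)" for n using decseq_SucD[OF assms(1), of n] by simp
  then show ?thesis using telescope_summable'[OF assms(2)] by simp
qed

lemma dirichlet_summable:
  fixes f :: "nat \<Rightarrow> 'a::banach"
  assumes b: "decseq b" "b \<longlonglongrightarrow> 0" and C: "\<And>n. norm (\<Sum>i<n. f i) \<le> C"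
  shows "summable (\<lambda>n. b n *\<^sub>R f n)"
proof -
  define t where "t n = - (\<Sum>i<n. f i)" for n
  have "summable (\<lambda>n. b n *\<^sub>R (t n - t (Suc n)))"
  proof (rule abel_summable)
    have t: "norm (t n) \<le> C" for n using C by (simp add: t_def)
    have C0: "0 \<le> C" using C[of 0] by simp
    show "(\<lambda>n. b n *\<^sub>R t n) \<longlonglongrightarrow> 0"
    proof (rule Lim_null_comparison)
      show "\<forall>\<^sub>F n in sequentially. norm (b n *\<^sub>R t n) \<le> \<bar>b n\<bar> * C"
        using t by (simp add: mult_left_mono)
      show "(\<lambda>n. \<bar>b n\<bar> * C) \<longlonglongrightarrow> 0"
        using tendsto_mult_right[OF tendsto_rabs[OF b(2)], of C] by simp
    qed
    show "summable (\<lambda>n. \<bar>b (Suc n) - b n\<bar> * norm (t (Suc n)))"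
      by (rule summable_comparison_test'[OF summable_mult2[OF summable_abs_diff_decseq[OF b], of C]])
        (use t C0 in \<open>auto intro!: mult_left_mono simp: abs_mult\<close>)
  qed
  then show ?thesis by (simp add: t_def)
qed

lemma suminf_mult_left: "summable f \<Longrightarrow> a * suminf f = (\<Sum>n. a * f n :: 'a::{real_normed_algebra,banach})"
  by (rule bounded_linear.suminf[OF bounded_linear_mult_right])

lemma suminf_mult_right: "summable f \<Longrightarrow> suminf f * a = (\<Sum>n. f n * a :: 'a::{real_normed_algebra,banach})"
  by (rule bounded_linear.suminf[OF bounded_linear_mult_left])

lemma suminf_star: "summable f \<Longrightarrow> (suminf f)\<^sup>\<star> = (\<Sum>n. (f n)\<^sup>\<star> :: 'a::cstar_algebra)"
  by (rule bounded_linear.suminf[OF bounded_linear_star])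

lemma suminf_single:
  fixes f :: "nat \<Rightarrow> 'a::{comm_monoid_add,t2_space}"
  assumes "\<And>m. m \<noteq> n \<Longrightarrow> f m = 0" shows "suminf f = f n"
  using suminf_finite[of "{n}" f] assms by auto

locale nested_projection_unit = projection_unit +
  assumes nested: "m \<le> n \<Longrightarrow> p m * p n = p m" "m \<le> n \<Longrightarrow> p n * p m = p m"
begin

lemma p_mult: "p m * p n = p (min m n)"
  using nested[of m n] nested[of n m] by (cases "m \<le> n") (auto simp: min_def)

definition step :: "nat \<Rightarrow> 'a" where "step n = p (Suc n) - p n"

lemma step_mult: "step m * step n = (if m = n then step n else 0)"
proof -
  consider "m = n" | "Suc m \<le> n" | "Suc n \<le> m" by linarith
  then show ?thesis
    by cases (simp_all add: step_def algebra_simps p_mult min_absorb1 min_absorb2)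
qed

lemma projection_diff: "m \<le> n \<Longrightarrow> projection (p n - p m)"
  using proj[of n] proj[of m] nested[of m n] by (auto simp: projection_def star_diff algebra_simps)

lemma projection_step: "projection (step n)"
  unfolding step_def by (rule projection_diff) simp

lemma norm_tail_le: "norm (t - p n * t) \<le> norm t"
proof -
  have p: "p n * p n = p n" "(p n)\<^sup>\<star> = p n" using proj by (auto simp: projection_def)
  have pp: "p n * (p n * y) = p n * y" for y using p(1) by (simp flip: mult.assoc)
  have "t\<^sup>\<star> * t = (t - p n * t)\<^sup>\<star> * (t - p n * t) + (p n * t)\<^sup>\<star> * (p n * t)"
    by (simp add: star_diff star_mult p pp algebra_simps)
  then have "norm ((t - p n * t)\<^sup>\<star> * (t - p n * t)) \<le> norm (t\<^sup>\<star> * t)"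
    using norm_mono[OF positivesI positivesI, of "t - p n * t" "p n * t"] by simp
  then have "(norm (t - p n * t))\<^sup>2 \<le> (norm t)\<^sup>2" unfolding cstar_identity .
  then show ?thesis by (rule power2_le_imp_le) simp
qed

lemma decseq_tail: "decseq (\<lambda>n. norm (a - p n * a))"
proof (rule decseq_SucI)
  fix n
  have "a - p (Suc n) * a = (a - p n * a) - p (Suc n) * (a - p n * a)"
    using nested(2)[of n "Suc n"] by (simp add: right_diff_distrib mult.assoc[symmetric])
  then show "norm (a - p (Suc n) * a) \<le> norm (a - p n * a)" using norm_tail_le[of "a - p n * a" "Suc n"] by (simp only:)
qed

lemma sum_step: "(\<Sum>i<n. step i) = p n - p 0"
  unfolding step_def by (rule sum_lessThan_telescope)

text \<open>The partial sums of \<open>step\<close> are projections, so Dirichlet's test applies to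
  weights that need not be summable.\<close>

lemma summable_step:
  assumes "decseq b" "b \<longlonglongrightarrow> 0" shows "summable (\<lambda>n. b n *\<^sub>R step n)"
  by (rule dirichlet_summable[OF assms, of _ 1])
    (auto simp: sum_step intro!: norm_projection_le projection_diff)

lemma suminf_step_mult:
  assumes "summable (\<lambda>n. b n *\<^sub>R step n)"
  shows "(\<Sum>n. b n *\<^sub>R step n) * step m = b m *\<^sub>R step m" "step m * (\<Sum>n. b n *\<^sub>R step n) = b m *\<^sub>R step m"
  unfolding suminf_mult_right[OF assms] suminf_mult_left[OF assms]
  by (subst suminf_single[of m]; simp add: step_mult)+

lemma suminf_step_mult_suminf:
  assumes b: "summable (\<lambda>n. b n *\<^sub>R step n)" and c: "summable (\<lambda>n. c n *\<^sub>R step n)"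
  shows "(\<Sum>n. b n *\<^sub>R step n) * (\<Sum>n. c n *\<^sub>R step n) = (\<Sum>n. (b n * c n) *\<^sub>R step n)"
  unfolding suminf_mult_left[OF c] using suminf_step_mult(1)[OF b] by (simp add: mult.commute)

text \<open>If the weights \<open>r\<close> decay slowly compared with the tails of \<open>a\<close>, then
  \<open>\<Sum> (r n)\<^sup>-\<^sup>1 step n \<cdot> a\<close> still converges, so \<open>a\<close> is divisible by \<open>\<Sum> r n \<cdot> step n\<close>.\<close>

lemma factor_through_weights:
  assumes r: "decseq r" "r \<longlonglongrightarrow> 0" "\<And>n. 0 < r n" and a: "\<And>n. norm (a - p n * a) \<le> (r n)\<^sup>2"
  obtains a' where "a = p 0 * a + (\<Sum>n. r n *\<^sub>R step n) * a'"
proof -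
  define t where "t n = a - p n * a" for n
  have "summable (\<lambda>n. inverse (r n) *\<^sub>R (t n - t (Suc n)))"
  proof (rule abel_summable)
    have le: "norm (inverse (r n) *\<^sub>R t n) \<le> r n" for n
    proof -
      have "inverse (r n) * norm (t n) \<le> inverse (r n) * (r n)\<^sup>2"
        using a[of n] r(3)[of n] by (intro mult_left_mono) (auto simp: t_def)
      also have "\<dots> = r n" using r(3)[of n] by (simp add: power2_eq_square)
      finally show ?thesis using r(3)[of n] by simp
    qed
    show "(\<lambda>n. inverse (r n) *\<^sub>R t n) \<longlonglongrightarrow> 0"
      by (rule Lim_null_comparison[OF _ r(2)]) (simp add: le del: norm_scaleR)
    show "summable (\<lambda>n. \<bar>inverse (r (Suc n)) - inverse (r n)\<bar> * norm (t (Suc n)))"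
    proof (rule summable_comparison_test'[OF summable_abs_diff_decseq[OF r(1,2)]])
      fix n
      let ?x = "r n" and ?y = "r (Suc n)"
      have xy: "0 < ?y" "?y \<le> ?x" using r(3) decseq_SucD[OF r(1)] by auto
      have abs: "\<bar>inverse ?y - inverse ?x\<bar> = inverse ?y - inverse ?x" using xy by (simp add: le_imp_inverse_le)
      \<comment> \<open>The square in the hypothesis on \<open>a\<close> pays for both inverses:
        what remains is at most \<open>?x - ?y\<close>, which telescopes.\<close>
      have "(inverse ?y - inverse ?x) * norm (t (Suc n)) \<le> (inverse ?y - inverse ?x) * ?y\<^sup>2"
        unfolding t_def using xy by (intro mult_left_mono a) (simp add: le_imp_inverse_le)
      also have "(inverse ?y - inverse ?x) * ?y\<^sup>2 = (?x - ?y) * (?y / ?x)"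
        using xy by (simp add: field_simps power2_eq_square)
      also have "\<dots> \<le> (?x - ?y) * 1" using xy by (intro mult_left_mono) auto
      also have "\<dots> \<le> \<bar>?y - ?x\<bar>" by simp
      finally show "norm (\<bar>inverse ?y - inverse ?x\<bar> * norm (t (Suc n))) \<le> \<bar>?y - ?x\<bar>" by (simp only: abs real_norm_def abs_mult abs_norm_cancel)
    qed
  qed
  moreover have ts: "t n - t (Suc n) = step n * a" for n by (simp add: t_def step_def algebra_simps)
  ultimately have sm: "summable (\<lambda>n. inverse (r n) *\<^sub>R (step n * a))" by simp
  define a' where "a' = (\<Sum>n. inverse (r n) *\<^sub>R (step n * a))"
  let ?D = "\<Sum>n. r n *\<^sub>R step n"
  have "?D * a' = (\<Sum>n. ?D * (inverse (r n) *\<^sub>R (step n * a)))"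
    unfolding a'_def by (rule suminf_mult_left[OF sm])
  also have "\<dots> = (\<Sum>n. t n - t (Suc n))"
  proof (rule suminf_cong)
    fix n
    have "?D * (step n * a) = r n *\<^sub>R (step n * a)"
      using suminf_step_mult(1)[OF summable_step[OF r(1,2)], of n] by (simp flip: mult.assoc)
    then show "?D * (inverse (r n) *\<^sub>R (step n * a)) = t n - t (Suc n)"
      using r(3)[of n] by (simp add: ts)
  qed
  also have "\<dots> = t 0 - 0"
  proof (rule sums_unique[symmetric, OF telescope_sums'])
    show "t \<longlonglongrightarrow> 0" unfolding t_def using tendsto_diff[OF tendsto_const left_unit, of a a] by simp
  qed
  finally have "a = p 0 * a + ?D * a'" by (simp add: t_def)
  then show thesis by (rule that)
qed

lemma subseq_nested:
  assumes "strict_mono N" shows "nested_projection_unit (\<lambda>n. p (N n))"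
proof
  show "(\<lambda>n. p (N n) * a) \<longlonglongrightarrow> a" "(\<lambda>n. a * p (N n)) \<longlonglongrightarrow> a" for a
    using LIMSEQ_subseq_LIMSEQ[OF left_unit assms] LIMSEQ_subseq_LIMSEQ[OF right_unit assms]
    by (simp_all add: o_def)
qed (use assms in \<open>auto simp: proj strict_mono_less_eq intro: nested\<close>)

end

section \<open>A maximal ideal containing the approximate unit\<close>

text \<open>\<open>I\<close> is \<open>J\<close> plus the finite sums of terms
  \<open>a * x * b\<close>. It contains \<open>x * x * x\<close> (take \<open>a = b = x\<close>), so
  it is strictly larger than \<open>J\<close> and must be everything. Complex scalars are absorbed
  into the left factors, and lists turn addition into \<open>@\<close>.\<close>

lemma maximal_ideal_decomposition:
  assumes J: "maximal_ideal J" and x: "x * x * x \<notin> J"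
  obtains j m a b where "j \<in> J" "y = j + (\<Sum>i<m::nat. a i * x * b i)"
proof -
  define S where "S l = (\<Sum>(a, b)\<leftarrow>l. a * x * b)" for l :: "('a \<times> 'a) list"
  define I where "I = {j + S l | j l. j \<in> J}"
  have iJ: "is_ideal J" using J by (simp add: maximal_ideal_def proper_ideal_def)
  have Iin: "j + S l \<in> I" if "j \<in> J" for j l using that unfolding I_def by blast
  have IE: thesis if "z \<in> I" "\<And>j l. z = j + S l \<Longrightarrow> j \<in> J \<Longrightarrow> thesis" for z thesis
    using that unfolding I_def by blast
  have Sapp: "S (l @ l') = S l + S l'" for l l' by (simp add: S_def)
  have Sc: "S (map (\<lambda>(a, b). (c *\<^sub>C a, b)) l) = c *\<^sub>C S l" for c l
    by (induction l) (auto simp: S_def scaleC_add_right mult_scaleC_left)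
  have Sl: "S (map (\<lambda>(a, b). (c * a, b)) l) = c * S l" for c l
    by (induction l) (auto simp: S_def algebra_simps)
  have Sr: "S (map (\<lambda>(a, b). (a, b * c)) l) = S l * c" for c l
    by (induction l) (auto simp: S_def algebra_simps)
  have "is_ideal I" unfolding is_ideal_def
  proof (intro conjI ballI allI)
    show "0 \<in> I" using Iin[OF ideal_zero[OF iJ], of "[]"] by (simp add: S_def)
  next
    fix u v assume "u \<in> I" "v \<in> I"
    then obtain j l j' l' where "u = j + S l" "j \<in> J" "v = j' + S l'" "j' \<in> J" by (auto elim!: IE)
    then have "u + v = (j + j') + S (l @ l')" by (simp add: Sapp)
    then show "u + v \<in> I" using Iin ideal_add[OF iJ] \<open>j \<in> J\<close> \<open>j' \<in> J\<close> by simp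
  next
    fix c u assume "u \<in> I"
    then obtain j l where u: "u = j + S l" "j \<in> J" by (auto elim!: IE)
    have "c *\<^sub>C j \<in> J" using iJ u(2) by (simp add: is_ideal_def)
    then show "c *\<^sub>C u \<in> I" unfolding u(1) scaleC_add_right Sc[symmetric] by (rule Iin)
  next
    fix u c assume "u \<in> I"
    then obtain j l where u: "u = j + S l" "j \<in> J" by (auto elim!: IE)
    show "c * u \<in> I" unfolding u(1) distrib_left Sl[symmetric] by (rule Iin[OF ideal_left[OF iJ u(2)]])
    show "u * c \<in> I" unfolding u(1) distrib_right Sr[symmetric] by (rule Iin[OF ideal_right[OF iJ u(2)]])
  qed
  moreover have JI: "J \<subseteq> I" using Iin[of _ "[]"] by (auto simp: S_def)
  moreover have "x * x * x \<in> I" using Iin[OF ideal_zero[OF iJ], of "[(x, x)]"] by (simp add: S_def)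
  ultimately have "I = UNIV"
    using J x unfolding maximal_ideal_def proper_ideal_def by blast
  then have "y \<in> I" by simp
  then obtain j l where jl: "y = j + S l" "j \<in> J" unfolding I_def by blast
  have "S l = (\<Sum>i<length l. fst (l ! i) * x * snd (l ! i))"
    by (simp add: S_def sum_list_sum_nth atLeast0LessThan case_prod_beta)
  then show thesis using that[OF jl(2)] jl(1) by simp
qed

lemma geometric_half: "(\<Sum>n. (1/2::real) ^ n) = 2" "summable (\<lambda>n. (1/2::real) ^ n)"
  using suminf_geometric[of "1/2::real"] by auto

lemma summable_norm_half:
  fixes f :: "nat \<Rightarrow> 'a::banach"
  assumes "\<And>n. norm (f n) \<le> C * (1/2) ^ n"
  shows "summable f" "norm (suminf f) \<le> 2 * C"
proof -
  have s: "summable (\<lambda>n. C * (1/2) ^ n)" by (intro summable_mult geometric_half)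
  show "summable f" by (rule summable_comparison_test'[OF s]) (use assms in auto)
  have "norm (suminf f) \<le> (\<Sum>n. C * (1/2) ^ n)" by (rule norm_suminf_le[OF assms s])
  also have "\<dots> = 2 * C" unfolding suminf_mult[OF geometric_half(2)] geometric_half(1) by simp
  finally show "norm (suminf f) \<le> 2 * C" .
qed

section \<open>Slowly decaying weights, and weighted series of almost orthogonal partial
  isometries\<close>

context nested_projection_unit
begin

text \<open>Sixth roots, because \<open>(\<gamma> n ^ 3)\<^sup>2\<close> is a sixth power. The added
  \<open>(1/64) ^ n\<close> keeps the weights positive and, as \<open>64 = 2 ^ 6\<close>, above
  \<open>(1/2) ^ n\<close>.\<close>

lemma slow_weights:
  "\<exists>\<gamma>. decseq \<gamma> \<and> \<gamma> \<longlonglongrightarrow> 0 \<and> (\<forall>n. 0 < \<gamma> n) \<and> (\<forall>n. (1/2) ^ n \<le> \<gamma> n) \<and>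
    (\<forall>n. norm (a - p n * a) \<le> (\<gamma> n ^ 3)\<^sup>2)"
proof -
  define u where "u n = norm (a - p n * a) + (1/64) ^ n" for n
  have u: "0 < u n" for n by (simp add: u_def add_nonneg_pos)
  have "decseq (\<lambda>n. (1/64::real) ^ n)" by (intro decseq_SucI) simp
  then have du: "decseq u" using decseq_tail[of a] unfolding u_def decseq_def by (auto intro!: add_mono)
  have "(\<lambda>n. a - p n * a) \<longlonglongrightarrow> 0" using tendsto_diff[OF tendsto_const left_unit, of a a] by simp
  then have "u \<longlonglongrightarrow> 0 + 0" unfolding u_def by (intro tendsto_add tendsto_norm_zero LIMSEQ_power_zero) auto
  then have lu: "(\<lambda>n. root 6 (u n)) \<longlonglongrightarrow> root 6 0" by (intro tendsto_real_root) simp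
  show ?thesis
  proof (intro exI[of _ "\<lambda>n. root 6 (u n)"] conjI allI)
    show "decseq (\<lambda>n. root 6 (u n))" using du by (auto simp: decseq_def)
    show "(\<lambda>n. root 6 (u n)) \<longlonglongrightarrow> 0" using lu by simp
    show "0 < root 6 (u n)" for n using u by simp
    have six: "root 6 (u n) ^ 6 = u n" for n using u[of n] by simp
    show "(1/2) ^ n \<le> root 6 (u n)" for n
    proof (rule power_le_imp_le_base)
      have "((1/2::real) ^ n) ^ Suc 5 = ((1/2) ^ 6) ^ n" by (simp flip: power_mult add: mult.commute)
      also have "\<dots> \<le> u n" by (simp add: u_def power_divide)
      finally show "((1/2) ^ n) ^ Suc 5 \<le> root 6 (u n) ^ Suc 5" using six[of n] by simp
    qed (use less_imp_le[OF u[of n]] in simp)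
    show "norm (a - p n * a) \<le> (root 6 (u n) ^ 3)\<^sup>2" for n
      using six[of n] by (simp flip: power_mult) (simp add: u_def)
  qed
qed

text \<open>For a partial sum \<open>F\<close> of the \<open>v n\<close>, the diagonal of
  \<open>F\<^sup>\<star> * F\<close> is a projection and the rest has norm at most 4; boundedness of
  \<open>F\<close> gives convergence by Dirichlet's test. For the last claim, the adjoint of the
  first series times the second is the cubic series up to a factor \<open>1 + G\<close> with
  \<open>norm G < 1\<close>, and up to finitely many terms from \<open>J\<close>.\<close>

lemma weighted_isometries:
  fixes v :: "nat \<Rightarrow> 'a" and \<gamma> :: "nat \<Rightarrow> real"
  assumes v0: "\<And>n. n < s \<Longrightarrow> v n = 0"
    and vv: "\<And>n. s \<le> n \<Longrightarrow> (v n)\<^sup>\<star> * v n = step n" "\<And>n. s \<le> n \<Longrightarrow> v n * step n = v n"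
    and orth: "\<And>m n. m \<noteq> n \<Longrightarrow> norm ((v m)\<^sup>\<star> * v n) \<le> (1/8) ^ m * (1/8) ^ n"
    and \<gamma>: "decseq \<gamma>" "\<gamma> \<longlonglongrightarrow> 0" "\<And>n. 0 < \<gamma> n" "\<And>n. (1/2) ^ n \<le> \<gamma> n"
  shows "summable (\<lambda>n. \<gamma> n *\<^sub>R v n)" "summable (\<lambda>n. (\<gamma> n)\<^sup>2 *\<^sub>R v n)"
    and "is_ideal J \<Longrightarrow> (\<And>n. p n \<in> J) \<Longrightarrow> 4 * \<gamma> 0 * (1/2) ^ s < 1 \<Longrightarrow> (\<Sum>n. (\<gamma> n)\<^sup>2 *\<^sub>R v n) \<in> J \<Longrightarrow>
      (\<Sum>n. \<gamma> n ^ 3 *\<^sub>R step n) \<in> J"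
proof -
  define w where "w n = (v n)\<^sup>\<star> * v n" for n
  have w: "w n = (if n < s then 0 else step n)" for n using v0 vv by (auto simp: w_def)
  have wsum: "(\<Sum>i<n. w i) = p (max n s) - p s" for n
  proof (induction n)
    case (Suc n)
    then show ?case by (cases "n < s") (auto simp: w step_def max_def)
  qed simp
  have wle: "norm (\<Sum>i<n. w i) \<le> 1" for n
    unfolding wsum by (intro norm_projection_le projection_diff) simp
  have geo: "(\<Sum>i<n. (1/8::real) ^ i) \<le> 2" for n
  proof -
    have "(\<Sum>i<n. (1/8::real) ^ i) \<le> (\<Sum>i<n. (1/2) ^ i)" by (intro sum_mono power_mono) auto
    also have "\<dots> \<le> (\<Sum>i. (1/2::real) ^ i)" by (rule sum_le_suminf[OF geometric_half(2)]) auto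
    finally show ?thesis by (simp only: geometric_half(1))
  qed
  have bound: "norm (\<Sum>i<n. v i) \<le> 3" for n
  proof -
    define F where "F = (\<Sum>i<n. v i)"
    define o' where "o' i j = (if i = j then 0 else (v i)\<^sup>\<star> * v j)" for i j
    have "F\<^sup>\<star> * F = (\<Sum>i<n. \<Sum>j<n. (v i)\<^sup>\<star> * v j)"
      by (simp add: F_def star_sum sum_product)
    also have "\<dots> = (\<Sum>i<n. \<Sum>j<n. (if i = j then w i else 0) + o' i j)"
      by (intro sum.cong) (auto simp: w_def o'_def)
    also have "\<dots> = (\<Sum>i<n. w i) + (\<Sum>i<n. \<Sum>j<n. o' i j)"
      by (simp add: sum.distrib)
    finally have "(norm F)\<^sup>2 \<le> norm (\<Sum>i<n. w i) + norm (\<Sum>i<n. \<Sum>j<n. o' i j)"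
      unfolding cstar_identity[symmetric] by (simp only: norm_triangle_ineq)
    also have "norm (\<Sum>i<n. \<Sum>j<n. o' i j) \<le> (\<Sum>i<n. \<Sum>j<n. (1/8) ^ i * (1/8) ^ j)"
      by (intro order_trans[OF norm_sum] sum_mono) (auto simp: o'_def intro: orth)
    also have "\<dots> = (\<Sum>i<n. (1/8) ^ i) * (\<Sum>j<n. (1/8) ^ j)" by (simp add: sum_product)
    also have "\<dots> \<le> 2 * 2" by (intro mult_mono geo sum_nonneg) auto
    finally have "(norm F)\<^sup>2 \<le> 3\<^sup>2" using wle[of n] by simp
    then show ?thesis unfolding F_def by (rule power2_le_imp_le) simp
  qed
  have \<gamma>pow: "decseq (\<lambda>n. \<gamma> n ^ Suc k)" "(\<lambda>n. \<gamma> n ^ Suc k) \<longlonglongrightarrow> 0" for k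
    using \<gamma>(1) less_imp_le[OF \<gamma>(3)] tendsto_power[OF \<gamma>(2), of "Suc k"] by (auto simp: decseq_def intro!: power_mono mult_mono)
  show s1: "summable (\<lambda>n. \<gamma> n *\<^sub>R v n)" by (rule dirichlet_summable[OF \<gamma>(1,2) bound])
  show s2: "summable (\<lambda>n. (\<gamma> n)\<^sup>2 *\<^sub>R v n)"
    using dirichlet_summable[OF \<gamma>pow[of 1] bound] by (simp add: numeral_2_eq_2)
  have s3: "summable (\<lambda>n. \<gamma> n ^ 3 *\<^sub>R w n)"
    using dirichlet_summable[OF \<gamma>pow[of 2] wle] by (simp add: numeral_3_eq_3)
  have s3': "summable (\<lambda>n. \<gamma> n ^ 3 *\<^sub>R step n)"
    using summable_step[OF \<gamma>pow[of 2]] by (simp add: numeral_3_eq_3)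
  assume J: "is_ideal J" and pJ: "\<And>n. p n \<in> J" and small: "4 * \<gamma> 0 * (1/2) ^ s < 1"
    and V2J: "(\<Sum>n. (\<gamma> n)\<^sup>2 *\<^sub>R v n) \<in> J"
  define U where "U = (\<Sum>n. \<gamma> n *\<^sub>R v n)"
  \<comment> \<open>The off-diagonal terms \<open>m \<noteq> n\<close> of the product.\<close>
  define err where "err n = U\<^sup>\<star> * v n - \<gamma> n *\<^sub>R w n" for n
  have sst: "summable (\<lambda>m. (\<gamma> m *\<^sub>R v m)\<^sup>\<star>)" by (rule bounded_linear.summable[OF bounded_linear_star s1])
  have Uv: "U\<^sup>\<star> * v n = (\<Sum>m. \<gamma> m *\<^sub>R ((v m)\<^sup>\<star> * v n))"
    "summable (\<lambda>m. \<gamma> m *\<^sub>R ((v m)\<^sup>\<star> * v n))" for n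
    using suminf_mult_right[OF sst, of "v n"] summable_mult2[OF sst, of "v n"]
    unfolding U_def suminf_star[OF s1] by (simp_all add: star_scaleR)
  have err_le: "norm (err n) \<le> 2 * \<gamma> 0 * (1/8) ^ n" for n
  proof -
    define c where "c m = (if m = n then 0 else \<gamma> m *\<^sub>R ((v m)\<^sup>\<star> * v n))" for m
    have c: "norm (c m) \<le> (\<gamma> 0 * (1/8) ^ n) * (1/2) ^ m" for m
    proof (cases "m = n")
      case False
      have "norm (c m) \<le> \<gamma> 0 * ((1/8) ^ m * (1/8) ^ n)"
        using \<gamma>(3)[of m] decseqD[OF \<gamma>(1), of 0 m] orth[OF False] False
        by (simp add: c_def del: power_divide) (intro mult_mono; simp)
      also have "\<dots> \<le> \<gamma> 0 * ((1/2) ^ m * (1/8) ^ n)"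
        using \<gamma>(3)[of 0] by (intro mult_left_mono mult_right_mono power_mono) auto
      finally show ?thesis by (simp add: mult_ac)
    qed (use \<gamma>(3)[of 0] in \<open>simp add: c_def\<close>)
    have "(\<Sum>m. \<gamma> m *\<^sub>R ((v m)\<^sup>\<star> * v n)) - suminf c = (\<Sum>m. \<gamma> m *\<^sub>R ((v m)\<^sup>\<star> * v n) - c m)"
      by (rule suminf_diff[OF Uv(2) summable_norm_half(1)[OF c]])
    also have "\<dots> = \<gamma> n *\<^sub>R w n" by (subst suminf_single[of n]) (auto simp: c_def w_def)
    finally have "err n = suminf c" unfolding err_def Uv(1) by (simp only: diff_eq_eq add.commute)
    then show ?thesis using summable_norm_half(2)[OF c] by simp
  qed
  have err0: "err n = 0" if "n < s" for n using that by (simp add: err_def v0 w)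
  have err_step: "err n * step n = err n" for n
  proof (cases "n < s")
    case False
    then show ?thesis by (simp add: err_def w left_diff_distrib mult.assoc vv(2) step_mult)
  qed (simp add: err0)
  define G where "G = (\<Sum>n. inverse (\<gamma> n) *\<^sub>R err n)"
  \<comment> \<open>Dividing by \<open>\<gamma> n\<close> costs \<open>2 ^ n\<close>, which leaves
    \<open>(1/4) ^ n\<close> of \<open>(1/8) ^ n\<close>. One factor \<open>(1/2) ^ n\<close> is
    kept for summation, the other is at most \<open>(1/2) ^ s\<close> because \<open>err\<close>
    vanishes before \<open>s\<close>.\<close>
  have G: "norm (inverse (\<gamma> n) *\<^sub>R err n) \<le> (2 * \<gamma> 0 * (1/2) ^ s) * (1/2) ^ n" for n
  proof (cases "n < s")
    case False
    have "inverse (\<gamma> n) \<le> 2 ^ n"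
      using le_imp_inverse_le[OF \<gamma>(4)[of n]] by (simp add: power_divide)
    then have "norm (inverse (\<gamma> n) *\<^sub>R err n) \<le> 2 ^ n * (2 * \<gamma> 0 * (1/8) ^ n)"
      using \<gamma>(3)[of n] err_le[of n] by (simp add: mult_mono')
    also have "\<dots> = 2 * \<gamma> 0 * ((1/2) ^ n * (1/2) ^ n)"
    proof -
      have "(2::real) ^ n * (1/8) ^ n = (1/2) ^ n * (1/2) ^ n" by (simp flip: power_mult_distrib)
      then show ?thesis by (simp only: mult_ac)
    qed
    also have "\<dots> \<le> 2 * \<gamma> 0 * ((1/2) ^ s * (1/2) ^ n)"
      using False \<gamma>(3)[of 0] by (intro mult_left_mono mult_right_mono power_decreasing) auto
    finally show ?thesis by (simp only: mult_ac)
  qed (use \<gamma>(3)[of 0] in \<open>simp add: err0\<close>)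
  have nG: "norm (- G) < 1" using summable_norm_half(2)[OF G] small by (simp add: G_def)
  have Gw: "G * w n = inverse (\<gamma> n) *\<^sub>R err n" for n
  proof (cases "n < s")
    case False
    have "G * step n = (\<Sum>m. inverse (\<gamma> m) *\<^sub>R err m * step n)"
      unfolding G_def by (rule suminf_mult_right[OF summable_norm_half(1)[OF G]])
    also have "\<dots> = inverse (\<gamma> n) *\<^sub>R err n * step n"
    proof (rule suminf_single)
      fix m assume "m \<noteq> n"
      then have "err m * step n = 0" by (subst err_step[symmetric]) (simp add: mult.assoc step_mult)
      then show "inverse (\<gamma> m) *\<^sub>R err m * step n = 0" by simp
    qed
    finally show ?thesis using False by (simp add: w err_step)
  qed (simp add: w err0)
  define D where "D = (\<Sum>n. \<gamma> n ^ 3 *\<^sub>R w n)"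
  have GD: "G * D = (\<Sum>n. G * (\<gamma> n ^ 3 *\<^sub>R w n))" "summable (\<lambda>n. G * (\<gamma> n ^ 3 *\<^sub>R w n))"
    unfolding D_def by (rule suminf_mult_left[OF s3], rule summable_mult[OF s3])
  have "D + G * D = (\<Sum>n. \<gamma> n ^ 3 *\<^sub>R w n + G * (\<gamma> n ^ 3 *\<^sub>R w n))"
    unfolding GD(1) unfolding D_def by (rule suminf_add[OF s3 GD(2)])
  also have "\<dots> = (\<Sum>n. U\<^sup>\<star> * ((\<gamma> n)\<^sup>2 *\<^sub>R v n))"
  proof (rule suminf_cong)
    fix n
    have "\<gamma> n ^ 3 * inverse (\<gamma> n) = (\<gamma> n)\<^sup>2" using \<gamma>(3)[of n] by (simp add: power3_eq_cube power2_eq_square)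
    then have "\<gamma> n ^ 3 *\<^sub>R w n + G * (\<gamma> n ^ 3 *\<^sub>R w n) = \<gamma> n ^ 3 *\<^sub>R w n + (\<gamma> n)\<^sup>2 *\<^sub>R err n"
      by (simp add: Gw)
    also have "\<dots> = U\<^sup>\<star> * ((\<gamma> n)\<^sup>2 *\<^sub>R v n)"
      by (simp add: err_def scaleR_diff_right power3_eq_cube power2_eq_square)
    finally show "\<gamma> n ^ 3 *\<^sub>R w n + G * (\<gamma> n ^ 3 *\<^sub>R w n) = U\<^sup>\<star> * ((\<gamma> n)\<^sup>2 *\<^sub>R v n)" .
  qed
  also have "\<dots> = U\<^sup>\<star> * (\<Sum>n. (\<gamma> n)\<^sup>2 *\<^sub>R v n)" by (rule suminf_mult_left[OF s2, symmetric])
  finally have "D - (- G) * D \<in> J" using ideal_left[OF J V2J] by simp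
  then have DJ: "D \<in> J" by (rule ideal_cancel[OF J nG])
  have "(\<Sum>n. \<gamma> n ^ 3 *\<^sub>R step n) - D = (\<Sum>n. \<gamma> n ^ 3 *\<^sub>R step n - \<gamma> n ^ 3 *\<^sub>R w n)"
    unfolding D_def by (rule suminf_diff[OF s3' s3])
  also have "\<dots> = (\<Sum>n<s. \<gamma> n ^ 3 *\<^sub>R step n - \<gamma> n ^ 3 *\<^sub>R w n)"
    by (rule suminf_finite) (auto simp: w)
  also have "\<dots> = (\<Sum>n<s. \<gamma> n ^ 3 *\<^sub>R step n)" by (simp add: w)
  also have "\<dots> \<in> J" unfolding step_def by (intro ideal_sum[OF J] ideal_scaleR[OF J] ideal_diff[OF J] pJ)
  finally show "(\<Sum>n. \<gamma> n ^ 3 *\<^sub>R step n) \<in> J" using ideal_add[OF J _ DJ] by fastforce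
qed

text \<open>\<open>v\<close> moves \<open>step n\<close> partly into the block \<open>E\<close>, where it almost avoids the supports of
  the \<open>M * b i\<close>, and partly under \<open>P\<close>, where it is almost orthogonal to the earlier \<open>V j\<close>.\<close>

definition transport ::
    "'a \<Rightarrow> 'a \<Rightarrow> 'a \<Rightarrow> (nat \<Rightarrow> 'a) \<Rightarrow> nat \<Rightarrow> nat \<Rightarrow> nat \<Rightarrow> (nat \<Rightarrow> 'a) \<Rightarrow> real \<Rightarrow> 'a \<Rightarrow> 'a \<Rightarrow> bool" where
  "transport P M E b m s n V \<delta> v k \<longleftrightarrow>
     v\<^sup>\<star> * v = step n \<and> v * step n = v \<and> (P + E) * v = v \<and> k \<in> corner E \<and> norm k \<le> 1 \<and> k * (E * v) = E * v \<and>
     (\<forall>i<m. norm (M * b i * k) \<le> \<delta>) \<and> (\<forall>j. s \<le> j \<longrightarrow> j < n \<longrightarrow> norm ((V j)\<^sup>\<star> * (P * v)) \<le> \<delta>)"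

text \<open>\<open>N\<close> precedes \<open>b\<close> and \<open>m\<close> in the quantifiers
  because \<open>x\<close> is built from \<open>N\<close> before the \<open>b i\<close> exist.
  \<open>V\<close> is arbitrary so that the earlier choices of a recursion can be inserted.\<close>

definition transports :: "nat \<Rightarrow> (nat \<Rightarrow> nat) \<Rightarrow> bool" where
  "transports N0 N \<longleftrightarrow> strict_mono N \<and> N0 \<le> N 0 \<and>
     (\<forall>b m. \<exists>n0. \<forall>s\<ge>n0. \<forall>n\<ge>s. \<forall>V \<delta>. (\<forall>j. s \<le> j \<longrightarrow> j < n \<longrightarrow> V j * step j = V j) \<longrightarrow> 0 < \<delta> \<longrightarrow>
       (\<exists>v k. transport (p N0) (p (N n)) (p (N (Suc n)) - p (N n)) b m s n V \<delta> v k))"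

text \<open>A recursion along the naturals: \<open>transport\<close> inspects \<open>V\<close> only
  below \<open>n\<close>, so \<open>V\<close> can be the sequence under construction. The tolerance
  \<open>(1/64) ^ n\<close> is \<open>(1/8) ^ n * (1/8) ^ n\<close>, enough for orthogonality
  against any earlier index.\<close>

lemma transport_sequence:
  assumes t: "transports N0 N"
  obtains n0 where "\<forall>s\<ge>n0. \<exists>v k. (\<forall>n<s. v n = 0 \<and> k n = 0) \<and>
    (\<forall>n\<ge>s. transport (p N0) (p (N n)) (p (N (Suc n)) - p (N n)) b m s n v ((1/64) ^ n) (v n) (k n))"
proof -
  obtain n0 where n0: "\<forall>s\<ge>n0. \<forall>n\<ge>s. \<forall>V \<delta>. (\<forall>j. s \<le> j \<longrightarrow> j < n \<longrightarrow> V j * step j = V j) \<longrightarrow> 0 < \<delta> \<longrightarrow>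
       (\<exists>v k. transport (p N0) (p (N n)) (p (N (Suc n)) - p (N n)) b m s n V \<delta> v k)"
    using t unfolding transports_def by blast
  have "\<exists>v k. (\<forall>n<s. v n = 0 \<and> k n = 0) \<and>
    (\<forall>n\<ge>s. transport (p N0) (p (N n)) (p (N (Suc n)) - p (N n)) b m s n v ((1/64) ^ n) (v n) (k n))"
    if s: "n0 \<le> s" for s
  proof -
    define T where "T f n r \<longleftrightarrow> (if n < s then r = (0, 0) else
      transport (p N0) (p (N n)) (p (N (Suc n)) - p (N n)) b m s n (\<lambda>j. fst (f j)) ((1/64) ^ n) (fst r) (snd r))"
      for f :: "nat \<Rightarrow> 'a \<times> 'a" and n r
    have "\<exists>f. \<forall>n. T f n (f n)"
    proof (rule dependent_wellorder_choice)
      fix r and f g :: "nat \<Rightarrow> 'a \<times> 'a" and n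
      assume "\<And>y. y < n \<Longrightarrow> f y = g y"
      then show "T f n r = T g n r" unfolding T_def transport_def by simp
    next
      fix n and f :: "nat \<Rightarrow> 'a \<times> 'a"
      assume IH: "\<And>y. y < n \<Longrightarrow> T f y (f y)"
      show "\<exists>r. T f n r"
      proof (cases "n < s")
        case False
        have "\<forall>j. s \<le> j \<longrightarrow> j < n \<longrightarrow> fst (f j) * step j = fst (f j)"
          using IH unfolding T_def transport_def by auto
        moreover have "0 < (1/64::real) ^ n" by simp
        ultimately have "\<exists>v k. transport (p N0) (p (N n)) (p (N (Suc n)) - p (N n)) b m s n (\<lambda>j. fst (f j)) ((1/64) ^ n) v k"
          using n0[rule_format, OF s, of n "\<lambda>j. fst (f j)" "(1/64) ^ n"] False by simp
        then show ?thesis using False by (auto simp: T_def)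
      qed (auto simp: T_def)
    qed
    then obtain f where f: "\<forall>n. T f n (f n)" by blast
    have "fst (f n) = 0 \<and> snd (f n) = 0" if "n < s" for n
      using f that unfolding T_def by (metis fst_conv snd_conv)
    moreover have "transport (p N0) (p (N n)) (p (N (Suc n)) - p (N n)) b m s n (\<lambda>n. fst (f n)) ((1/64) ^ n) (fst (f n)) (snd (f n))"
      if "n \<ge> s" for n using f that unfolding T_def by (simp add: not_less)
    ultimately show ?thesis
      by (intro exI[of _ "\<lambda>n. fst (f n)"] exI[of _ "\<lambda>n. snd (f n)"]) simp
  qed
  then show thesis using that by blast
qed

end

lemma power_half_small: "0 \<le> c \<Longrightarrow> \<exists>n0. \<forall>n\<ge>n0. c * (1/2) ^ n < (1::real)"
proof -
  have "(\<lambda>n. c * (1/2::real) ^ n) \<longlonglongrightarrow> c * 0" by (intro tendsto_intros LIMSEQ_power_zero) simp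
  then have "\<forall>\<^sub>F n in sequentially. c * (1/2) ^ n < 1" by (rule order_tendstoD) simp
  then show ?thesis by (simp add: eventually_sequentially)
qed

section \<open>The contradiction from a maximal ideal, given transports\<close>

context nested_projection_unit
begin

theorem no_maximal_ideal_with_transports:
  assumes p0: "p 0 = 0" and J: "maximal_ideal J" and pJ: "\<And>n. p n \<in> J"
    and T: "\<And>\<phi>. \<exists>N0 N. transports N0 N \<and> (\<forall>n. \<phi> n \<le> N n)"
  shows False
proof -
  have iJ: "is_ideal J" using J by (simp add: maximal_ideal_def proper_ideal_def)
  obtain a where a: "a \<notin> J" using J unfolding maximal_ideal_def proper_ideal_def by blast
  obtain \<gamma> where "decseq \<gamma> \<and> \<gamma> \<longlonglongrightarrow> 0 \<and> (\<forall>n. 0 < \<gamma> n) \<and> (\<forall>n. (1/2) ^ n \<le> \<gamma> n) \<and>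
    (\<forall>n. norm (a - p n * a) \<le> (\<gamma> n ^ 3)\<^sup>2)"
    using slow_weights[of a] by blast
  then have \<gamma>: "decseq \<gamma>" "\<gamma> \<longlonglongrightarrow> 0" "\<And>n. 0 < \<gamma> n" "\<And>n. (1/2) ^ n \<le> \<gamma> n"
    "\<And>n. norm (a - p n * a) \<le> (\<gamma> n ^ 3)\<^sup>2"
    by (simp_all only: simp_thms)
  have D: "(\<Sum>n. \<gamma> n ^ 3 *\<^sub>R step n) \<notin> J"
  proof
    assume DJ: "(\<Sum>n. \<gamma> n ^ 3 *\<^sub>R step n) \<in> J"
    have "decseq (\<lambda>n. \<gamma> n ^ 3)" "(\<lambda>n. \<gamma> n ^ 3) \<longlonglongrightarrow> 0"
      using \<gamma>(1) less_imp_le[OF \<gamma>(3)] tendsto_power[OF \<gamma>(2), of 3] by (auto simp: decseq_def intro!: power_mono)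
    then obtain a' where "a = p 0 * a + (\<Sum>n. \<gamma> n ^ 3 *\<^sub>R step n) * a'"
      by (rule factor_through_weights[of _ a]) (use \<gamma> in auto)
    then show False using a ideal_right[OF iJ DJ, of a'] p0 by simp
  qed
  \<comment> \<open>\<open>32768\<close> is the cube of 32, so these are the weights of
    \<open>x * x * x\<close>. They decay fast, and \<open>\<phi>\<close> asks the blocks to be so
    long that the tails of \<open>a\<close> decay even faster.\<close>
  define r where "r n = (1/32768::real) ^ n" for n
  have "\<exists>\<phi>. \<forall>n. \<forall>l\<ge>\<phi> n. norm (a - p l * a) \<le> (r n)\<^sup>2"
  proof (rule choice, rule allI)
    fix n
    have "(\<lambda>l. norm (a - p l * a)) \<longlonglongrightarrow> 0"
      using tendsto_norm_zero[OF tendsto_diff[OF tendsto_const left_unit, of a a, simplified]] by simp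
    then have "\<forall>\<^sub>F l in sequentially. norm (a - p l * a) < (r n)\<^sup>2"
      by (rule order_tendstoD) (simp add: r_def)
    then show "\<exists>l0. \<forall>l\<ge>l0. norm (a - p l * a) \<le> (r n)\<^sup>2"
      unfolding eventually_sequentially using less_imp_le by blast
  qed
  then obtain \<phi> where \<phi>: "\<forall>n. \<forall>l\<ge>\<phi> n. norm (a - p l * a) \<le> (r n)\<^sup>2" by blast
  obtain N0 N where N: "transports N0 N" "\<forall>n. \<phi> n \<le> N n" using T[of \<phi>] by blast
  have mono: "strict_mono N" and N0: "N0 \<le> N 0" using N(1) by (auto simp: transports_def)
  interpret sub: nested_projection_unit "\<lambda>n. p (N n)" by (rule subseq_nested[OF mono])
  define E where "E = sub.step"
  have E: "p (N (Suc n)) - p (N n) = E n" for n by (simp add: E_def sub.step_def)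
  have EE: "E i * E l = (if i = l then E l else 0)" for i l unfolding E_def by (rule sub.step_mult)
  have E1: "norm (E n) \<le> 1" for n unfolding E_def by (intro norm_projection_le sub.projection_step)
  define P where "P = p N0"
  have PP: "P\<^sup>\<star> = P" "P * P = P" using proj[of N0] by (auto simp: P_def projection_def)
  have Es: "(E n)\<^sup>\<star> = E n" for n using sub.projection_step[of n] by (simp add: E_def projection_def)
  have PE: "P * E n = 0" "E n * P = 0" for n
  proof -
    have "N0 \<le> N n" "N0 \<le> N (Suc n)" using N0 mono
      by (meson le0 order_trans strict_mono_less_eq)+
    then show "P * E n = 0" "E n * P = 0" by (simp_all add: E[symmetric] P_def algebra_simps nested)
  qed
  have geo: "decseq (\<lambda>n. c ^ n)" "(\<lambda>n. c ^ n) \<longlonglongrightarrow> 0" if "0 \<le> c" "c < 1" for c :: real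
    using that by (auto intro!: decseq_SucI LIMSEQ_power_zero simp: mult_left_le_one_le)
  define x where "x = (\<Sum>n. (1/32) ^ n *\<^sub>R E n)"
  have sx: "summable (\<lambda>n. (1/32) ^ n *\<^sub>R E n)" "summable (\<lambda>n. ((1/32) ^ n * (1/32) ^ n) *\<^sub>R E n)"
    unfolding E_def power_mult_distrib[symmetric] by (intro sub.summable_step geo; simp)+
  have xxx: "x * x * x = (\<Sum>n. r n *\<^sub>R E n)"
  proof -
    have "x * x = (\<Sum>n. ((1/32) ^ n * (1/32) ^ n) *\<^sub>R E n)"
      using sub.suminf_step_mult_suminf[of "\<lambda>n. (1/32) ^ n" "\<lambda>n. (1/32) ^ n"] sx by (simp add: x_def E_def)
    then have "x * x * x = (\<Sum>n. ((1/32) ^ n * (1/32) ^ n * (1/32) ^ n) *\<^sub>R E n)"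
      using sub.suminf_step_mult_suminf[of "\<lambda>n. (1/32) ^ n * (1/32) ^ n" "\<lambda>n. (1/32) ^ n"] sx
      by (simp add: x_def E_def)
    also have "(\<lambda>n. (1/32) ^ n * (1/32) ^ n * (1/32) ^ n) = r"
      by (auto simp: r_def fun_eq_iff simp flip: power_mult_distrib)
    then have "(\<lambda>n. ((1/32) ^ n * (1/32) ^ n * (1/32) ^ n) *\<^sub>R E n) = (\<lambda>n. r n *\<^sub>R E n)"
      by (simp add: fun_eq_iff)
    finally show ?thesis .
  qed
  have x3: "x * x * x \<notin> J"
  proof
    assume xJ: "x * x * x \<in> J"
    have r: "decseq r" "r \<longlonglongrightarrow> 0" "\<And>n. 0 < r n" unfolding r_def by (intro geo; simp)+ simp
    have "norm (a - p (N n) * a) \<le> (r n)\<^sup>2" for n using \<phi> N(2) by blast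
    from sub.factor_through_weights[OF r this]
    obtain a' where "a = p (N 0) * a + (x * x * x) * a'" unfolding xxx E_def by blast
    then show False
      using a ideal_add[OF iJ ideal_right[OF iJ pJ, of "N 0" a] ideal_right[OF iJ xJ, of a']] by simp
  qed
  define y where "y = (\<Sum>n. \<gamma> n *\<^sub>R E n)"
  have sy: "summable (\<lambda>n. \<gamma> n *\<^sub>R E n)" unfolding E_def by (rule sub.summable_step[OF \<gamma>(1,2)])
  have yE: "y * E n = \<gamma> n *\<^sub>R E n" for n
    using sub.suminf_step_mult(1)[of \<gamma> n] sy by (simp add: y_def E_def)
  obtain j m c b where j: "j \<in> J" "y = j + (\<Sum>i<m::nat. c i * x * b i)"
    by (rule maximal_ideal_decomposition[OF J x3, of y]) blast
  define B where "B = (\<Sum>i<m. c i * x * b i)"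
  define C where "C = (\<Sum>i<m. norm (c i) * (2 + 2 * norm (b i)))"
  have C0: "0 \<le> C" unfolding C_def by (intro sum_nonneg mult_nonneg_nonneg) auto
  obtain n0 where n0: "\<forall>s\<ge>n0. \<exists>v k. (\<forall>n<s. v n = 0 \<and> k n = 0) \<and>
    (\<forall>n\<ge>s. transport (p N0) (p (N n)) (p (N (Suc n)) - p (N n)) b m s n v ((1/64) ^ n) (v n) (k n))"
    by (rule transport_sequence[OF N(1), of b m]) blast
  obtain n1 where n1: "\<forall>n\<ge>n1. 4 * \<gamma> 0 * (1/2) ^ n < 1"
    using power_half_small[of "4 * \<gamma> 0"] \<gamma>(3)[of 0] by auto
  obtain n2 where n2: "\<forall>n\<ge>n2. (2 * C) * (1/2) ^ n < 1"
    using power_half_small[of "2 * C"] C0 by auto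
  \<comment> \<open>Starting late secures the transports (\<open>n0\<close>), the smallness required
    by \<open>weighted_isometries\<close> (\<open>n1\<close>) and \<open>norm G < 1\<close>
    (\<open>n2\<close>).\<close>
  define s where "s = max n0 (max n1 n2)"
  have sn: "n0 \<le> s" "n1 \<le> s" "n2 \<le> s" by (auto simp: s_def le_max_iff_disj)
  obtain v k where vk0: "\<forall>n<s. v n = 0 \<and> k n = 0" and
    vk: "\<forall>n\<ge>s. transport P (p (N n)) (E n) b m s n v ((1/64) ^ n) (v n) (k n)"
    using n0[rule_format, OF sn(1)] unfolding E P_def by auto
  have v0: "v n = 0" if "n < s" for n using vk0 that by simp
  have k0: "k n = 0" if "n < s" for n using vk0 that by simp
  have vv: "(v n)\<^sup>\<star> * v n = step n" "v n * step n = v n" and PEv: "(P + E n) * v n = v n"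
    and kE: "k n * E n = k n" and k1: "norm (k n) \<le> 1" and kv: "k n * (E n * v n) = E n * v n"
    and bk: "\<And>i. i < m \<Longrightarrow> norm (p (N n) * b i * k n) \<le> (1/64) ^ n"
    and Vv: "\<And>l. s \<le> l \<Longrightarrow> l < n \<Longrightarrow> norm ((v l)\<^sup>\<star> * (P * v n)) \<le> (1/64) ^ n"
    if "s \<le> n" for n
    using vk that unfolding transport_def corner_def by auto
  have orth1: "norm ((v l)\<^sup>\<star> * v n) \<le> (1/8) ^ l * (1/8) ^ n" if ln: "l < n" for l n
  proof (cases "l < s")
    case False
    then have sl: "s \<le> l" "s \<le> n" using ln by auto
    have "(v l)\<^sup>\<star> * (P + E l) = (v l)\<^sup>\<star>"
      using arg_cong[OF PEv[OF sl(1)], of star] by (simp add: star_mult star_add PP Es)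
    then have "(v l)\<^sup>\<star> * E n = (v l)\<^sup>\<star> * ((P + E l) * E n)" by (simp flip: mult.assoc)
    also have "\<dots> = 0" using ln by (simp add: distrib_right PE EE)
    finally have z: "(v l)\<^sup>\<star> * (E n * v n) = 0" by (simp flip: mult.assoc)
    have "(v l)\<^sup>\<star> * v n = (v l)\<^sup>\<star> * ((P + E n) * v n)" using PEv[OF sl(2)] by simp
    also have "\<dots> = (v l)\<^sup>\<star> * (P * v n)" by (simp add: distrib_right distrib_left z)
    finally have "norm ((v l)\<^sup>\<star> * v n) \<le> (1/64) ^ n" using Vv[OF sl(2,1) ln] by simp
    also have "(1/64::real) ^ n = (1/8) ^ n * (1/8) ^ n" by (simp flip: power_mult_distrib)
    also have "\<dots> \<le> (1/8) ^ l * (1/8) ^ n" using ln by (intro mult_right_mono power_decreasing) auto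
    finally show ?thesis .
  qed (simp add: v0)
  have orth: "norm ((v l)\<^sup>\<star> * v n) \<le> (1/8) ^ l * (1/8) ^ n" if "l \<noteq> n" for l n
  proof (cases "l < n")
    case False
    then have "norm (((v n)\<^sup>\<star> * v l)\<^sup>\<star>) \<le> (1/8) ^ n * (1/8) ^ l"
      unfolding norm_star using that by (intro orth1) simp
    then show ?thesis by (simp add: star_mult star_star mult.commute)
  qed (rule orth1)
  have s1: "summable (\<lambda>n. \<gamma> n *\<^sub>R v n)"
    by (rule weighted_isometries(1)[of s v \<gamma>]) (assumption | rule v0 vv orth \<gamma>)+
  have s2: "summable (\<lambda>n. (\<gamma> n)\<^sup>2 *\<^sub>R v n)"
    by (rule weighted_isometries(2)[of s v \<gamma>]) (assumption | rule v0 vv orth \<gamma>)+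
  \<comment> \<open>The part of \<open>v n\<close> in the block \<open>E n\<close>; there
    \<open>y\<close> acts as the scalar \<open>\<gamma> n\<close>, and \<open>k n\<close> is a local
    unit that kills all other \<open>g l\<close>.\<close>
  define g where "g n = v n - P * v n" for n
  have g0: "g n = 0" if "n < s" for n using v0[OF that] by (simp add: g_def)
  have gE: "g n = E n * v n" if "s \<le> n" for n
    using PEv[OF that] by (simp add: g_def distrib_right algebra_simps)
  have yg: "y * g n = \<gamma> n *\<^sub>R g n" for n
    by (cases "n < s") (simp add: g0, simp add: gE not_less mult.assoc[symmetric] yE)
  have kg: "k l * g n = (if l = n then g n else 0)" for l n
  proof -
    consider "n < s" | "l < s" "s \<le> n" | "s \<le> l" "s \<le> n" by linarith
    then show ?thesis
    proof cases
      case 3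
      have "k l * g n = k l * E l * (E n * v n)" using 3 by (simp add: kE gE)
      also have "\<dots> = k l * ((E l * E n) * v n)" by (simp add: mult.assoc)
      also have "\<dots> = (if l = n then g n else 0)" using 3 by (simp add: EE kv gE)
      finally show ?thesis .
    qed (auto simp: g0 k0)
  qed
  have x2: "norm x \<le> 2"
  proof -
    have "norm ((1/32) ^ n *\<^sub>R E n) \<le> 1 * (1/2) ^ n" for n
    proof -
      have "(1/32::real) ^ n * norm (E n) \<le> (1/2) ^ n * 1"
        by (intro mult_mono power_mono E1) auto
      then show ?thesis by simp
    qed
    from summable_norm_half(2)[OF this] show ?thesis by (simp add: x_def)
  qed
  have xtail: "norm (x - x * p (N n)) \<le> 2 * (1/16) ^ n" for n
  proof -
    have sp: "summable (\<lambda>l. (1/32) ^ l *\<^sub>R E l * p (N n))" by (rule summable_mult2[OF sx(1)])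
    have eq: "x - x * p (N n) = (\<Sum>l. (1/32) ^ l *\<^sub>R E l - (1/32) ^ l *\<^sub>R E l * p (N n))"
      unfolding x_def suminf_mult_right[OF sx(1)] by (rule suminf_diff[OF sx(1) sp])
    have "norm ((1/32) ^ l *\<^sub>R E l - (1/32) ^ l *\<^sub>R E l * p (N n)) \<le> (1/16) ^ n * (1/2) ^ l" for l
    proof (cases "l < n")
      case True
      then have "N l \<le> N n" "N (Suc l) \<le> N n" using mono by (auto simp: strict_mono_less_eq)
      then have "E l * p (N n) = E l" by (simp add: E[symmetric] algebra_simps nested)
      then show ?thesis by simp
    next
      case False
      then have "N n \<le> N l" "N n \<le> N (Suc l)" using mono by (auto simp: strict_mono_less_eq)
      then have "E l * p (N n) = 0" by (simp add: E[symmetric] algebra_simps nested)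
      then have "norm ((1/32) ^ l *\<^sub>R E l - (1/32) ^ l *\<^sub>R E l * p (N n)) = (1/32) ^ l * norm (E l)" by simp
      also have "\<dots> \<le> (1/32) ^ l * 1" by (intro mult_left_mono E1) simp
      also have "\<dots> = (1/16) ^ l * (1/2) ^ l" by (simp flip: power_mult_distrib)
      also have "\<dots> \<le> (1/16) ^ n * (1/2) ^ l"
        using False by (intro mult_right_mono power_decreasing) auto
      finally show ?thesis .
    qed
    from summable_norm_half(2)[OF this] show ?thesis by (simp add: eq)
  qed
  have Bk: "norm (B * k n) \<le> C * (1/16) ^ n" if n: "s \<le> n" for n
  proof -
    have xbk: "norm (x * (b i * k n)) \<le> (2 + 2 * norm (b i)) * (1/16) ^ n" if i: "i < m" for i
    proof -
      have "x * (b i * k n) = x * (p (N n) * b i * k n) + (x - x * p (N n)) * (b i * k n)"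
        by (simp add: algebra_simps)
      also have "norm \<dots> \<le> norm x * norm (p (N n) * b i * k n) + norm (x - x * p (N n)) * norm (b i * k n)"
        by (intro norm_triangle_mono norm_mult_ineq)
      also have "\<dots> \<le> 2 * (1/16) ^ n + (2 * (1/16) ^ n) * norm (b i)"
      proof (intro add_mono mult_mono x2 xtail)
        have "(1/64::real) ^ n \<le> (1/16) ^ n" by (intro power_mono) auto
        then show "norm (p (N n) * b i * k n) \<le> (1/16) ^ n" using bk[OF n i] by linarith
        show "norm (b i * k n) \<le> norm (b i)"
          using norm_mult_ineq[of "b i" "k n"] mult_left_le[OF k1[OF n] norm_ge_zero[of "b i"]] by linarith
      qed auto
      finally show ?thesis by (simp add: algebra_simps)
    qed
    have "B * k n = (\<Sum>i<m. c i * (x * (b i * k n)))" by (simp add: B_def sum_distrib_right mult.assoc)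
    also have "norm \<dots> \<le> (\<Sum>i<m. norm (c i) * ((2 + 2 * norm (b i)) * (1/16) ^ n))"
      by (intro order_trans[OF norm_sum] sum_mono order_trans[OF norm_mult_ineq] mult_left_mono xbk) auto
    also have "\<dots> = C * (1/16) ^ n" by (simp add: C_def sum_distrib_right mult.assoc)
    finally show ?thesis .
  qed
  \<comment> \<open>Because the \<open>k n\<close> separate the \<open>g n\<close>, this one element
    satisfies \<open>G * ((\<gamma> n)\<^sup>2 *\<^sub>R g n) = B * (\<gamma> n *\<^sub>R g
    n)\<close> for every \<open>n\<close>, so \<open>(y - B) * W1\<close> becomes
    \<open>W2 - G * W2\<close>.\<close>
  define G where "G = (\<Sum>n. inverse (\<gamma> n) *\<^sub>R (B * k n))"
  have Gn: "norm (inverse (\<gamma> n) *\<^sub>R (B * k n)) \<le> (C * (1/2) ^ s) * (1/2) ^ n" for n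
  proof (cases "n < s")
    case False
    have "inverse (\<gamma> n) \<le> 2 ^ n" using le_imp_inverse_le[OF \<gamma>(4)[of n]] by (simp add: power_divide)
    then have "norm (inverse (\<gamma> n) *\<^sub>R (B * k n)) \<le> 2 ^ n * (C * (1/16) ^ n)"
      using \<gamma>(3)[of n] Bk[of n] False by (simp add: mult_mono')
    also have "\<dots> = C * (1/8) ^ n"
    proof -
      have "(2::real) ^ n * (1/16) ^ n = (1/8) ^ n" by (simp flip: power_mult_distrib)
      then show ?thesis by (simp only: mult_ac)
    qed
    also have "\<dots> \<le> C * ((1/2) ^ n * (1/2) ^ n)"
      unfolding power_mult_distrib[symmetric] by (intro mult_left_mono power_mono C0) auto
    also have "\<dots> \<le> C * ((1/2) ^ s * (1/2) ^ n)"
      using False by (intro mult_left_mono mult_right_mono power_decreasing C0) auto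
    finally show ?thesis by (simp only: mult_ac)
  qed (use C0 in \<open>simp add: k0\<close>)
  have "norm G \<le> 2 * (C * (1/2) ^ s)" unfolding G_def by (rule summable_norm_half(2)[OF Gn])
  then have G1: "norm G < 1" using n2[rule_format, OF sn(3)] by simp
  have Gg: "G * g n = inverse (\<gamma> n) *\<^sub>R (B * g n)" for n
  proof -
    have "G * g n = (\<Sum>l. inverse (\<gamma> l) *\<^sub>R (B * k l) * g n)"
      unfolding G_def by (rule suminf_mult_right[OF summable_norm_half(1)[OF Gn]])
    also have "\<dots> = inverse (\<gamma> n) *\<^sub>R (B * k n) * g n"
      by (rule suminf_single) (simp add: mult.assoc kg)
    finally show ?thesis by (simp add: mult.assoc kg)
  qed
  have gsum: "summable (\<lambda>n. w n *\<^sub>R g n)" "(\<Sum>n. w n *\<^sub>R v n) - P * (\<Sum>n. w n *\<^sub>R v n) = (\<Sum>n. w n *\<^sub>R g n)"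
    if w: "summable (\<lambda>n. w n *\<^sub>R v n)" for w :: "nat \<Rightarrow> real"
  proof -
    have eq: "w n *\<^sub>R g n = w n *\<^sub>R v n - P * (w n *\<^sub>R v n)" for n by (simp add: g_def scaleR_diff_right)
    have sP: "summable (\<lambda>n. P * (w n *\<^sub>R v n))" by (rule summable_mult[OF w])
    show "summable (\<lambda>n. w n *\<^sub>R g n)" unfolding eq by (rule summable_diff[OF w sP])
    show "(\<Sum>n. w n *\<^sub>R v n) - P * (\<Sum>n. w n *\<^sub>R v n) = (\<Sum>n. w n *\<^sub>R g n)"
      unfolding eq suminf_mult_left[OF w] by (rule suminf_diff[OF w sP])
  qed
  define W1 where "W1 = (\<Sum>n. \<gamma> n *\<^sub>R g n)"
  define W2 where "W2 = (\<Sum>n. (\<gamma> n)\<^sup>2 *\<^sub>R g n)"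
  have yW: "(y - B) * W1 = (\<Sum>n. (y - B) * (\<gamma> n *\<^sub>R g n))"
    unfolding W1_def by (rule suminf_mult_left[OF gsum(1)[OF s1]])
  have gs2: "summable (\<lambda>n. (\<gamma> n)\<^sup>2 *\<^sub>R g n)" by (rule gsum(1)[OF s2])
  have GW: "G * W2 = (\<Sum>n. G * ((\<gamma> n)\<^sup>2 *\<^sub>R g n))"
    unfolding W2_def by (rule suminf_mult_left[OF gs2])
  have GW': "summable (\<lambda>n. G * ((\<gamma> n)\<^sup>2 *\<^sub>R g n))" by (rule summable_mult[OF gs2])
  have "W2 - G * W2 = (\<Sum>n. (\<gamma> n)\<^sup>2 *\<^sub>R g n - G * ((\<gamma> n)\<^sup>2 *\<^sub>R g n))"
    unfolding GW unfolding W2_def by (rule suminf_diff[OF gs2 GW'])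
  also have "\<dots> = (y - B) * W1"
    unfolding yW
  proof (rule suminf_cong)
    fix n
    have "(\<gamma> n)\<^sup>2 * inverse (\<gamma> n) = \<gamma> n" using \<gamma>(3)[of n] by (simp add: power2_eq_square)
    then show "(\<gamma> n)\<^sup>2 *\<^sub>R g n - G * ((\<gamma> n)\<^sup>2 *\<^sub>R g n) = (y - B) * (\<gamma> n *\<^sub>R g n)"
      by (simp add: Gg left_diff_distrib yg scaleR_diff_right power2_eq_square)
  qed
  also have "\<dots> = j * W1" using j(2) by (simp add: B_def)
  also have "\<dots> \<in> J" by (rule ideal_right[OF iJ j(1)])
  finally have W2J: "W2 \<in> J" by (rule ideal_cancel[OF iJ G1])
  have "(\<Sum>n. (\<gamma> n)\<^sup>2 *\<^sub>R v n) - P * (\<Sum>n. (\<gamma> n)\<^sup>2 *\<^sub>R v n) = W2"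
    unfolding W2_def by (rule gsum(2)[OF s2])
  \<comment> \<open>The part under \<open>P\<close> is free of charge, as \<open>P\<close> lies in
    \<open>J\<close>.\<close>
  then have "(\<Sum>n. (\<gamma> n)\<^sup>2 *\<^sub>R v n) = W2 + P * (\<Sum>n. (\<gamma> n)\<^sup>2 *\<^sub>R v n)"
    by (simp only: diff_eq_eq)
  also have "\<dots> \<in> J" unfolding P_def by (rule ideal_add[OF iJ W2J ideal_right[OF iJ pJ]])
  finally have V2J: "(\<Sum>n. (\<gamma> n)\<^sup>2 *\<^sub>R v n) \<in> J" .
  have "(\<Sum>n. \<gamma> n ^ 3 *\<^sub>R step n) \<in> J"
    by (rule weighted_isometries(3)[of s v \<gamma>])
      (assumption | rule v0 vv orth \<gamma> iJ pJ V2J n1[rule_format, OF sn(2)])+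
  then show False using D by simp
qed

end

section \<open>Transports from comparison\<close>

context nested_projection_unit
begin

lemma qt_projection_diff:
  assumes t: "lsc_2quasitrace \<tau>" and le: "m \<le> n" shows "\<tau> (p n) = \<tau> (p m) + \<tau> (p n - p m)"
proof -
  have "p m * (p n - p m) = (p n - p m) * p m" using le by (simp add: algebra_simps nested)
  then have "\<tau> (p m + (p n - p m)) = \<tau> (p m) + \<tau> (p n - p m)"
    by (intro qt_add[OF t] projection_positive proj projection_diff le)
  then show ?thesis by simp
qed

lemma qt_p_mono: "lsc_2quasitrace \<tau> \<Longrightarrow> m \<le> n \<Longrightarrow> \<tau> (p m) \<le> \<tau> (p n)"
  using qt_projection_diff[of \<tau> m n] by simp

lemma qt_sum_step:
  assumes t: "lsc_2quasitrace \<tau>" shows "\<tau> (p s) + (\<Sum>j<n. \<tau> (step (s + j))) = \<tau> (p (s + n))"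
proof (induction n)
  case (Suc n)
  have "\<tau> (p (s + Suc n)) = \<tau> (p (s + n)) + \<tau> (step (s + n))"
    using qt_projection_diff[OF t, of "s + n" "s + Suc n"] by (simp add: step_def)
  then show ?case by (simp add: Suc.IH[symmetric] add.assoc)
qed simp

lemma orthogonal_corner_mult:
  assumes "P * E = 0" "x \<in> corner P" "y \<in> corner E" shows "x * y = 0"
proof -
  have "x * y = x * (P * E) * y" using assms(2,3) by (simp add: cornerD mult.assoc) (simp add: cornerD mult.assoc[symmetric])
  then show ?thesis by (simp add: assms(1))
qed

text \<open>An element \<open>c = c\<^sub>1 + c\<^sub>2\<close> with orthogonal summands dominates \<open>c\<^sub>1\<close> on some quasitraces
  and \<open>c\<^sub>2\<close> on the others, so a single application of comparison serves both families.\<close>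

lemma transport_exists:
  fixes V :: "nat \<Rightarrow> 'a" and \<rho> :: ennreal
  assumes T: "\<And>\<tau>. \<tau> \<in> T \<Longrightarrow> lsc_2quasitrace \<tau>"
    and compare: "\<And>c. c \<in> positives \<Longrightarrow> (\<And>\<tau>. \<tau> \<in> T \<Longrightarrow> \<tau> (step n) + \<rho> < dim_fun \<tau> c) \<Longrightarrow> step n \<precsim> c"
    and P: "projection P" and E: "projection E" and M: "projection M" and PE: "P * E = 0" "E * P = 0"
    and V: "\<And>j. s \<le> j \<Longrightarrow> j < n \<Longrightarrow> V j * step j = V j" and \<delta>: "0 < \<delta>"
    and large: "\<And>\<tau>. \<tau> \<in> T \<Longrightarrow>
      (\<exists>B > \<tau> (step n) + \<rho>. \<forall>X. \<tau> E \<le> X + of_nat m * \<tau> M \<longrightarrow> B \<le> X) \<or>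
      (\<exists>B > \<tau> (step n) + \<rho>. \<forall>X. \<tau> P \<le> X + (\<Sum>j<n - s. \<tau> (step (s + j))) \<longrightarrow> B \<le> X)"
  shows "\<exists>v k. transport P M E b m s n V \<delta> v k"
proof -
  have sq: "P * P = P" "P\<^sup>\<star> = P" "E * E = E" "M * M = M" using P E M by (auto simp: projection_def)
  \<comment> \<open>In the block \<open>E\<close>: almost annihilated by the \<open>M * b i\<close>,
    whose ranges lie under \<open>M\<close>, at the price of \<open>m\<close> times
    \<open>\<tau> M\<close>.\<close>
  obtain g1 k1 where g1: "sa E g1" "sa E k1" "k1 * g1 = g1" "g1 * k1 = g1" "norm g1 \<le> 1" "norm k1 \<le> 1"
    "\<And>i. i < m \<Longrightarrow> norm (M * b i * E * k1) \<le> \<delta>"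
    "\<And>\<tau> n. lsc_2quasitrace \<tau> \<Longrightarrow> \<tau> E \<le> \<tau> (fcalc (root (Suc n)) (g1 * g1)) + (\<Sum>i<m. \<tau> M)"
  proof (rule approximate_kernel[OF E \<delta>, of m "\<lambda>_. M" "\<lambda>i. M * b i * E"])
    show "projection M \<and> M * (M * b i * E) = M * b i * E \<and> M * b i * E * E = M * b i * E" for i
      using M sq by (simp add: mult.assoc) (simp add: sq mult.assoc[symmetric])
  qed blast
  have VP: "step j * ((V j)\<^sup>\<star> * P) = (V j)\<^sup>\<star> * P" if "s \<le> j" "j < n" for j
  proof -
    have "(step j)\<^sup>\<star> * (V j)\<^sup>\<star> = (V j)\<^sup>\<star>" using arg_cong[OF V[OF that], of star] by (simp add: star_mult)
    then show ?thesis using projection_step[of j] by (simp add: projection_def mult.assoc[symmetric])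
  qed
  \<comment> \<open>Under \<open>P\<close>: almost orthogonal to the earlier \<open>V j\<close>. The
    adjoint of \<open>V j\<close> has range under \<open>step j\<close>, so the price is the sum of
    the earlier steps.\<close>
  obtain g2 k2 where g2: "sa P g2" "sa P k2" "k2 * g2 = g2" "g2 * k2 = g2" "norm g2 \<le> 1" "norm k2 \<le> 1"
    "\<And>j. j < n - s \<Longrightarrow> norm ((V (s + j))\<^sup>\<star> * P * k2) \<le> \<delta>"
    "\<And>\<tau> l. lsc_2quasitrace \<tau> \<Longrightarrow>
       \<tau> P \<le> \<tau> (fcalc (root (Suc l)) (g2 * g2)) + (\<Sum>j<n - s. \<tau> (step (s + j)))"
  proof (rule approximate_kernel[OF P \<delta>, of "n - s" "\<lambda>j. step (s + j)" "\<lambda>j. (V (s + j))\<^sup>\<star> * P"])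
    show "projection (step (s + j)) \<and> step (s + j) * ((V (s + j))\<^sup>\<star> * P) = (V (s + j))\<^sup>\<star> * P \<and>
      (V (s + j))\<^sup>\<star> * P * P = (V (s + j))\<^sup>\<star> * P" if "j < n - s" for j
      using that VP[of "s + j"] by (simp add: projection_step mult.assoc sq)
  qed blast
  note cE = sa_corner[OF g1(1)] sa_corner[OF g1(2)] and cP = sa_corner[OF g2(1)] sa_corner[OF g2(2)]
  define c1 where "c1 = g1 * g1"
  define c2 where "c2 = g2 * g2"
  define g where "g = g1 + g2"
  have stars: "g1\<^sup>\<star> = g1" "g2\<^sup>\<star> = g2" using g1 g2 by (auto simp: sa_def)
  have oPE: "x * y = 0" "y * x = 0" if "x \<in> corner P" "y \<in> corner E" for x y
    using orthogonal_corner_mult[OF PE(1) that] orthogonal_corner_mult[OF PE(2) that(2,1)] by auto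
  have o: "g1 * g2 = 0" "g2 * g1 = 0" "k1 * g2 = 0" "k2 * g1 = 0"
    using oPE cE cP by auto
  have gg: "g * g = c1 + c2" by (simp add: g_def c1_def c2_def algebra_simps o)
  have gs: "g\<^sup>\<star> = g" by (simp add: g_def star_add stars)
  have c1: "c1 \<in> positives" "sa E c1" and c2: "c2 \<in> positives" "sa P c2"
    using positivesI[of g1] positivesI[of g2] nn_sa[OF nn_square[OF g1(1)]] nn_sa[OF nn_square[OF g2(1)]]
    by (auto simp: c1_def c2_def stars)
  have c: "c1 + c2 \<in> positives" using positivesI[of g] by (simp add: gs gg)
  have oc: "c1 * c2 = 0" "c2 * c1 = 0" using oPE sa_corner[OF c1(2)] sa_corner[OF c2(2)] by auto
  have nsq: "norm (u * u) \<le> 1" if "norm u \<le> 1" for u :: 'a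
    using norm_mult_ineq[of u u] mult_le_one[OF that _ that] by simp
  have nc: "norm (c1 + c2) \<le> 1"
    by (rule norm_orthogonal_add_le[OF positives_star[OF c1(1)] positives_star[OF c2(1)] oc])
      (auto simp: c1_def c2_def intro!: nsq g1 g2)
  have root_add: "\<tau> (fcalc (root (Suc l)) (c1 + c2)) = \<tau> (fcalc (root (Suc l)) c1) + \<tau> (fcalc (root (Suc l)) c2)"
    if t: "lsc_2quasitrace \<tau>" for \<tau> l
  proof -
    have cr: "cont (root (Suc l))" "root (Suc l) 0 = 0" by (auto intro!: continuous_intros)
    have "fcalc (root (Suc l)) c1 \<in> corner E" "fcalc (root (Suc l)) c2 \<in> corner P"
      unfolding fcalc_eq_fc[OF c1(2,1) cr] fcalc_eq_fc[OF c2(2,1) cr] by (intro fc_corner c1 c2 cr)+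
    then have "fcalc (root (Suc l)) c1 * fcalc (root (Suc l)) c2 = fcalc (root (Suc l)) c2 * fcalc (root (Suc l)) c1"
      using oPE by simp
    then show ?thesis
      unfolding fcalc_orthogonal[OF c1(1) c2(1) c oc cr]
      by (intro qt_add[OF t] fcalc_root_positive c1 c2)
  qed
  have "step n \<precsim> c1 + c2"
  proof (rule compare[OF c])
    fix \<tau> assume \<tau>: "\<tau> \<in> T"
    note t = T[OF \<tau>]
    \<comment> \<open>Strict inequality for each root separately could be lost in the limit
      \<open>dim_fun\<close>; one \<open>B\<close> for all \<open>l\<close> preserves it.\<close>
    have "\<exists>B > \<tau> (step n) + \<rho>. \<forall>l. B \<le> \<tau> (fcalc (root (Suc l)) (c1 + c2))"
      using large[OF \<tau>]
    proof (elim disjE exE conjE)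
      fix B assume B: "\<tau> (step n) + \<rho> < B" "\<forall>X. \<tau> E \<le> X + of_nat m * \<tau> M \<longrightarrow> B \<le> X"
      have "B \<le> \<tau> (fcalc (root (Suc l)) c1)" for l
        using g1(8)[OF t, of l] B(2) by (simp add: c1_def)
      then have "\<forall>l. B \<le> \<tau> (fcalc (root (Suc l)) (c1 + c2))" by (simp add: root_add[OF t] add_increasing2)
      then show ?thesis using B(1) by blast
    next
      fix B assume B: "\<tau> (step n) + \<rho> < B" "\<forall>X. \<tau> P \<le> X + (\<Sum>j<n - s. \<tau> (step (s + j))) \<longrightarrow> B \<le> X"
      have "B \<le> \<tau> (fcalc (root (Suc l)) c2)" for l
        using g2(8)[OF t, of l] B(2) by (simp add: c2_def)
      then have "\<forall>l. B \<le> \<tau> (fcalc (root (Suc l)) (c1 + c2))" by (simp add: root_add[OF t] add_increasing)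
      then show ?thesis using B(1) by blast
    qed
    then obtain B where "\<tau> (step n) + \<rho> < B" "\<forall>l. B \<le> \<tau> (fcalc (root (Suc l)) (c1 + c2))" by blast
    then show "\<tau> (step n) + \<rho> < dim_fun \<tau> (c1 + c2)"
      using le_dim_fun[OF t c nc, of B] by simp
  qed
  then obtain v where v: "v\<^sup>\<star> * v = step n" "v * step n = v" "\<And>k. k * g = g \<Longrightarrow> k * v = v"
    unfolding gg[symmetric] by (rule partial_isometry_of_cuntz_le[OF projection_step gs]) blast
  have "(k1 + k2) * g = g" by (simp add: g_def algebra_simps o g1 g2)
  then have kv: "k1 * v + k2 * v = v" using v(3)[of "k1 + k2"] by (simp add: distrib_right)
  have PEg: "(P + E) * g = g"
    using cE(1) cP(1) PE by (simp add: g_def algebra_simps cornerD) (metis (no_types) PE add.right_neutral cornerD(1) mult.assoc mult_zero_left)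
  have Pk: "P * (k1 * v) = 0" "P * (k2 * v) = k2 * v" "E * (k1 * v) = k1 * v" "E * (k2 * v) = 0"
    using oPE(1)[OF corner_self[OF P] cE(2)] oPE(2)[OF cP(2) corner_self[OF E]] cE(2) cP(2)
    by (simp_all add: mult.assoc[symmetric] cornerD)
  have Ev: "E * v = k1 * v" using arg_cong[OF kv, of "\<lambda>x. E * x"] by (simp add: distrib_left Pk)
  have Pv: "P * v = k2 * v" using arg_cong[OF kv, of "\<lambda>x. P * x"] by (simp add: distrib_left Pk)
  have "(norm v)\<^sup>2 \<le> 1\<^sup>2" unfolding cstar_identity[symmetric] v(1) using norm_projection_le[OF projection_step] by simp
  then have v1: "norm v \<le> 1" by (rule power2_le_imp_le) simp
  have "transport P M E b m s n V \<delta> v k1"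
    unfolding transport_def
  proof (intro conjI allI impI v(1,2) g1(6) cE(2))
    show "(P + E) * v = v" by (rule v(3)[OF PEg])
    show "k1 * (E * v) = E * v"
    proof -
      have "k1 * (E * v) = k1 * v" using cE(2) by (simp add: mult.assoc[symmetric] cornerD)
      then show ?thesis by (simp add: Ev)
    qed
    show "norm (M * b i * k1) \<le> \<delta>" if "i < m" for i
      using g1(7)[OF that] cE(2) by (simp add: mult.assoc cornerD)
    fix j assume j: "s \<le> j" "j < n"
    have "(V j)\<^sup>\<star> * (P * v) = (V j)\<^sup>\<star> * P * k2 * v" using cP(2) by (simp add: Pv mult.assoc Pk(2))
    also have "norm \<dots> \<le> norm ((V j)\<^sup>\<star> * P * k2) * norm v" by (rule norm_mult_ineq)
    also have "\<dots> \<le> norm ((V j)\<^sup>\<star> * P * k2)" by (rule mult_left_le[OF v1]) simp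
    also have "\<dots> \<le> \<delta>" using g2(7)[of "j - s"] j by simp
    finally show "norm ((V j)\<^sup>\<star> * (P * v)) \<le> \<delta>" .
  qed
  then show ?thesis by blast
qed

lemma transports_of_comparison:
  fixes \<rho> :: real
  assumes T: "\<And>\<tau>. \<tau> \<in> T \<Longrightarrow> lsc_2quasitrace \<tau>" and \<rho>: "0 \<le> \<rho>"
    and compare: "\<And>n c. c \<in> positives \<Longrightarrow> (\<And>\<tau>. \<tau> \<in> T \<Longrightarrow> \<tau> (step n) + ennreal \<rho> < dim_fun \<tau> c) \<Longrightarrow> step n \<precsim> c"
    and split: "T = Tf \<union> Ti"
    and bounded: "\<And>n. \<exists>C::real. \<forall>\<tau>\<in>Ti. \<tau> (p n) \<le> ennreal C"
    and diverge: "\<And>C::real. \<exists>n. \<forall>\<tau>\<in>Ti. ennreal C \<le> \<tau> (p n)"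
    and fin: "\<And>\<tau> n. \<tau> \<in> Tf \<Longrightarrow> \<tau> (p n) < \<infinity>"
    and \<eta>: "0 < \<eta>" "\<And>\<tau>. \<tau> \<in> Tf \<Longrightarrow> ennreal (\<rho> + \<eta>) \<le> \<tau> (p N1)"
    and cauchy: "\<And>r. 0 < r \<Longrightarrow> \<exists>n. \<forall>\<tau>\<in>Tf. \<forall>j. \<tau> (p j) \<le> \<tau> (p n) + ennreal r"
  shows "\<exists>N0 N. transports N0 N \<and> (\<forall>n. \<phi> n \<le> N n)"
proof -
  have "\<exists>C. \<forall>n. 0 \<le> C n \<and> (\<forall>\<tau>\<in>Ti. \<tau> (p n) \<le> ennreal (C n))"
  proof (rule choice, rule allI)
    fix n
    obtain C where "\<forall>\<tau>\<in>Ti. \<tau> (p n) \<le> ennreal C" using bounded by blast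
    then show "\<exists>C. 0 \<le> C \<and> (\<forall>\<tau>\<in>Ti. \<tau> (p n) \<le> ennreal C)"
      by (intro exI[of _ "max C 0"]) (auto intro: order_trans[OF _ ennreal_leI])
  qed
  then obtain C where C: "\<And>n. 0 \<le> C n" "\<And>n \<tau>. \<tau> \<in> Ti \<Longrightarrow> \<tau> (p n) \<le> ennreal (C n)" by blast
  \<comment> \<open>One \<open>C l\<close> is lost because the new block excludes
    \<open>p (N n)\<close>, and at most \<open>n\<close> more to the supports of the
    \<open>b i\<close>, as \<open>m \<le> n\<close>. The remaining
    \<open>C (Suc n) + \<rho> + 1\<close> exceeds \<open>\<tau> (step n) + \<rho>\<close>.\<close>
  define K where "K n l = (real n + 1) * C l + C (Suc n) + \<rho> + 1" for n l
  have "\<exists>N. \<forall>n. (N1 \<le> N n \<and> \<phi> n \<le> N n) \<and> (N n < N (Suc n) \<and> (\<forall>\<tau>\<in>Ti. ennreal (K n (N n)) \<le> \<tau> (p (N (Suc n)))))"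
  proof (rule dependent_nat_choice)
    show "\<exists>l. N1 \<le> l \<and> \<phi> 0 \<le> l" by (rule exI[of _ "max N1 (\<phi> 0)"]) simp
    fix l n assume "N1 \<le> l \<and> \<phi> n \<le> l"
    obtain l' where l': "\<forall>\<tau>\<in>Ti. ennreal (K n l) \<le> \<tau> (p l')" using diverge by blast
    define L where "L = Suc l + \<phi> (Suc n) + N1 + l'"
    have "ennreal (K n l) \<le> \<tau> (p L)" if "\<tau> \<in> Ti" for \<tau>
      using l' that qt_p_mono[OF T, of \<tau> l' L] split by (force simp: L_def intro: order_trans)
    then show "\<exists>y. (N1 \<le> y \<and> \<phi> (Suc n) \<le> y) \<and> l < y \<and> (\<forall>\<tau>\<in>Ti. ennreal (K n l) \<le> \<tau> (p y))"
      by (intro exI[of _ L]) (auto simp: L_def)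
  qed
  then obtain N where N: "\<And>n. N1 \<le> N n" "\<And>n. \<phi> n \<le> N n" "\<And>n. N n < N (Suc n)"
    "\<And>n \<tau>. \<tau> \<in> Ti \<Longrightarrow> ennreal (K n (N n)) \<le> \<tau> (p (N (Suc n)))" by blast
  have mono: "strict_mono N" using N(3) by (simp add: strict_mono_Suc_iff)
  \<comment> \<open>From this index on, a single step and the sum of the earlier steps are each at
    most \<open>\<eta>/4\<close>. So \<open>\<rho> + \<eta> - \<eta>/4\<close> remains under
    \<open>p N1\<close>, more than \<open>\<rho> + \<eta>/2\<close>, while
    \<open>\<rho> + \<eta>/4\<close> suffices to cover the step.\<close>
  obtain n\<eta> where n\<eta>: "\<forall>\<tau>\<in>Tf. \<forall>j. \<tau> (p j) \<le> \<tau> (p n\<eta>) + ennreal (\<eta>/4)"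
    using cauchy[of "\<eta>/4"] \<eta>(1) by auto
  have "\<exists>v k. transport (p N1) (p (N n)) (p (N (Suc n)) - p (N n)) b m s n V \<delta> v k"
    if s: "max m n\<eta> \<le> s" "s \<le> n" and V: "\<forall>j. s \<le> j \<longrightarrow> j < n \<longrightarrow> V j * step j = V j" and \<delta>: "0 < \<delta>"
    for b m s n V \<delta>
  proof (rule transport_exists[OF T compare proj projection_diff proj _ _ _ \<delta>])
    show "N n \<le> N (Suc n)" using N(3)[of n] by simp
    show "p N1 * (p (N (Suc n)) - p (N n)) = 0" "(p (N (Suc n)) - p (N n)) * p N1 = 0"
      using N(1)[of n] N(1)[of "Suc n"] by (simp_all add: algebra_simps nested)
    show "V j * step j = V j" if "s \<le> j" "j < n" for j using V that by blast
    fix \<tau> assume \<tau>: "\<tau> \<in> T"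
    note t = T[OF \<tau>]
    have stepn: "\<tau> (p (Suc n)) = \<tau> (p n) + \<tau> (step n)"
      using qt_projection_diff[OF t, of n "Suc n"] by (simp add: step_def)
    let ?E = "p (N (Suc n)) - p (N n)"
    have pE: "\<tau> (p (N (Suc n))) = \<tau> (p (N n)) + \<tau> ?E"
      by (rule qt_projection_diff[OF t]) (use N(3)[of n] in simp)
    show "(\<exists>B > \<tau> (step n) + ennreal \<rho>. \<forall>X. \<tau> ?E \<le> X + of_nat m * \<tau> (p (N n)) \<longrightarrow> B \<le> X) \<or>
      (\<exists>B > \<tau> (step n) + ennreal \<rho>. \<forall>X. \<tau> (p N1) \<le> X + (\<Sum>j<n - s. \<tau> (step (s + j))) \<longrightarrow> B \<le> X)"
    proof (cases "\<tau> \<in> Ti")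
      case True
      have "\<tau> (step n) \<le> ennreal (C (Suc n))" using C(2)[OF True, of "Suc n"] unfolding stepn
        by (rule order_trans[OF add_increasing[OF zero_le order_refl]])
      then have "\<tau> (step n) + ennreal \<rho> \<le> ennreal (C (Suc n) + \<rho>)"
        using C(1) \<rho> by (simp add: ennreal_plus add_right_mono)
      also have "\<dots> < ennreal (C (Suc n) + \<rho> + 1)" using C(1)[of "Suc n"] \<rho> by (simp add: ennreal_lessI)
      finally have less: "\<tau> (step n) + ennreal \<rho> < ennreal (C (Suc n) + \<rho> + 1)" .
      have "ennreal (C (Suc n) + \<rho> + 1) \<le> X" if X: "\<tau> ?E \<le> X + of_nat m * \<tau> (p (N n))" for X
      proof (cases X)
        case (real r)
        have "ennreal (K n (N n)) \<le> \<tau> (p (N n)) + (ennreal r + of_nat m * \<tau> (p (N n)))"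
          using N(4)[OF True, of n] X unfolding pE real by (meson add_left_mono order_trans)
        also have "\<dots> \<le> ennreal (C (N n)) + (ennreal r + of_nat m * ennreal (C (N n)))"
          by (intro add_mono mult_left_mono C(2)[OF True] order_refl) simp
        also have "\<dots> = ennreal (C (N n) + (r + real m * C (N n)))"
          using C(1)[of "N n"] real by (simp add: ennreal_plus ennreal_mult ennreal_of_nat_eq_real_of_nat)
        finally have "K n (N n) \<le> C (N n) + (r + real m * C (N n))"
          using C(1)[of "N n"] real by (subst (asm) ennreal_le_iff) auto
        moreover have "real m * C (N n) \<le> real n * C (N n)"
          using s C(1) by (intro mult_right_mono) auto
        ultimately have "C (Suc n) + \<rho> + 1 \<le> r" by (simp add: K_def algebra_simps)
        then show ?thesis using real by (simp add: ennreal_leI)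
      qed simp
      then show ?thesis using less by blast
    next
      case False
      then have tf: "\<tau> \<in> Tf" using \<tau> split by blast
      have near: "\<tau> (p l) \<le> \<tau> (p l') + ennreal (\<eta>/4)" if "n\<eta> \<le> l'" for l l'
        using n\<eta> tf qt_p_mono[OF t that] by (meson add_right_mono order_trans)
      have cancel: "y \<le> ennreal (\<eta>/4)" if "\<tau> (p l) + y \<le> \<tau> (p l) + ennreal (\<eta>/4)" for l y
        using that fin[OF tf, of l] by (auto simp: ennreal_add_left_cancel_le)
      have st: "\<tau> (step n) \<le> ennreal (\<eta>/4)"
        using near[of n "Suc n"] s unfolding stepn by (intro cancel[of n]) simp
      have "\<tau> (p s) + (\<Sum>j<n - s. \<tau> (step (s + j))) \<le> \<tau> (p s) + ennreal (\<eta>/4)"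
        unfolding qt_sum_step[OF t] using s by (intro near) simp
      then have sum: "(\<Sum>j<n - s. \<tau> (step (s + j))) \<le> ennreal (\<eta>/4)" by (rule cancel)
      have "\<tau> (step n) + ennreal \<rho> \<le> ennreal (\<eta>/4 + \<rho>)"
        using st \<eta>(1) \<rho> by (simp add: ennreal_plus add_right_mono)
      also have "\<dots> < ennreal (\<rho> + \<eta>/2)" using \<eta>(1) \<rho> by (simp add: ennreal_lessI)
      finally have less: "\<tau> (step n) + ennreal \<rho> < ennreal (\<rho> + \<eta>/2)" .
      have "ennreal (\<rho> + \<eta>/2) \<le> X" if X: "\<tau> (p N1) \<le> X + (\<Sum>j<n - s. \<tau> (step (s + j)))" for X
      proof (cases X)
        case (real r)
        have "ennreal (\<rho> + \<eta>) \<le> ennreal r + ennreal (\<eta>/4)"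
          using \<eta>(2)[OF tf] X sum unfolding real by (meson add_left_mono order_trans)
        also have "\<dots> = ennreal (r + \<eta>/4)" using real \<eta>(1) by (simp add: ennreal_plus)
        finally have "\<rho> + \<eta> \<le> r + \<eta>/4" using real \<eta>(1) by (subst (asm) ennreal_le_iff) auto
        then show ?thesis using real \<eta>(1) by (simp add: ennreal_leI)
      qed simp
      then show ?thesis using less by blast
    qed
  qed
  then have "transports N1 N"
    unfolding transports_def using mono N(1)[of 0] by blast
  then show ?thesis using N(2) by blast
qed

end

section \<open>Admissible scales\<close>

lemma admissible_scale_unit:
  fixes p :: "nat \<Rightarrow> 'a::cstar_algebra"
  assumes unit: "projection_approx_unit p" and p0: "p 0 = 0"
  shows "nested_projection_unit p"
proof -
  have pr: "projection (p n)" for n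
    using unit p0 by (cases n) (auto simp: projection_approx_unit_def projection_def)
  interpret projection_unit p
    using unit pr by unfold_locales (auto simp: projection_approx_unit_def)
  have s: "p (Suc n) * p n = p n" "p n * p (Suc n) = p n" for n
    using projection_le[OF pr pr, of "Suc n" n] unit p0 by (cases n; auto simp: projection_approx_unit_def)+
  have "p n * p (n + d) = p n \<and> p (n + d) * p n = p n" for n d
  proof (induction d)
    case 0
    show ?case using pr[of n] by (simp add: projection_def)
  next
    case (Suc d)
    have "p n * p (n + Suc d) = p n * p (n + d) * p (Suc (n + d))" "p (n + Suc d) * p n = p (Suc (n + d)) * (p (n + d) * p n)"
      using Suc by simp_all
    then show ?case using Suc s[of "n + d"] by (metis mult.assoc)
  qed
  then have "p m * p n = p m" "p n * p m = p m" if "m \<le> n" for m n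
    using that by (metis le_add_diff_inverse)+
  then show ?thesis by unfold_locales
qed

lemma transports_of_admissible_scale:
  fixes p :: "nat \<Rightarrow> 'a::cstar_algebra"
  assumes sc: "admissible_scale T p \<rho> e \<epsilon>0"
  shows "\<exists>N0 N. nested_projection_unit.transports p N0 N \<and> (\<forall>n. \<phi> n \<le> N n)"
proof -
  have unit: "projection_approx_unit p" and p0: "p 0 = 0" and \<rho>: "0 \<le> \<rho>" and e: "e \<in> positives" "0 < \<epsilon>0"
    and T: "\<And>\<tau>. \<tau> \<in> T \<Longrightarrow> lsc_2quasitrace \<tau>"
    and comp: "\<And>n c. n \<ge> 1 \<Longrightarrow> c \<in> positives \<Longrightarrow>
      (\<forall>\<tau>\<in>T. dim_fun \<tau> (p n - p (n - 1)) + ennreal \<rho> < dim_fun \<tau> c) \<Longrightarrow> p n - p (n - 1) \<precsim> c"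
    and inf: "T_inf T p \<noteq> {} \<Longrightarrow> \<forall>n\<ge>1. (SUP \<tau>\<in>T_inf T p. \<tau> (p n)) < \<infinity>"
      "T_inf T p \<noteq> {} \<Longrightarrow> (\<lambda>n. INF \<tau>\<in>T_inf T p. \<tau> (p n)) \<longlonglongrightarrow> \<infinity>"
    and fin: "T_fin T p \<noteq> {} \<Longrightarrow> (INF \<tau>\<in>T_fin T p. dim_fun \<tau> (cut_down e \<epsilon>0)) > ennreal \<rho>"
      "T_fin T p \<noteq> {} \<Longrightarrow> (\<lambda>n. SUP \<tau>\<in>T_fin T p. (SUP j\<in>{1..}. \<tau> (p j)) - \<tau> (p n)) \<longlonglongrightarrow> 0"
    using sc unfolding admissible_scale_def by blast+
  interpret nested_projection_unit p by (rule admissible_scale_unit[OF unit p0])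
  define S where "S \<tau> = (SUP j\<in>{1..}. \<tau> (p j))" for \<tau> :: "'a \<Rightarrow> ennreal"
  have leS: "\<tau> (p n) \<le> S \<tau>" if "\<tau> \<in> T" for \<tau> n
    unfolding S_def using qt_zero[OF T[OF that]] by (cases n) (auto simp: p0 intro!: SUP_upper)
  have "x < \<infinity> \<or> x = \<infinity>" for x :: ennreal by (cases x) auto
  then have Tfi: "T = T_fin T p \<union> T_inf T p" unfolding T_fin_def T_inf_def by blast
  have TfT: "\<tau> \<in> T_fin T p \<Longrightarrow> \<tau> \<in> T" for \<tau> by (simp add: T_fin_def)
  have Sfin: "\<tau> \<in> T_fin T p \<Longrightarrow> S \<tau> < \<infinity>" for \<tau> by (simp add: T_fin_def S_def)
  have compare: "step n \<precsim> c"
    if "c \<in> positives" "\<And>\<tau>. \<tau> \<in> T \<Longrightarrow> \<tau> (step n) + ennreal \<rho> < dim_fun \<tau> c" for n c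
    using comp[of "Suc n" c] that by (simp add: step_def[symmetric] dim_fun_projection[OF T projection_step])
  have bounded: "\<exists>C::real. \<forall>\<tau>\<in>T_inf T p. \<tau> (p n) \<le> ennreal C" for n
  proof (cases "T_inf T p = {}")
    case False
    show ?thesis
    proof (cases "n = 0")
      case True
      then show ?thesis using qt_zero[OF T] by (intro exI[of _ 0]) (simp add: p0 T_inf_def)
    next
      case n: False
      let ?M = "SUP \<tau>\<in>T_inf T p. \<tau> (p n)"
      have "?M < \<infinity>" using inf(1)[OF False] n by simp
      then have "?M = ennreal (enn2real ?M)" by simp
      then have "\<forall>\<tau>\<in>T_inf T p. \<tau> (p n) \<le> ennreal (enn2real ?M)" by (metis SUP_upper)
      then show ?thesis by blast
    qed
  qed simp
  have diverge: "\<exists>n. \<forall>\<tau>\<in>T_inf T p. ennreal C \<le> \<tau> (p n)" for C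
  proof (cases "T_inf T p = {}")
    case False
    have "\<forall>\<^sub>F n in sequentially. ennreal C < (INF \<tau>\<in>T_inf T p. \<tau> (p n))"
      by (rule order_tendstoD(1)[OF inf(2)[OF False]]) simp
    then obtain n where "ennreal C < (INF \<tau>\<in>T_inf T p. \<tau> (p n))" by (auto simp: eventually_sequentially)
    from less_imp_le[OF less_INF_D[OF this]] show ?thesis by (intro exI[of _ n] ballI)
  qed simp
  have cauchy: "\<exists>n. \<forall>\<tau>\<in>T_fin T p. S \<tau> \<le> \<tau> (p n) + ennreal r" if r: "0 < r" for r
  proof (cases "T_fin T p = {}")
    case False
    have "\<forall>\<^sub>F n in sequentially. (SUP \<tau>\<in>T_fin T p. (SUP j\<in>{1..}. \<tau> (p j)) - \<tau> (p n)) < ennreal r"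
      by (rule order_tendstoD(2)[OF fin(2)[OF False]]) (simp add: r)
    then obtain n where n: "(SUP \<tau>\<in>T_fin T p. S \<tau> - \<tau> (p n)) < ennreal r" by (auto simp: eventually_sequentially S_def)
    have "S \<tau> \<le> \<tau> (p n) + ennreal r" if t: "\<tau> \<in> T_fin T p" for \<tau>
    proof -
      have "S \<tau> - \<tau> (p n) \<le> ennreal r" using n SUP_upper[OF t, of "\<lambda>\<tau>. S \<tau> - \<tau> (p n)"] by simp
      then have "\<tau> (p n) + (S \<tau> - \<tau> (p n)) \<le> \<tau> (p n) + ennreal r" by (rule add_left_mono)
      then show ?thesis using leS[OF TfT[OF t], of n] by (simp add: add_diff_inverse_ennreal)
    qed
    then show ?thesis by blast
  qed simp
  have "\<exists>\<eta> N1. 0 < \<eta> \<and> (\<forall>\<tau>\<in>T_fin T p. ennreal (\<rho> + \<eta>) \<le> \<tau> (p N1))"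
  proof (cases "T_fin T p = {}")
    case False
    obtain r where r: "ennreal \<rho> < ennreal r" "ennreal r < (INF \<tau>\<in>T_fin T p. dim_fun \<tau> (cut_down e \<epsilon>0))" "0 \<le> r"
    proof -
      obtain y where y: "ennreal \<rho> < y" "y < (INF \<tau>\<in>T_fin T p. dim_fun \<tau> (cut_down e \<epsilon>0))"
        using dense[OF fin(1)[OF False]] by blast
      then have "y < \<infinity>" by (auto simp: less_top[symmetric])
      then show thesis using y that[of "enn2real y"] by simp
    qed
    have \<rho>r: "\<rho> < r" using r(1,3) \<rho> by (simp add: ennreal_less_iff)
    have cut: "cut_down e \<epsilon>0 \<in> positives"
      unfolding cut_down_def by (rule fcalc_positive[OF e(1)]) (use e(2) in \<open>auto intro!: continuous_intros\<close>)
    \<comment> \<open>The element \<open>e\<close> serves only to push the total mass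
      \<open>S \<tau>\<close> above \<open>\<rho>\<close> by a uniform amount. Half of that amount,
      \<open>\<eta>\<close>, is then given up to replace \<open>S \<tau>\<close> by a single
      \<open>\<tau> (p n)\<close>.\<close>
    have rS: "ennreal r \<le> S \<tau>" if t: "\<tau> \<in> T_fin T p" for \<tau>
    proof -
      have "ennreal r \<le> dim_fun \<tau> (cut_down e \<epsilon>0)" using less_INF_D[OF r(2) t] by simp
      also have "\<dots> \<le> (SUP n. \<tau> (p n))" by (rule dim_fun_le_SUP[OF T[OF TfT[OF t]] cut])
      also have "\<dots> \<le> S \<tau>" by (rule SUP_least) (rule leS[OF TfT[OF t]])
      finally show ?thesis .
    qed
    define \<eta> where "\<eta> = (r - \<rho>) / 2"
    have \<eta>: "0 < \<eta>" "r = \<rho> + \<eta> + \<eta>" using \<rho>r by (auto simp: \<eta>_def field_simps)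
    obtain n where n: "\<forall>\<tau>\<in>T_fin T p. S \<tau> \<le> \<tau> (p n) + ennreal \<eta>" using cauchy[OF \<eta>(1)] by blast
    have "ennreal (\<rho> + \<eta>) \<le> \<tau> (p n)" if t: "\<tau> \<in> T_fin T p" for \<tau>
    proof -
      have "ennreal \<eta> + ennreal (\<rho> + \<eta>) = ennreal r" using \<eta> \<rho> by (simp add: ennreal_plus[symmetric] del: ennreal_plus)
      also have "\<dots> \<le> ennreal \<eta> + \<tau> (p n)" using rS[OF t] n t by (metis add.commute order_trans)
      finally show ?thesis by (simp add: ennreal_add_left_cancel_le)
    qed
    then show ?thesis using \<eta>(1) by blast
  qed (auto intro: exI[of _ 1])
  then obtain \<eta> N1 where \<eta>: "0 < \<eta>" "\<And>\<tau>. \<tau> \<in> T_fin T p \<Longrightarrow> ennreal (\<rho> + \<eta>) \<le> \<tau> (p N1)" by blast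
  show ?thesis
  proof (rule transports_of_comparison[where T = T and Tf = "T_fin T p" and Ti = "T_inf T p" and \<rho> = \<rho>])
    show "lsc_2quasitrace \<tau>" if "\<tau> \<in> T" for \<tau> using T[OF that] .
    show "step n \<precsim> c"
      if "c \<in> positives" "\<And>\<tau>. \<tau> \<in> T \<Longrightarrow> \<tau> (step n) + ennreal \<rho> < dim_fun \<tau> c" for n c
      using compare[OF that] .
    show "0 < \<eta>" by (rule \<eta>(1))
    show "ennreal (\<rho> + \<eta>) \<le> \<tau> (p N1)" if "\<tau> \<in> T_fin T p" for \<tau> by (rule \<eta>(2)[OF that])
    show "\<tau> (p n) < \<infinity>" if "\<tau> \<in> T_fin T p" for \<tau> n
      using leS[OF TfT[OF that], of n] Sfin[OF that] by (rule le_less_trans)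
    show "\<exists>n. \<forall>\<tau>\<in>T_fin T p. \<forall>j. \<tau> (p j) \<le> \<tau> (p n) + ennreal r" if "0 < r" for r
      using cauchy[OF that] leS[OF TfT] by (meson order_trans)
  qed (rule \<rho> Tfi bounded diverge)+
qed

theorem mainTheorem1:
  assumes nonunital: "\<not> (\<exists>u::'a::cstar_algebra. \<forall>a. u * a = a \<and> a * u = a)"
    and scale: "\<exists>(T :: ('a \<Rightarrow> ennreal) set) p \<rho> e \<epsilon>0. admissible_scale T p \<rho> e \<epsilon>0"
  shows "\<not> (\<exists>J :: 'a set. maximal_ideal J \<and> norm_dense J) \<and>
    (simple_cstar TYPE('a) \<longrightarrow> \<not> (\<exists>J :: 'a set. maximal_ideal J))"
proof -
  obtain T p \<rho> e \<epsilon>0 where sc: "admissible_scale (T :: ('a \<Rightarrow> ennreal) set) p \<rho> e \<epsilon>0"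
    using scale by blast
  have p0: "p 0 = 0" and unit: "projection_approx_unit p"
    using sc by (auto simp: admissible_scale_def)
  interpret nested_projection_unit p by (rule admissible_scale_unit[OF unit p0])
  have no_dense: False if J: "maximal_ideal J" "norm_dense J" for J :: "'a set"
  proof (rule no_maximal_ideal_with_transports[OF p0 J(1)])
    have "is_ideal J" using J(1) by (simp add: maximal_ideal_def proper_ideal_def)
    then show "p n \<in> J" for n by (rule projection_in_dense_ideal[OF _ J(2) proj])
  qed (rule transports_of_admissible_scale[OF sc])
  \<comment> \<open>The closure of \<open>J\<close> is a nonzero closed ideal, and a simple algebra
    has no proper one.\<close>
  moreover have "norm_dense J" if simple: "simple_cstar TYPE('a)" and J: "maximal_ideal J" for J :: "'a set"
  proof (rule ccontr)
    assume "\<not> norm_dense J"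
    then have "closure J \<subset> UNIV" by (auto simp: norm_dense_def)
    moreover have "{0} \<subset> closure J" "is_ideal (closure J)"
      using J closure_subset[of J] ideal_closure[of J] by (auto simp: maximal_ideal_def proper_ideal_def)
    ultimately have "proper_ideal (closure J)" by (simp add: proper_ideal_def)
    then show False using simple by (auto simp: simple_cstar_def)
  qed
  ultimately show ?thesis by blast
qed

end
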